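(* There exist universal constants $c,c',\widetilde{c}>0$ with the following property. Let $q\geq 1$, $d\in\mathbb{N}$ and $n\geq c\exp\exp(5d)+c'\exp(q^{3})$ ($n\in\mathbb{N}$). Let $\mu$ be a probability measure on $\mathbb{R}^{d}$ with a log-concave density function, let $(x_{i})_{1}^{n}$ be an i.i.d. sample from $\mu$, let $P_{n}=\operatorname{conv}\{x_{i}\}_{1}^{n}$ and let $F_{1/n}$ be the floating body of $\mu$ with parameter $1/n$. With probability at least $1-3^{d+3}(\log n)^{-q}$, $$d_{\mathfrak{L}}(P_{n},F_{1/n})\leq 1+\widetilde{c}\,d(d+q)\frac{\log\log n}{\log n}.$$
   Context: A density $f$ on $\mathbb{R}^d$ is log-concave if $f=e^{-g}$ with $g:\mathbb{R}^d\to(-\infty,\infty]$ convex. Floating body: for $x\in\mathbb{R}^d$ let $\widetilde{f}(x)=\inf_{\mathfrak{H}}\mu(\mathfrak{H})$, where $\mathfrak{H}$ runs through all open half-spaces containing $x$. For $\delta>0$, $F_{\delta}=\{x\in\mathbb{R}^{d}: \widetilde{f}(x)\geq\delta\}$. Logarithmic Hausdorff distance between convex bodies $K,L\subset\mathbb{R}^d$ (compact convex sets with nonempty interior): $$d_{\mathfrak{L}}(K,L)=\inf\{\lambda\geq1:\exists x\in\operatorname{int}(K\cap L),\ \lambda^{-1}(L-x)+x\subset K\subset\lambda(L-x)+x\},$$ with the convention $\inf(\varnothing)=\infty$. "Universal constant" means independent of $d,n,q,\mu$; $\log$ is the natural logarithm. *)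

theory Defs
  imports "HOL-Probability.Probability" "HOL-Library.Function_Algebras"
begin

text \<open>
  The constants of the theorem do not depend on the dimension, so the dimension has to be bound
  inside a formula and cannot be the cardinality of a type. Points of Euclidean d-space are
  therefore functions on the naturals in the extensional space over the index set below d,
  as in the library's finite product measures. Pointwise operations on functions
  give access to the library's notions of convexity.
\<close>

instantiation "fun" :: (type, real_vector) real_vector
begin

definition scaleR_fun_def: "r *\<^sub>R f = (\<lambda>x. r *\<^sub>R f x)"

instance
  by standard
    (simp_all add: scaleR_fun_def plus_fun_def fun_eq_iff scaleR_add_right scaleR_add_left)

end

definition Rn :: "nat \<Rightarrow> (nat \<Rightarrow> real) set" where
  "Rn d = ({..<d} \<rightarrow>\<^sub>E UNIV)"

definition Rn_topology :: "nat \<Rightarrow> (nat \<Rightarrow> real) topology" where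
  "Rn_topology d = product_topology (\<lambda>_. euclideanreal) {..<d}"

definition Rn_lborel :: "nat \<Rightarrow> (nat \<Rightarrow> real) measure" where
  "Rn_lborel d = PiM {..<d} (\<lambda>_. lborel)"

text \<open>
  An extensional function has the arbitrary but fixed value \<open>undefined\<close> outside the index set.
  Affine combinations preserve this value, and only these are ever formed: convex
  combinations, and homotheties about a point of the space.
\<close>

lemma affine_Rn: "affine (Rn d)"
  unfolding affine_def
proof (intro ballI allI impI)
  fix x y and u v :: real
  assume x: "x \<in> Rn d" and y: "y \<in> Rn d" and uv: "u + v = 1"
  have "(u *\<^sub>R x + v *\<^sub>R y) i = undefined" if "i \<notin> {..<d}" for i
  proof -
    have "x i = undefined" "y i = undefined"
      using x y that unfolding Rn_def by (blast intro: PiE_arb)+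
    then have "(u *\<^sub>R x + v *\<^sub>R y) i = (u + v) * undefined"
      by (simp add: scaleR_fun_def distrib_right)
    with uv show ?thesis by simp
  qed
  then show "u *\<^sub>R x + v *\<^sub>R y \<in> Rn d"
    unfolding Rn_def by (blast intro: PiE_I)
qed

lemma topspace_Rn_topology: "topspace (Rn_topology d) = Rn d"
  by (simp add: Rn_topology_def Rn_def)

lemma space_Rn_lborel: "space (Rn_lborel d) = Rn d"
  by (simp add: Rn_lborel_def Rn_def space_PiM)

text \<open>Convexity on the whole space of a function with values in \<open>(-\<infinity>, \<infinity>]\<close>.\<close>

definition convex_ext :: "nat \<Rightarrow> ((nat \<Rightarrow> real) \<Rightarrow> ereal) \<Rightarrow> bool" where
  "convex_ext d g \<longleftrightarrow>
     (\<forall>x\<in>Rn d. g x \<noteq> -\<infinity>) \<and>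
     (\<forall>x\<in>Rn d. \<forall>y\<in>Rn d. \<forall>t. 0 < t \<and> t < 1 \<longrightarrow>
        g ((1 - t) *\<^sub>R x + t *\<^sub>R y) \<le> ereal (1 - t) * g x + ereal t * g y)"

definition exp_neg :: "ereal \<Rightarrow> real" where
  "exp_neg a = (if a = \<infinity> then 0 else exp (- real_of_ereal a))"

definition log_concave :: "nat \<Rightarrow> ((nat \<Rightarrow> real) \<Rightarrow> real) \<Rightarrow> bool" where
  "log_concave d f \<longleftrightarrow> (\<exists>g. convex_ext d g \<and> (\<forall>x\<in>Rn d. f x = exp_neg (g x)))"

definition has_log_concave_density :: "nat \<Rightarrow> (nat \<Rightarrow> real) measure \<Rightarrow> bool" where
  "has_log_concave_density d \<mu> \<longleftrightarrow>
     (\<exists>f. f \<in> borel_measurable (Rn_lborel d) \<and> log_concave d f \<and>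
          \<mu> = density (Rn_lborel d) (\<lambda>x. ennreal (f x)))"

definition open_halfspaces :: "nat \<Rightarrow> (nat \<Rightarrow> real) set set" where
  "open_halfspaces d =
     {{y \<in> Rn d. (\<Sum>i<d. a i * y i) > b} | a b. \<exists>i<d. a i \<noteq> 0}"

definition floating_fun :: "nat \<Rightarrow> (nat \<Rightarrow> real) measure \<Rightarrow> (nat \<Rightarrow> real) \<Rightarrow> real" where
  "floating_fun d \<mu> x = (INF H\<in>{H \<in> open_halfspaces d. x \<in> H}. measure \<mu> H)"

definition floating_body :: "nat \<Rightarrow> (nat \<Rightarrow> real) measure \<Rightarrow> real \<Rightarrow> (nat \<Rightarrow> real) set" where
  "floating_body d \<mu> \<delta> = {x \<in> Rn d. floating_fun d \<mu> x \<ge> \<delta>}"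

text \<open>The infimum is taken in the extended reals, where that of the empty set is \<open>\<infinity>\<close>.\<close>

definition log_Hausdorff_dist :: "nat \<Rightarrow> (nat \<Rightarrow> real) set \<Rightarrow> (nat \<Rightarrow> real) set \<Rightarrow> ereal" where
  "log_Hausdorff_dist d K L =
     Inf (ereal ` {l. l \<ge> 1 \<and>
       (\<exists>x \<in> Rn_topology d interior_of (K \<inter> L).
          (\<lambda>y. (1 / l) *\<^sub>R (y - x) + x) ` L \<subseteq> K \<and>
          K \<subseteq> (\<lambda>y. l *\<^sub>R (y - x) + x) ` L)})"

end

theory Submission
  imports Defs "HOL-Real_Asymp.Real_Asymp"
begin

text \<open>
  Let \<open>z\<close> be the centroid of \<open>\<mu>\<close>, and for a direction \<open>u \<noteq> 0\<close> let \<open>Q u\<close> be the \<open>(1 - 1/n)\<close>-quantile of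
  \<open>\<langle>u, x - z\<rangle>\<close> under \<open>\<mu>\<close>. A point \<open>y\<close> lies in the floating body \<open>F\<close> of parameter \<open>1/n\<close> iff
  \<open>\<langle>u, y - z\<rangle> \<le> Q u\<close> for all \<open>u\<close>, and in the random polytope iff \<open>\<langle>u, y\<rangle> \<le> max\<^sub>i \<langle>u, x\<^sub>i\<rangle>\<close> for all \<open>u\<close>.
  Hence the two bodies are within logarithmic distance \<open>l\<close> of each other, with homotheties centred at
  \<open>z\<close>, as soon as \<open>Q u / l \<le> max\<^sub>i \<langle>u, x\<^sub>i - z\<rangle> \<le> l * Q u\<close> holds simultaneously in all directions
  (\<open>log_Hausdorff_dist_le_if_directions\<close>). The function \<open>Q\<close> may exceed the support function of \<open>F\<close>; both
  inclusions are read off from the description of \<open>F\<close> by half-spaces.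

  For one direction this is the one-dimensional law of Gnedenko. By Prekopa's theorem
  (\<open>log_concave_marginal_PiM\<close>) the tail \<open>g t = \<mu> {x. \<langle>u, x - z\<rangle> > t}\<close> is log-concave. It is at least
  \<open>1/8\<close> at \<open>0\<close> (\<open>centered_depth\<close>) and drops to \<open>1/n\<close> at \<open>Q u\<close>, so the decay of \<open>ln g\<close> beyond \<open>Q u\<close> is at least
  its average decay before: \<open>g\<close> is at most \<open>(8/n)\<^sup>\<eta> / n\<close> at \<open>(1 + 3 * \<eta>) * Q u\<close> and at least
  \<open>(n/8)\<^sup>\<eta> / n\<close> at \<open>(1 - 2 * \<eta>) * Q u\<close>. The maximum of \<open>n\<close> independent samples therefore leaves this
  window with probability at most \<open>2 * (8/n)\<^sup>\<eta>\<close>. For \<open>\<eta> = 12 * d * (d + q) * ln (ln n) / ln n\<close> that is at most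
  \<open>2 * (ln n)\<close> to the power \<open>- 6 * d * (d + q)\<close>.

  This leaves room for a union bound over \<open>(ln n)\<close> to the power \<open>O(d)\<close> directions, which suffice. In
  coordinates with respect to a basis of directions that is orthonormal for the covariance form, a
  grid of mesh \<open>1/m\<close> with \<open>m\<close> polynomial in \<open>ln n\<close> is fine enough: between the standard
  deviation of \<open>\<langle>u, x\<rangle>\<close> and \<open>Q u\<close> there is at most a factor of order \<open>ln n\<close>
  (\<open>quantile_ge_dev\<close>, \<open>quantile_le_dev\<close>), so that moving \<open>u\<close> to the nearest grid direction changes all
  quantities by a negligible fraction of \<open>Q u\<close> (\<open>net_controls_unit_directions\<close>).

  A probability is asserted for a set that is defined by an infimum over real factors and centres,
  so its measurability requires a proof as well (\<open>measurable_log_Hausdorff_dist_le\<close>).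
\<close>

section \<open>Log-concavity of marginals\<close>

lemma interval_length_approx:
  fixes I :: "real set"
  assumes "I \<noteq> {}" "convex I" "0 \<le> r" "ennreal r < emeasure lborel I"
  obtains a b where "a \<in> I" "b \<in> I" "r < b - a"
proof (rule ccontr)
  assume "\<not> thesis"
  with that have small: "\<And>a b. a \<in> I \<Longrightarrow> b \<in> I \<Longrightarrow> b - a \<le> r"
    by (meson not_le)
  obtain x where x: "x \<in> I" using assms by auto
  have bd: "bdd_above I" "bdd_below I"
  proof -
    have "\<And>y. y \<in> I \<Longrightarrow> y \<le> x + r" using small[OF x] by (simp add: algebra_simps)
    then show "bdd_above I" by (auto simp: bdd_above_def)
    have "\<And>y. y \<in> I \<Longrightarrow> x - r \<le> y" using small[OF _ x] by (simp add: algebra_simps)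
    then show "bdd_below I" by (auto simp: bdd_below_def)
  qed
  have sub: "I \<subseteq> {Inf I..Sup I}"
    using bd by (auto intro: cInf_lower cSup_upper)
  have "Sup I \<le> Inf I + r"
  proof (rule cSup_least[OF assms(1)])
    fix b assume b: "b \<in> I"
    have "b - r \<le> Inf I"
      by (rule cInf_greatest[OF assms(1)]) (use small[OF _ b] in \<open>simp add: algebra_simps\<close>)
    then show "b \<le> Inf I + r" by simp
  qed
  moreover have le: "Inf I \<le> Sup I" using cInf_lower[OF x bd(2)] cSup_upper[OF x bd(1)] by simp
  moreover have "emeasure lborel I \<le> emeasure lborel {Inf I..Sup I}"
    by (rule emeasure_mono[OF sub]) simp
  ultimately have "emeasure lborel I \<le> ennreal r"
    using assms(3) by (auto simp: emeasure_lborel_Icc_eq intro: order.trans[OF _ ennreal_leI])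
  with assms(4) show False by simp
qed

text \<open>
  The Brunn-Minkowski inequality on the line. Only intervals occur, because the level sets of
  log-concave functions are convex; for them the inequality reduces to adding the lengths of
  compact subintervals.
\<close>

lemma emeasure_convex_combination_le:
  fixes I J S :: "real set"
  assumes I: "I \<noteq> {}" "convex I" and J: "J \<noteq> {}" "convex J" and t: "0 < t" "t < 1"
    and S: "S \<in> sets lborel"
    and sub: "\<And>x y. x \<in> I \<Longrightarrow> y \<in> J \<Longrightarrow> (1 - t) * x + t * y \<in> S"
  shows "ennreal (1 - t) * emeasure lborel I + ennreal t * emeasure lborel J \<le> emeasure lborel S"
proof -
  have step: "ennreal ((1 - t) * r + t * s) \<le> emeasure lborel S"
    if r: "a \<in> I" "b \<in> I" "r = b - a" "0 \<le> r" and s: "c \<in> J" "e \<in> J" "s = e - c" "0 \<le> s"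
    for a b c e r s
  proof -
    have ab: "a \<le> b" "c \<le> e" using r s by auto
    have "{(1 - t) * a + t * c..(1 - t) * b + t * e} \<subseteq> S"
    proof
      fix w assume w: "w \<in> {(1 - t) * a + t * c..(1 - t) * b + t * e}"
      define D where "D = (1 - t) * r + t * s"
      have D0: "0 \<le> D" unfolding D_def using r s t by auto
      have eD: "(1 - t) * b + t * e = (1 - t) * a + t * c + D" unfolding D_def r(3) s(3) by (simp add: algebra_simps)
      obtain \<theta> where \<theta>: "0 \<le> \<theta>" "\<theta> \<le> 1" "w = (1 - t) * a + t * c + \<theta> * D"
      proof (cases "D = 0")
        case True then show ?thesis using that[of 0] w eD by auto
      next
        case False
        then show ?thesis using that[of "(w - ((1 - t) * a + t * c)) / D"] w eD D0
          by (auto simp: field_simps)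
      qed
      have "a + \<theta> * r \<in> I"
        using convexD[OF I(2) r(1,2), of "1 - \<theta>" \<theta>] \<theta> by (simp add: r(3) algebra_simps)
      moreover have "c + \<theta> * s \<in> J"
        using convexD[OF J(2) s(1,2), of "1 - \<theta>" \<theta>] \<theta> by (simp add: s(3) algebra_simps)
      ultimately have "(1 - t) * (a + \<theta> * r) + t * (c + \<theta> * s) \<in> S" by (rule sub)
      moreover have "w = (1 - t) * (a + \<theta> * r) + t * (c + \<theta> * s)"
        by (simp add: \<theta>(3) D_def algebra_simps)
      ultimately show "w \<in> S" by simp
    qed
    then have "emeasure lborel {(1 - t) * a + t * c..(1 - t) * b + t * e} \<le> emeasure lborel S"
      by (rule emeasure_mono[OF _ S])
    moreover have "(1 - t) * a + t * c \<le> (1 - t) * b + t * e"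
      using ab t by (intro add_mono mult_left_mono) auto
    moreover have "(1 - t) * b + t * e - ((1 - t) * a + t * c) = (1 - t) * r + t * s"
      unfolding r(3) s(3) by (simp add: algebra_simps)
    ultimately show ?thesis by (metis emeasure_lborel_Icc)
  qed
  have appr: "\<exists>a\<in>K. \<exists>b\<in>K. r \<le> b - a \<and> 0 \<le> b - a"
    if "K \<noteq> {}" "convex K" "r = 0 \<or> (0 \<le> r \<and> ennreal r < emeasure lborel K)" for K r
  proof (cases "r = 0")
    case True then show ?thesis using that by force
  next
    case False
    then have "0 \<le> r" "ennreal r < emeasure lborel K" using that by auto
    from interval_length_approx[OF that(1,2) this] obtain a b where "a \<in> K" "b \<in> K" "r < b - a" .
    then show ?thesis using \<open>0 \<le> r\<close> by (intro bexI[of _ a] bexI[of _ b]) auto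
  qed
  have main: "ennreal (1 - t) * ennreal r + ennreal t * ennreal s \<le> emeasure lborel S"
    if hr: "r = 0 \<or> (0 \<le> r \<and> ennreal r < emeasure lborel I)"
      and hs: "s = 0 \<or> (0 \<le> s \<and> ennreal s < emeasure lborel J)" for r s
  proof -
    obtain a b where ab: "a \<in> I" "b \<in> I" "r \<le> b - a" "0 \<le> b - a" using appr[OF I hr] by auto
    obtain c e where ce: "c \<in> J" "e \<in> J" "s \<le> e - c" "0 \<le> e - c" using appr[OF J hs] by auto
    have "ennreal (1 - t) * ennreal r + ennreal t * ennreal s = ennreal ((1 - t) * r + t * s)"
      using t hr hs by (auto simp flip: ennreal_mult ennreal_plus)
    also have "\<dots> \<le> ennreal ((1 - t) * (b - a) + t * (e - c))"
      using ab ce t by (intro ennreal_leI add_mono mult_left_mono) auto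
    also have "\<dots> \<le> emeasure lborel S"
      using step[OF ab(1,2) refl ab(4) ce(1,2) refl ce(4)] .
    finally show ?thesis .
  qed
  have sup: "x = (SUP r\<in>{r. r = 0 \<or> (0 \<le> r \<and> ennreal r < x)}. ennreal r)" for x :: ennreal
  proof (rule antisym)
    \<comment> \<open>Allowing r = 0 unconditionally keeps the index set nonempty when x = 0.\<close>
    show "x \<le> (SUP r\<in>{r. r = 0 \<or> (0 \<le> r \<and> ennreal r < x)}. ennreal r)"
    proof (rule dense_le)
      fix y assume "y < x"
      then have "y \<noteq> \<top>" by auto
      then obtain r where "y = ennreal r" "0 \<le> r" by (cases y) auto
      then show "y \<le> (SUP r\<in>{r. r = 0 \<or> (0 \<le> r \<and> ennreal r < x)}. ennreal r)"
        using \<open>y < x\<close> by (intro SUP_upper2[of r]) auto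
    qed
    show "(SUP r\<in>{r. r = 0 \<or> (0 \<le> r \<and> ennreal r < x)}. ennreal r) \<le> x"
      by (rule SUP_least) auto
  qed
  show ?thesis
    apply (subst sup[of "emeasure lborel I"])
    apply (subst sup[of "emeasure lborel J"])
    apply (subst SUP_mult_left_ennreal)
    apply (subst SUP_mult_left_ennreal)
    apply (subst ennreal_SUP_add_left[symmetric])
     apply force
    apply (rule SUP_least)
    apply (subst ennreal_SUP_add_right)
     apply force
    apply (rule SUP_least)
    using main apply auto
    done
qed

lemma nn_integral_layer_cake:
  assumes "sigma_finite_measure M" and [measurable]: "f \<in> borel_measurable M"
  shows "(\<integral>\<^sup>+x. f x \<partial>M) =
    (\<integral>\<^sup>+s. indicator {0..} s * emeasure M {x\<in>space M. ennreal s < f x} \<partial>lborel)"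
proof -
  interpret M: sigma_finite_measure M by fact
  interpret P: pair_sigma_finite lborel M
    by (simp add: pair_sigma_finite_def sigma_finite_lborel assms)
  have eq: "emeasure lborel {s. 0 \<le> s \<and> ennreal s < v} = v" for v :: ennreal
  proof (cases v)
    case (real r)
    then have "{s. 0 \<le> s \<and> ennreal s < v} = {0..<r}"
      by (auto simp: ennreal_less_iff)
    then show ?thesis using real by simp
  next
    case top
    then have "{s. 0 \<le> s \<and> ennreal s < v} = {0..}" by auto
    moreover have "emeasure lborel {0::real..} = \<top>"
    proof (rule ccontr)
      assume "emeasure lborel {0::real..} \<noteq> \<top>"
      then obtain r where r: "emeasure lborel {0::real..} = ennreal r" "0 \<le> r"
        by (cases "emeasure lborel {0::real..}") auto
      have "emeasure lborel {0..r + 1} \<le> emeasure lborel {0::real..}"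
        by (rule emeasure_mono) auto
      then show False using r by (simp add: ennreal_le_iff del: ennreal_plus)
    qed
    ultimately show ?thesis using top by simp
  qed
  have "(\<integral>\<^sup>+x. f x \<partial>M) =
      (\<integral>\<^sup>+x. (\<integral>\<^sup>+s. indicator {s. 0 \<le> s \<and> ennreal s < f x} s \<partial>lborel) \<partial>M)"
    by (rule nn_integral_cong, subst nn_integral_indicator) (auto simp: eq)
  also have "\<dots> = (\<integral>\<^sup>+s. (\<integral>\<^sup>+x. indicator {s. 0 \<le> s \<and> ennreal s < f x} s \<partial>M) \<partial>lborel)"
  proof (rule P.Fubini')
    have "(\<lambda>z. indicator {z. 0 \<le> fst z \<and> ennreal (fst z) < f (snd z)} z)
      \<in> borel_measurable (lborel \<Otimes>\<^sub>M M)"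
      by measurable
    then show "(\<lambda>(s, x). indicator {s. 0 \<le> s \<and> ennreal s < f x} s)
      \<in> borel_measurable (lborel \<Otimes>\<^sub>M M)"
      by (simp add: case_prod_beta' indicator_def)
  qed
  also have "\<dots> = (\<integral>\<^sup>+s. indicator {0..} s * emeasure M {x\<in>space M. ennreal s < f x} \<partial>lborel)"
  proof (rule nn_integral_cong)
    fix s :: real
    have "(\<integral>\<^sup>+x. indicator {s. 0 \<le> s \<and> ennreal s < f x} s \<partial>M) =
       (\<integral>\<^sup>+x. indicator {0..} s * indicator {x\<in>space M. ennreal s < f x} x \<partial>M)"
      by (rule nn_integral_cong) (auto simp: indicator_def)
    also have "\<dots> = indicator {0..} s * emeasure M {x\<in>space M. ennreal s < f x}"
      by (subst nn_integral_cmult_indicator) auto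
    finally show "(\<integral>\<^sup>+x. indicator {s. 0 \<le> s \<and> ennreal s < f x} s \<partial>M) = \<dots>" .
  qed
  finally show ?thesis .
qed

text \<open>
  When both functions have supremum exactly 1, the superlevel sets of \<open>f\<close> and \<open>g\<close> are nonempty for
  the same levels, namely those below 1. The inequality for intervals can then be applied level by
  level and integrated.
\<close>

lemma prekopa_leindler_normalized:
  fixes f g h :: "real \<Rightarrow> ennreal"
  assumes [measurable]: "f \<in> borel_measurable lborel" "g \<in> borel_measurable lborel" "h \<in> borel_measurable lborel"
    and t: "0 < t" "t < 1"
    and qc: "\<And>c. convex {x. c < f x}" "\<And>c. convex {x. c < g x}"
    and le1: "\<And>x. f x \<le> 1" "\<And>x. g x \<le> 1"
    and sup1: "\<And>s. s < 1 \<Longrightarrow> \<exists>x. ennreal s < f x" "\<And>s. s < 1 \<Longrightarrow> \<exists>x. ennreal s < g x"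
    and comp: "\<And>x y s. 0 < s \<Longrightarrow> ennreal s < f x \<Longrightarrow> ennreal s < g y \<Longrightarrow> ennreal s \<le> h ((1 - t) * x + t * y)"
  shows "ennreal (1 - t) * (\<integral>\<^sup>+x. f x \<partial>lborel) + ennreal t * (\<integral>\<^sup>+x. g x \<partial>lborel) \<le> (\<integral>\<^sup>+x. h x \<partial>lborel)"
proof -
  let ?L = "\<lambda>f s. indicator {0..} s * emeasure lborel {x. ennreal s < f x}"
  have lc: "(\<integral>\<^sup>+x. f x \<partial>lborel) = (\<integral>\<^sup>+s. ?L f s \<partial>lborel)"
    if "f \<in> borel_measurable lborel" for f :: "real \<Rightarrow> ennreal"
    using nn_integral_layer_cake[OF sigma_finite_lborel that] by simp
  have meas: "?L f \<in> borel_measurable lborel" if [measurable]: "f \<in> borel_measurable lborel" for f :: "real \<Rightarrow> ennreal"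
  proof -
    have "(\<lambda>s. emeasure lborel (Pair s -` {z\<in>space (lborel \<Otimes>\<^sub>M lborel). ennreal (fst z) < f (snd z)})) \<in> borel_measurable lborel"
      by (rule lborel.measurable_emeasure_Pair) measurable
    then have "(\<lambda>s. emeasure lborel {x. ennreal s < f x}) \<in> borel_measurable lborel"
      by (simp add: vimage_def space_pair_measure)
    then show ?thesis by measurable
  qed
  have "ennreal (1 - t) * (\<integral>\<^sup>+x. f x \<partial>lborel) + ennreal t * (\<integral>\<^sup>+x. g x \<partial>lborel) =
     (\<integral>\<^sup>+s. ennreal (1 - t) * ?L f s + ennreal t * ?L g s \<partial>lborel)"
    unfolding lc[OF assms(1)] lc[OF assms(2)] using meas[OF assms(1)] meas[OF assms(2)]
    by (simp add: nn_integral_add nn_integral_cmult)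
  also have "\<dots> \<le> (\<integral>\<^sup>+s. ?L h s \<partial>lborel)"
  proof (rule nn_integral_mono_AE, rule AE_mp[OF AE_lborel_singleton[of 0]], rule AE_I2, intro impI)
    fix s :: real assume s0: "s \<noteq> 0"
    show "ennreal (1 - t) * ?L f s + ennreal t * ?L g s \<le> ?L h s"
    proof (cases "0 \<le> s")
      case True
      with s0 have s: "0 < s" by simp
      show ?thesis
      proof (cases "s < 1")
        case lt: True
        have "ennreal (1 - t) * emeasure lborel {x. ennreal s < f x} + ennreal t * emeasure lborel {x. ennreal s < g x}
          \<le> emeasure lborel {x. ennreal s < h x}"
        proof (rule emeasure_convex_combination_le[OF _ qc(1) _ qc(2) t])
          fix x y assume "x \<in> {x. ennreal s < f x}" "y \<in> {x. ennreal s < g x}"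
          then have "ennreal s < min (f x) (g y)" by simp
          then obtain v where v: "ennreal s < v" "v < min (f x) (g y)" using dense by blast
          then obtain r where r: "v = ennreal r" "0 \<le> r"
            by (cases v) auto
          with v s have "s < r" by (simp add: ennreal_less_iff)
          then have "ennreal r \<le> h ((1 - t) * x + t * y)" using comp[of r x y] v r s by auto
          then show "(1 - t) * x + t * y \<in> {x. ennreal s < h x}" using v r by auto
        qed (use sup1 lt in auto)
        then show ?thesis using s by simp
      next
        case False
        then have "\<not> ennreal s < f x" "\<not> ennreal s < g x" for x
          using le1[of x] by (auto simp: not_less ennreal_le_iff intro: order.trans[of _ 1])
        then show ?thesis by simp
      qed
    qed simp
  qed
  also have "\<dots> = (\<integral>\<^sup>+x. h x \<partial>lborel)" by (rule lc[OF assms(3), symmetric])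
  finally show ?thesis .
qed

text \<open>
  Log-concavity is stated below with strict lower bounds for the function values. This limit
  recovers the inequality for the values themselves.
\<close>

lemma ennreal_powr_mult_le:
  fixes A B :: real
  assumes "0 \<le> A" "0 \<le> B" "0 < t" "t < 1"
    "\<And>a b. 0 < a \<Longrightarrow> a < A \<Longrightarrow> 0 < b \<Longrightarrow> b < B \<Longrightarrow> ennreal (a powr (1 - t) * b powr t) \<le> c"
  shows "ennreal (A powr (1 - t) * B powr t) \<le> c"
proof (cases "A = 0 \<or> B = 0 \<or> c = \<top>")
  case True then show ?thesis using assms by auto
next
  case False
  then obtain r where r: "c = ennreal r" "0 \<le> r" by (cases c) auto
  have AB: "0 < A" "0 < B" using False assms by auto
  have "A powr (1 - t) * B powr t \<le> r"
  proof (rule field_le_mult_one_interval)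
    fix z :: real assume z: "0 < z" "z < 1"
    have "ennreal ((z * A) powr (1 - t) * (z * B) powr t) \<le> c"
      using z AB by (intro assms(5)) auto
    moreover have "(z * A) powr (1 - t) * (z * B) powr t = z * (A powr (1 - t) * B powr t)"
      using z AB by (simp add: powr_mult powr_diff) 
    ultimately show "z * (A powr (1 - t) * B powr t) \<le> r" using r by (simp add: ennreal_le_iff)
  qed
  then show ?thesis using r by (simp add: ennreal_le_iff)
qed

lemma ennreal_less_divide_iff:
  fixes v :: ennreal
  assumes "0 < M"
  shows "ennreal s < v / ennreal M \<longleftrightarrow> ennreal (s * M) < v"
proof (cases v)
  case (real r)
  show ?thesis
  proof (cases "0 \<le> s")
    case True
    with real assms show ?thesis
      by (simp add: divide_ennreal ennreal_less_iff pos_less_divide_eq)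
  next
    case False
    then have "s * M \<le> 0" using assms by (simp add: mult_nonpos_nonneg)
    with real assms False show ?thesis by (simp add: divide_ennreal ennreal_neg zero_less_divide_iff)
  qed
next
  case top then show ?thesis by (simp add: ennreal_top_divide)
qed

lemma ennreal_le_divide_iff:
  fixes v :: ennreal
  assumes "0 < M" "0 \<le> s"
  shows "ennreal s \<le> v / ennreal M \<longleftrightarrow> ennreal (s * M) \<le> v"
proof (cases v)
  case (real r)
  with assms show ?thesis
    by (simp add: divide_ennreal ennreal_le_iff pos_le_divide_eq)
next
  case top then show ?thesis by (simp add: ennreal_top_divide)
qed

lemma ennreal_divide_le_1:
  fixes v :: ennreal
  assumes "0 < M" "v \<le> ennreal M"
  shows "v / ennreal M \<le> 1"
  using assms by (cases v) (auto simp: divide_ennreal ennreal_le_iff top_unique simp flip: ennreal_1)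

text \<open>
  Cutting \<open>f\<close> off at a large height makes its supremum finite, as the normalization in
  \<open>prekopa_leindler_normalized\<close> requires, and keeps the integral above any given smaller number.
\<close>

lemma truncation_integral:
  fixes f :: "real \<Rightarrow> ennreal"
  assumes [measurable]: "f \<in> borel_measurable lborel" and a: "0 \<le> a" "ennreal a < (\<integral>\<^sup>+x. f x \<partial>lborel)"
  obtains M k where "0 < M" "ennreal M = (SUP x. min (f x) (of_nat k))"
    "ennreal a < (\<integral>\<^sup>+x. min (f x) (of_nat k) \<partial>lborel)"
proof -
  have "(SUP k. \<integral>\<^sup>+x. min (f x) (of_nat k) \<partial>lborel) = (\<integral>\<^sup>+x. (SUP k. min (f x) (of_nat k)) \<partial>lborel)"
    by (rule nn_integral_monotone_convergence_SUP[symmetric])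
      (auto simp: incseq_def le_fun_def ennreal_of_nat_eq_real_of_nat intro!: min.coboundedI2 ennreal_leI)
  also have "\<dots> = (\<integral>\<^sup>+x. f x \<partial>lborel)"
  proof (rule nn_integral_cong)
    fix x
    show "(SUP k. min (f x) (of_nat k)) = f x"
    proof (rule antisym)
      show "f x \<le> (SUP k. min (f x) (of_nat k))"
      proof (cases "f x")
        case (real r)
        obtain k :: nat where "r \<le> real k" using real_arch_simple by blast
        then have "f x \<le> of_nat k" using real by (simp add: ennreal_of_nat_eq_real_of_nat ennreal_leI)
        then show ?thesis by (intro SUP_upper2[of k]) auto
      next
        case top
        have "(SUP k. of_nat k :: ennreal) = \<top>" by (rule ennreal_SUP_of_nat_eq_top)
        moreover have "(\<lambda>k. min (f x) (of_nat k)) = of_nat" using top by (simp add: fun_eq_iff)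
        ultimately show ?thesis by (metis top_greatest)
      qed
    qed (auto intro!: SUP_least)
  qed
  finally obtain k where k: "ennreal a < (\<integral>\<^sup>+x. min (f x) (of_nat k) \<partial>lborel)"
    using a(2) by (metis (no_types, lifting) less_SUP_iff)
  define S where "S = (SUP x. min (f x) (of_nat k))"
  have "S \<le> of_nat k" unfolding S_def by (rule SUP_least) auto
  then have "S \<noteq> \<top>" by (auto simp: top_unique ennreal_of_nat_eq_real_of_nat)
  moreover have "S \<noteq> 0"
  proof
    assume "S = 0"
    then have "min (f x) (of_nat k) = 0" for x
      unfolding S_def by (metis SUP_upper UNIV_I le_zero_eq)
    then have "(\<integral>\<^sup>+x. min (f x) (of_nat k) \<partial>lborel) = 0" by simp
    with k show False by simp
  qed
  ultimately obtain M where "S = ennreal M" "0 < M"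
    by (cases S) (auto simp: less_le)
  then show ?thesis using that[of M k] k S_def by simp
qed

text \<open>
  After truncation both functions are divided by their suprema; the arithmetic-geometric inequality
  turns the resulting sum of normalized integrals into the product.
\<close>

lemma prekopa_leindler_real:
  fixes f g h :: "real \<Rightarrow> ennreal"
  assumes [measurable]: "f \<in> borel_measurable lborel" "g \<in> borel_measurable lborel" "h \<in> borel_measurable lborel"
    and t: "0 < t" "t < 1"
    and qc: "\<And>c. convex {x. c < f x}" "\<And>c. convex {x. c < g x}"
    and comp: "\<And>x y a b. 0 < a \<Longrightarrow> 0 < b \<Longrightarrow> ennreal a < f x \<Longrightarrow> ennreal b < g y \<Longrightarrow>
        ennreal (a powr (1 - t) * b powr t) \<le> h ((1 - t) * x + t * y)"
    and a: "0 < a" "ennreal a < (\<integral>\<^sup>+x. f x \<partial>lborel)"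
    and b: "0 < b" "ennreal b < (\<integral>\<^sup>+x. g x \<partial>lborel)"
  shows "ennreal (a powr (1 - t) * b powr t) \<le> (\<integral>\<^sup>+x. h x \<partial>lborel)"
proof -
  obtain M k where M: "0 < M" "ennreal M = (SUP x. min (f x) (of_nat k))"
    "ennreal a < (\<integral>\<^sup>+x. min (f x) (of_nat k) \<partial>lborel)"
    using truncation_integral[OF assms(1) less_imp_le[OF a(1)] a(2)] .
  obtain N l where N: "0 < N" "ennreal N = (SUP x. min (g x) (of_nat l))"
    "ennreal b < (\<integral>\<^sup>+x. min (g x) (of_nat l) \<partial>lborel)"
    using truncation_integral[OF assms(2) less_imp_le[OF b(1)] b(2)] .
  define K where "K = M powr (1 - t) * N powr t"
  have K: "0 < K" using M N by (simp add: K_def)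
  let ?f = "\<lambda>x. min (f x) (of_nat k) / ennreal M" and ?g = "\<lambda>x. min (g x) (of_nat l) / ennreal N"
    and ?h = "\<lambda>x. h x / ennreal K"
  have qc': "convex {x. c < min (u x) (of_nat k) / ennreal M}"
    if "\<And>c. convex {x. c < u x}" "0 < M" for u :: "real \<Rightarrow> ennreal" and M c k
  proof (cases c)
    case (real r)
    then have "{x. c < min (u x) (of_nat k) / ennreal M} = {x. ennreal (r * M) < u x} \<inter> {x. ennreal (r * M) < of_nat k}"
      using that(2) by (auto simp: ennreal_less_divide_iff)
    then show ?thesis using that(1) by (auto intro: convex_Int)
  qed simp
  have sup: "\<exists>x. ennreal s < u x / ennreal M" if "ennreal M = (SUP x. u x)" "0 < M" "s < 1"
    for s M and u :: "real \<Rightarrow> ennreal"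
  proof -
    have "ennreal (s * M) < ennreal M"
      using that(2,3) by (intro ennreal_lessI) auto
    then have "\<exists>x. ennreal (s * M) < u x" by (simp add: that(1) less_SUP_iff)
    then show ?thesis using that(2) by (simp only: ennreal_less_divide_iff)
  qed
  have "ennreal (1 - t) * (\<integral>\<^sup>+x. ?f x \<partial>lborel) + ennreal t * (\<integral>\<^sup>+x. ?g x \<partial>lborel) \<le> (\<integral>\<^sup>+x. ?h x \<partial>lborel)"
  proof (rule prekopa_leindler_normalized[OF _ _ _ t])
    show "convex {x. c < ?f x}" for c by (rule qc'[OF qc(1) M(1)])
    show "convex {x. c < ?g x}" for c by (rule qc'[OF qc(2) N(1)])
    show "?f x \<le> 1" for x
      by (rule ennreal_divide_le_1[OF M(1)]) (unfold M(2), rule SUP_upper, simp)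
    show "?g x \<le> 1" for x
      by (rule ennreal_divide_le_1[OF N(1)]) (unfold N(2), rule SUP_upper, simp)
    show "\<exists>x. ennreal s < ?f x" if "s < 1" for s using sup[OF M(2,1) that] .
    show "\<exists>x. ennreal s < ?g x" if "s < 1" for s using sup[OF N(2,1) that] .
    fix x y s :: real assume s: "0 < s" "ennreal s < ?f x" "ennreal s < ?g y"
    have "ennreal ((s * M) powr (1 - t) * (s * N) powr t) \<le> h ((1 - t) * x + t * y)"
      using s M(1) N(1) by (intro comp) (auto simp: ennreal_less_divide_iff)
    moreover have "(s * M) powr (1 - t) * (s * N) powr t = s * K"
      using s M N by (simp add: K_def powr_mult powr_diff)
    ultimately show "ennreal s \<le> ?h ((1 - t) * x + t * y)"
      using K s by (simp add: ennreal_le_divide_iff)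
  qed measurable
  moreover have "ennreal (a / M) \<le> (\<integral>\<^sup>+x. ?f x \<partial>lborel)"
    using M(1,3) a by (simp add: nn_integral_divide ennreal_le_divide_iff less_imp_le)
  moreover have "ennreal (b / N) \<le> (\<integral>\<^sup>+x. ?g x \<partial>lborel)"
    using N(1,3) b by (simp add: nn_integral_divide ennreal_le_divide_iff less_imp_le)
  ultimately have "ennreal (1 - t) * ennreal (a / M) + ennreal t * ennreal (b / N) \<le> (\<integral>\<^sup>+x. ?h x \<partial>lborel)"
    by (meson add_mono mult_left_mono order.trans zero_le)
  moreover have "ennreal (1 - t) * ennreal (a / M) + ennreal t * ennreal (b / N) = ennreal ((1 - t) * (a / M) + t * (b / N))"
    using a b M N t by (simp flip: ennreal_mult ennreal_plus)
  moreover have "(a / M) powr (1 - t) * (b / N) powr t \<le> (1 - t) * (a / M) + t * (b / N)"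
    using a b M N t by (intro Youngs_inequality_0) auto
  ultimately have "ennreal ((a / M) powr (1 - t) * (b / N) powr t) \<le> (\<integral>\<^sup>+x. ?h x \<partial>lborel)"
    by (metis ennreal_leI order.trans)
  also have "\<dots> = (\<integral>\<^sup>+x. h x \<partial>lborel) / ennreal K" by (rule nn_integral_divide) measurable
  finally have "ennreal ((a / M) powr (1 - t) * (b / N) powr t * K) \<le> (\<integral>\<^sup>+x. h x \<partial>lborel)"
    using K by (simp add: ennreal_le_divide_iff)
  moreover have "(a / M) powr (1 - t) * (b / N) powr t * K = a powr (1 - t) * b powr t"
    using a b M N by (simp add: K_def powr_divide)
  ultimately show ?thesis by simp
qed

text \<open>
  Partial integrals of a log-concave density may be infinite on a null set, so values in
  \<open>[0, \<infinity>]\<close> are unavoidable in the induction over coordinates. Quantifying over real numbers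
  strictly below the two values avoids powers of infinity.
\<close>

definition log_concave_ennreal :: "('b::real_vector \<Rightarrow> ennreal) \<Rightarrow> bool" where
  "log_concave_ennreal F \<longleftrightarrow> (\<forall>x y t a b. 0 < t \<longrightarrow> t < 1 \<longrightarrow> 0 < a \<longrightarrow> 0 < b \<longrightarrow>
     ennreal a < F x \<longrightarrow> ennreal b < F y \<longrightarrow>
     ennreal (a powr (1 - t) * b powr t) \<le> F ((1 - t) *\<^sub>R x + t *\<^sub>R y))"

lemma log_concave_ennrealD:
  "log_concave_ennreal F \<Longrightarrow> 0 < t \<Longrightarrow> t < 1 \<Longrightarrow> 0 < a \<Longrightarrow> 0 < b \<Longrightarrow>
    ennreal a < F x \<Longrightarrow> ennreal b < F y \<Longrightarrow> ennreal (a powr (1 - t) * b powr t) \<le> F ((1 - t) *\<^sub>R x + t *\<^sub>R y)"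
  unfolding log_concave_ennreal_def by blast

lemma log_concave_ennreal_level_convex:
  assumes "log_concave_ennreal F"
  shows "convex {x. c < F x}"
proof (rule convexI)
  fix x y and u v :: real
  assume xy: "x \<in> {x. c < F x}" "y \<in> {x. c < F x}" and uv: "0 \<le> u" "0 \<le> v" "u + v = 1"
  show "u *\<^sub>R x + v *\<^sub>R y \<in> {x. c < F x}"
  proof (cases "u = 0 \<or> v = 0")
    case True then show ?thesis using xy uv by auto
  next
    case False
    have "c < min (F x) (F y)" using xy by simp
    then obtain w where w: "c < w" "w < min (F x) (F y)" using dense by blast
    have "0 < w" "w \<noteq> \<top>" using w by (auto simp: not_less_zero intro: gr_zeroI)
    then obtain r where r: "w = ennreal r" "0 < r" by (cases w) auto
    have "ennreal (r powr (1 - v) * r powr v) \<le> F ((1 - v) *\<^sub>R x + v *\<^sub>R y)"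
      using False uv w r by (intro log_concave_ennrealD[OF assms]) auto
    moreover have "r powr (1 - v) * r powr v = r" using r by (simp add: powr_diff)
    moreover have "1 - v = u" using uv by simp
    ultimately show ?thesis using w r by auto
  qed
qed

lemma log_concave_marginal_real:
  fixes F :: "'b::real_vector \<times> real \<Rightarrow> ennreal"
  assumes F: "log_concave_ennreal F" and meas: "\<And>b. (\<lambda>y. F (b, y)) \<in> borel_measurable lborel"
  shows "log_concave_ennreal (\<lambda>b. \<integral>\<^sup>+y. F (b, y) \<partial>lborel)"
  unfolding log_concave_ennreal_def
proof (intro allI impI)
  fix x y :: 'b and t a b :: real
  assume *: "0 < t" "t < 1" "0 < a" "0 < b"
     "ennreal a < (\<integral>\<^sup>+ z. F (x, z) \<partial>lborel)" "ennreal b < (\<integral>\<^sup>+ z. F (y, z) \<partial>lborel)"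
  have conv: "convex {z. c < F (b, z)}" for c b
  proof -
    have "{z. c < F (b, z)} = {z. (b, z) \<in> {w. c < F w}}" by simp
    moreover have "convex {z. (b, z) \<in> {w. c < F w}}"
    proof (rule convexI)
      fix p q u v :: real assume "p \<in> {z. (b, z) \<in> {w. c < F w}}" "q \<in> {z. (b, z) \<in> {w. c < F w}}" "0 \<le> u" "0 \<le> v" "u + v = 1"
      then show "u *\<^sub>R p + v *\<^sub>R q \<in> {z. (b, z) \<in> {w. c < F w}}"
        using convexD[OF log_concave_ennreal_level_convex[OF F, of c], of "(b, p)" "(b, q)" u v]
        by (simp flip: scaleR_left_distrib)
    qed
    ultimately show ?thesis by simp
  qed
  show "ennreal (a powr (1 - t) * b powr t) \<le> (\<integral>\<^sup>+ z. F ((1 - t) *\<^sub>R x + t *\<^sub>R y, z) \<partial>lborel)"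
  proof (rule prekopa_leindler_real[OF meas meas meas *(1,2) conv conv _ *(3,5,4,6)])
    fix p q a b :: real assume "0 < a" "0 < b" "ennreal a < F (x, p)" "ennreal b < F (y, q)"
    from log_concave_ennrealD[OF F *(1,2) this]
    show "ennreal (a powr (1 - t) * b powr t) \<le> F ((1 - t) *\<^sub>R x + t *\<^sub>R y, (1 - t) * p + t * q)" by simp
  qed
qed

text \<open>
  Prekopa's theorem: one coordinate after the other is integrated out. The parameter \<open>b\<close> stays
  arbitrary so that the remaining coordinates can be carried along with it in the induction.
  Log-concavity is required on the whole function space, whereas measurability is known only for
  extensional arguments; the invariance under \<open>restrict\<close> mediates between the two.
\<close>

lemma log_concave_marginal_PiM:
  fixes F :: "'b::real_vector \<times> ('i \<Rightarrow> real) \<Rightarrow> ennreal"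
  assumes "finite I" "log_concave_ennreal F"
    and "\<And>b. (\<lambda>x. F (b, x)) \<in> borel_measurable (PiM I (\<lambda>_. lborel))"
    and "\<And>b x. F (b, restrict x I) = F (b, x)"
  shows "log_concave_ennreal (\<lambda>b. \<integral>\<^sup>+x. F (b, x) \<partial>PiM I (\<lambda>_. lborel))"
  using assms
proof (induction I arbitrary: F rule: finite_induct)
  case empty
  have "log_concave_ennreal (\<lambda>b. F (b, (\<lambda>_. undefined)))"
    unfolding log_concave_ennreal_def
  proof (intro allI impI)
    fix x y :: 'b and t a b :: real
    assume "0 < t" "t < 1" "0 < a" "0 < b" "ennreal a < F (x, \<lambda>_. undefined)" "ennreal b < F (y, \<lambda>_. undefined)"
    from log_concave_ennrealD[OF empty(1) this]
    have "ennreal (a powr (1 - t) * b powr t)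
        \<le> F ((1 - t) *\<^sub>R x + t *\<^sub>R y, (1 - t) *\<^sub>R (\<lambda>_. undefined) + t *\<^sub>R (\<lambda>_. undefined))"
      by simp
    moreover have "(1 - t) *\<^sub>R (\<lambda>_::'i. undefined :: real) + t *\<^sub>R (\<lambda>_. undefined) = (\<lambda>_. undefined)"
      by (simp flip: scaleR_left_distrib)
    ultimately show "ennreal (a powr (1 - t) * b powr t) \<le> F ((1 - t) *\<^sub>R x + t *\<^sub>R y, \<lambda>_. undefined)"
      by metis
  qed
  then show ?case by (simp add: PiM_empty nn_integral_count_space_finite)
next
  case (insert i I F)
  interpret product_sigma_finite "\<lambda>_::'i. lborel :: real measure"
    by standard
  define G where "G = (\<lambda>(b, x). \<integral>\<^sup>+y. F (b, x(i := y)) \<partial>lborel)"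
  have Fr: "F (b, x(i := y)) = F (b, (restrict x I)(i := y))" for b x y
  proof -
    have "F (b, x(i := y)) = F (b, restrict (x(i := y)) (insert i I))" by (rule insert.prems(3)[symmetric])
    also have "restrict (x(i := y)) (insert i I) = restrict ((restrict x I)(i := y)) (insert i I)"
      by (auto simp: fun_eq_iff restrict_def)
    also have "F (b, \<dots>) = F (b, (restrict x I)(i := y))" by (rule insert.prems(3))
    finally show ?thesis .
  qed
  have m1: "(\<lambda>(x, y). F (b, x(i := y))) \<in> borel_measurable (PiM I (\<lambda>_. lborel) \<Otimes>\<^sub>M lborel)" for b
    using measurable_compose[OF measurable_add_dim insert.prems(2)[of b]]
    by (simp add: case_prod_beta' fun_upd_def)
  have m2: "(\<lambda>y. F (b, x(i := y))) \<in> borel_measurable lborel" for b x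
  proof -
    have "restrict x I \<in> space (PiM I (\<lambda>_. lborel))" by (simp add: space_PiM)
    from measurable_compose[OF measurable_Pair1'[OF this] m1[of b]]
    show ?thesis unfolding Fr[of b x] by simp
  qed
  have "log_concave_ennreal (\<lambda>b. \<integral>\<^sup>+x. G (b, x) \<partial>PiM I (\<lambda>_. lborel))"
  proof (rule insert.IH)
    have "log_concave_ennreal (\<lambda>w. \<integral>\<^sup>+y. (\<lambda>(w, y). F (fst w, (snd w)(i := y))) (w, y) \<partial>lborel)"
    proof (rule log_concave_marginal_real)
      show "log_concave_ennreal (\<lambda>(w, y). F (fst w, (snd w)(i := y)))"
        unfolding log_concave_ennreal_def
      proof (intro allI impI)
        fix x y :: "('b \<times> ('i \<Rightarrow> real)) \<times> real" and t a b :: real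
        assume *: "0 < t" "t < 1" "0 < a" "0 < b"
          "ennreal a < (case x of (w, y) \<Rightarrow> F (fst w, (snd w)(i := y)))"
          "ennreal b < (case y of (w, y) \<Rightarrow> F (fst w, (snd w)(i := y)))"
        obtain x1 x2 x3 y1 y2 y3 where xy: "x = ((x1, x2), x3)" "y = ((y1, y2), y3)"
          by (metis prod.exhaust_sel)
        have e: "(1 - t) *\<^sub>R (x2(i := x3)) + t *\<^sub>R (y2(i := y3)) = ((1 - t) *\<^sub>R x2 + t *\<^sub>R y2)(i := (1 - t) *\<^sub>R x3 + t *\<^sub>R y3)"
          by (auto simp: fun_eq_iff scaleR_fun_def)
        have "ennreal a < F (x1, x2(i := x3))" "ennreal b < F (y1, y2(i := y3))" using * xy by auto
        from log_concave_ennrealD[OF insert.prems(1) *(1-4) this]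
        show "ennreal (a powr (1 - t) * b powr t) \<le>
          (case (1 - t) *\<^sub>R x + t *\<^sub>R y of (w, y) \<Rightarrow> F (fst w, (snd w)(i := y)))"
          by (simp only: xy scaleR_Pair add_Pair e prod.case fst_conv snd_conv)
      qed
      show "(\<lambda>y. (\<lambda>(w, y). F (fst w, (snd w)(i := y))) (b, y)) \<in> borel_measurable lborel" for b
        using m2[of "fst b" "snd b"] by simp
    qed
    then show "log_concave_ennreal G" by (simp add: G_def case_prod_beta')
    show "(\<lambda>x. G (b, x)) \<in> borel_measurable (PiM I (\<lambda>_. lborel))" for b
      using lborel.borel_measurable_nn_integral[OF m1[of b]] by (simp add: G_def)
    show "G (b, restrict x I) = G (b, x)" for b x
      unfolding G_def prod.case by (subst (2) Fr) simp
  qed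
  moreover have "(\<integral>\<^sup>+x. F (b, x) \<partial>PiM (insert i I) (\<lambda>_. lborel)) = (\<integral>\<^sup>+x. G (b, x) \<partial>PiM I (\<lambda>_. lborel))" for b
    unfolding G_def prod.case using insert.hyps insert.prems(2)
    by (rule product_nn_integral_insert)
  ultimately show ?case by simp
qed

definition ip :: "nat \<Rightarrow> (nat \<Rightarrow> real) \<Rightarrow> (nat \<Rightarrow> real) \<Rightarrow> real" where
  "ip d u x = (\<Sum>i<d. u i * x i)"

lemma ip_restrict: "ip d u (restrict x {..<d}) = ip d u x"
  by (simp add: ip_def)

lemma ip_affine: "ip d u (a *\<^sub>R x + b *\<^sub>R y) = a * ip d u x + b * ip d u y"
  by (simp add: ip_def scaleR_fun_def sum.distrib sum_distrib_left algebra_simps)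

lemma exp_neg_log_concave:
  assumes g: "convex_ext d g" and xy: "x \<in> Rn d" "y \<in> Rn d" and t: "0 < t" "t < 1"
    and ab: "0 < a" "0 < b" "a < exp_neg (g x)" "b < exp_neg (g y)"
  shows "a powr (1 - t) * b powr t \<le> exp_neg (g ((1 - t) *\<^sub>R x + t *\<^sub>R y))"
proof -
  have c: "g ((1 - t) *\<^sub>R x + t *\<^sub>R y) \<le> ereal (1 - t) * g x + ereal t * g y"
    using g xy t unfolding convex_ext_def by blast
  obtain p where p: "g x = ereal p" using g xy ab by (cases "g x") (auto simp: convex_ext_def exp_neg_def)
  obtain q where q: "g y = ereal q" using g xy ab by (cases "g y") (auto simp: convex_ext_def exp_neg_def)
  have mem: "(1 - t) *\<^sub>R x + t *\<^sub>R y \<in> Rn d"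
    using affine_Rn[of d] xy unfolding affine_def by simp
  obtain r where r: "g ((1 - t) *\<^sub>R x + t *\<^sub>R y) = ereal r"
    using g mem c p q by (cases "g ((1 - t) *\<^sub>R x + t *\<^sub>R y)") (auto simp: convex_ext_def)
  have "r \<le> (1 - t) * p + t * q" using c p q r by simp
  then have "exp (- ((1 - t) * p + t * q)) \<le> exp (- r)" by (subst exp_le_cancel_iff) simp
  moreover have "a powr (1 - t) * b powr t \<le> exp (- p) powr (1 - t) * exp (- q) powr t"
    using ab p q t by (intro mult_mono powr_mono2) (auto simp: exp_neg_def)
  moreover have "exp (- p) powr (1 - t) * exp (- q) powr t = exp (- ((1 - t) * p + t * q))"
    by (simp add: powr_def algebra_simps flip: exp_add)
  ultimately have "a powr (1 - t) * b powr t \<le> exp (- r)" by linarith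
  then show ?thesis using r by (simp add: exp_neg_def)
qed

lemma borel_measurable_ip[measurable]: "ip d u \<in> borel_measurable (Rn_lborel d)"
  unfolding ip_def[abs_def] Rn_lborel_def by measurable

text \<open>
  The set of all \<open>(s, x)\<close> with \<open>s < ip d u x\<close> is convex, hence its indicator times the density is
  log-concave in \<open>s\<close> and \<open>x\<close> jointly, and the measure of a half-space is a marginal of it.
\<close>

lemma halfspace_emeasure_log_concave:
  assumes f: "f \<in> borel_measurable (Rn_lborel d)" "log_concave d f"
  shows "log_concave_ennreal (\<lambda>s. emeasure (density (Rn_lborel d) (\<lambda>x. ennreal (f x))) {x \<in> Rn d. s < ip d u x})"
proof -
  \<comment> \<open>The restriction extends the density to all functions; it commutes with affine combinations, because these fix the value undefined.\<close>
  define F :: "real \<times> (nat \<Rightarrow> real) \<Rightarrow> ennreal" where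
    "F = (\<lambda>(s, x). ennreal (f (restrict x {..<d})) * indicator {x. s < ip d u x} x)"
  have "log_concave_ennreal (\<lambda>s. \<integral>\<^sup>+x. F (s, x) \<partial>PiM {..<d} (\<lambda>_. lborel))"
  proof (rule log_concave_marginal_PiM)
    show "log_concave_ennreal F"
      unfolding log_concave_ennreal_def
    proof (intro allI impI)
      fix x y :: "real \<times> (nat \<Rightarrow> real)" and t a b :: real
      assume *: "0 < t" "t < 1" "0 < a" "0 < b" "ennreal a < F x" "ennreal b < F y"
      obtain s x' r y' where xy: "x = (s, x')" "y = (r, y')" by (metis prod.exhaust_sel)
      have x': "s < ip d u x'" "a < f (restrict x' {..<d})"
        using * xy by (cases "s < ip d u x'"; simp add: F_def ennreal_less_iff)+
      have y': "r < ip d u y'" "b < f (restrict y' {..<d})"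
        using * xy by (cases "r < ip d u y'"; simp add: F_def ennreal_less_iff)+
      obtain g where g: "convex_ext d g" "\<And>x. x \<in> Rn d \<Longrightarrow> f x = exp_neg (g x)"
        using f(2) unfolding log_concave_def by blast
      have R: "restrict x {..<d} \<in> Rn d" for x by (simp add: Rn_def)
      have e: "(1 - t) *\<^sub>R restrict x' {..<d} + t *\<^sub>R restrict y' {..<d} = restrict ((1 - t) *\<^sub>R x' + t *\<^sub>R y') {..<d}"
      proof (rule ext)
        fix i
        have "(1 - t) * (undefined::real) + t * undefined = undefined" by (simp add: algebra_simps)
        then show "((1 - t) *\<^sub>R restrict x' {..<d} + t *\<^sub>R restrict y' {..<d}) i = restrict ((1 - t) *\<^sub>R x' + t *\<^sub>R y') {..<d} i"
          by (simp add: scaleR_fun_def restrict_def)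
      qed
      have "a powr (1 - t) * b powr t \<le> f (restrict ((1 - t) *\<^sub>R x' + t *\<^sub>R y') {..<d})"
        using exp_neg_log_concave[OF g(1) R R *(1-4), of x' y'] x' y' by (simp add: g R e)
      moreover have "(1 - t) * s + t * r < ip d u ((1 - t) *\<^sub>R x' + t *\<^sub>R y')"
        unfolding ip_affine using x' y' * by (intro add_strict_mono mult_strict_left_mono) auto
      ultimately show "ennreal (a powr (1 - t) * b powr t) \<le> F ((1 - t) *\<^sub>R x + t *\<^sub>R y)"
        by (simp add: xy F_def ennreal_leI)
    qed
    show "(\<lambda>x. F (b, x)) \<in> borel_measurable (PiM {..<d} (\<lambda>_. lborel))" for b
    proof -
      have "(\<lambda>x. ennreal (f x) * indicator {x \<in> space (Rn_lborel d). b < ip d u x} x) \<in> borel_measurable (Rn_lborel d)"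
        using f(1) by measurable
      then show ?thesis
        unfolding Rn_lborel_def
        by (rule measurable_cong[THEN iffD1, rotated])
          (auto simp: F_def space_PiM indicator_def PiE_restrict)
    qed
    show "F (b, restrict x {..<d}) = F (b, x)" for b x
      by (simp add: F_def indicator_def ip_restrict)
  qed simp
  moreover have "(\<integral>\<^sup>+x. F (s, x) \<partial>PiM {..<d} (\<lambda>_. lborel)) =
     emeasure (density (Rn_lborel d) (\<lambda>x. ennreal (f x))) {x \<in> Rn d. s < ip d u x}" for s
  proof -
    have "{x \<in> space (Rn_lborel d). s < ip d u x} \<in> sets (Rn_lborel d)" by measurable
    then have "emeasure (density (Rn_lborel d) (\<lambda>x. ennreal (f x))) {x \<in> Rn d. s < ip d u x} =
       (\<integral>\<^sup>+x. ennreal (f x) * indicator {x \<in> Rn d. s < ip d u x} x \<partial>Rn_lborel d)"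
      using f(1) by (subst emeasure_density) (auto simp: space_Rn_lborel)
    also have "\<dots> = (\<integral>\<^sup>+x. F (s, x) \<partial>Rn_lborel d)"
      by (rule nn_integral_cong) (auto simp: F_def space_Rn_lborel indicator_def Rn_def PiE_restrict)
    finally show ?thesis by (simp add: Rn_lborel_def)
  qed
  ultimately show ?thesis by simp
qed

section \<open>Real random variables with log-concave tails\<close>

text \<open>
  Both moments are controlled at once by \<open>exp (Y / (2 * b)) - 1\<close>, which dominates the linear and the
  quadratic term of its Taylor expansion. With half of the available exponential rate its
  tail at level \<open>s\<close> is at most \<open>A / (1 + s)\<^sup>2\<close>, whose integral is \<open>A\<close>.
\<close>

lemma (in prob_space) exp_tail_moments:
  assumes [measurable]: "Y \<in> borel_measurable M" and b: "0 < b" and A: "0 \<le> A"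
    and tail: "\<And>t. 0 \<le> t \<Longrightarrow> prob {x\<in>space M. t < Y x} \<le> A * exp (- t / b)"
  shows "integrable M (\<lambda>x. (max 0 (Y x))\<^sup>2)" "expectation (\<lambda>x. (max 0 (Y x))\<^sup>2) \<le> 8 * b\<^sup>2 * A"
    "integrable M (\<lambda>x. max 0 (Y x))" "expectation (\<lambda>x. max 0 (Y x)) \<le> 2 * b * A"
proof -
  define Z where "Z x = max 0 (exp (Y x / (2 * b)) - 1)" for x
  have [measurable]: "Z \<in> borel_measurable M" unfolding Z_def by measurable
  have "(\<integral>\<^sup>+x. ennreal (Z x) \<partial>M) =
      (\<integral>\<^sup>+s. indicator {0..} s * emeasure M {x\<in>space M. ennreal s < ennreal (Z x)} \<partial>lborel)"
    by (rule nn_integral_layer_cake[OF sigma_finite_measure_axioms]) measurable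
  also have "\<dots> \<le> (\<integral>\<^sup>+s. ennreal (A / (1 + s)\<^sup>2) * indicator {0..} s \<partial>lborel)"
  proof (rule nn_integral_mono)
    fix s :: real
    show "indicator {0..} s * emeasure M {x\<in>space M. ennreal s < ennreal (Z x)} \<le> ennreal (A / (1 + s)\<^sup>2) * indicator {0..} s"
    proof (cases "0 \<le> s")
      case True
      have "s < Z x \<longleftrightarrow> 2 * b * ln (1 + s) < Y x" for x
      proof -
        have "s < Z x \<longleftrightarrow> 1 + s < exp (Y x / (2 * b))" unfolding Z_def using True by auto
        also have "\<dots> \<longleftrightarrow> ln (1 + s) < Y x / (2 * b)" using True
          by (metis add_pos_nonneg exp_gt_zero exp_less_cancel_iff exp_ln zero_less_one)
        also have "\<dots> \<longleftrightarrow> 2 * b * ln (1 + s) < Y x" using b by (simp add: field_simps)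
        finally show ?thesis .
      qed
      then have "emeasure M {x\<in>space M. ennreal s < ennreal (Z x)} = prob {x\<in>space M. 2 * b * ln (1 + s) < Y x}"
        using True by (simp add: ennreal_less_iff emeasure_eq_measure)
      also have "\<dots> \<le> ennreal (A * exp (- (2 * b * ln (1 + s)) / b))"
        using True b by (intro ennreal_leI tail) auto
      also have "exp (- (2 * b * ln (1 + s)) / b) = 1 / (1 + s)\<^sup>2"
      proof -
        have "- (2 * b * ln (1 + s)) / b = - (2 * ln (1 + s))" using b by simp
        moreover have "exp (2 * ln (1 + s)) = (1 + s)\<^sup>2" using True by (simp add: exp_double)
        ultimately show ?thesis by (simp add: exp_minus inverse_eq_divide)
      qed
      finally show ?thesis using True by simp
    qed simp
  qed
  also have "\<dots> = ennreal (0 - (- A / (1 + 0)))"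
  proof (rule nn_integral_FTC_atLeast)
    fix x :: real assume x: "0 \<le> x"
    show "((\<lambda>s. - A / (1 + s)) has_real_derivative A / (1 + x)\<^sup>2) (at x)"
      using x by (auto intro!: derivative_eq_intros simp: power2_eq_square field_simps)
    show "0 \<le> A / (1 + x)\<^sup>2" using A by simp
  next
    show "((\<lambda>s. - A / (1 + s)) \<longlongrightarrow> 0) at_top"
      by (intro tendsto_divide_0[OF tendsto_const] filterlim_at_top_imp_at_infinity
          filterlim_tendsto_add_at_top[OF tendsto_const filterlim_ident])
  qed measurable
  finally have Z: "(\<integral>\<^sup>+x. ennreal (Z x) \<partial>M) \<le> ennreal A" by simp
  have Z2: "(max 0 (Y x))\<^sup>2 \<le> 8 * b\<^sup>2 * Z x" and Z1: "max 0 (Y x) \<le> 2 * b * Z x" for x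
  proof -
    define y where "y = max 0 (Y x) / (2 * b)"
    have y: "0 \<le> y" "max 0 (Y x) = 2 * b * y" using b by (auto simp: y_def)
    have "y + y\<^sup>2 / 2 \<le> exp y - 1" using exp_lower_Taylor_quadratic[OF y(1)] by simp
    also have "exp y - 1 = Z x"
      using b divide_nonpos_pos[of "Y x" "2 * b"] divide_nonneg_pos[of "Y x" "2 * b"]
      by (cases "0 \<le> Y x") (auto simp: y_def Z_def max_def)
    finally have *: "y + y\<^sup>2 / 2 \<le> Z x" .
    have "y\<^sup>2 \<le> 2 * Z x" using * y(1) by simp
    then have "4 * b\<^sup>2 * y\<^sup>2 \<le> 4 * b\<^sup>2 * (2 * Z x)" by (intro mult_left_mono) auto
    then show "(max 0 (Y x))\<^sup>2 \<le> 8 * b\<^sup>2 * Z x" unfolding y(2) by (simp add: power_mult_distrib)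
    have "y \<le> Z x" using * zero_le_power2[of y] by linarith
    then show "max 0 (Y x) \<le> 2 * b * Z x" unfolding y(2) using b by simp
  qed
  have Z0: "0 \<le> Z x" for x by (simp add: Z_def)
  have bound: "integrable M f \<and> expectation f \<le> C * A"
    if [measurable]: "f \<in> borel_measurable M" and f: "\<And>x. 0 \<le> f x" "\<And>x. f x \<le> C * Z x" "0 \<le> C" for f C
  proof -
    have "(\<integral>\<^sup>+x. ennreal (f x) \<partial>M) \<le> (\<integral>\<^sup>+x. ennreal C * ennreal (Z x) \<partial>M)"
      using f by (intro nn_integral_mono) (auto simp: Z0 simp flip: ennreal_mult intro!: ennreal_leI)
    also have "\<dots> = ennreal C * (\<integral>\<^sup>+x. ennreal (Z x) \<partial>M)" by (rule nn_integral_cmult) measurable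
    also have "\<dots> \<le> ennreal C * ennreal A" by (intro mult_left_mono Z) auto
    also have "\<dots> = ennreal (C * A)" using f A by (simp add: ennreal_mult)
    finally have le: "(\<integral>\<^sup>+x. ennreal (f x) \<partial>M) \<le> ennreal (C * A)" .
    have int: "integrable M f"
      using f le by (intro integrableI_nonneg) (auto intro: le_less_trans)
    have "ennreal (expectation f) \<le> ennreal (C * A)"
      using nn_integral_eq_integral[OF int] f le by simp
    then show ?thesis using int A f by (simp add: ennreal_le_iff)
  qed
  show "integrable M (\<lambda>x. (max 0 (Y x))\<^sup>2)" "expectation (\<lambda>x. (max 0 (Y x))\<^sup>2) \<le> 8 * b\<^sup>2 * A"
    using bound[of "\<lambda>x. (max 0 (Y x))\<^sup>2" "8 * b\<^sup>2", OF _ _ Z2] by auto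
  show "integrable M (\<lambda>x. max 0 (Y x))" "expectation (\<lambda>x. max 0 (Y x)) \<le> 2 * b * A"
    using bound[of "\<lambda>x. max 0 (Y x)" "2 * b", OF _ _ Z1] b by auto
qed

definition tail :: "'a measure \<Rightarrow> ('a \<Rightarrow> real) \<Rightarrow> real \<Rightarrow> real" where
  "tail M X t = measure M {x\<in>space M. t < X x}"

locale log_concave_tail = prob_space M for M :: "'a measure" +
  fixes X :: "'a \<Rightarrow> real"
  assumes X_measurable[measurable]: "X \<in> borel_measurable M"
    and tail_log_concave: "0 < a \<Longrightarrow> a < 1 \<Longrightarrow>
      tail M X s powr (1 - a) * tail M X t powr a \<le> tail M X ((1 - a) * s + a * t)"
begin

lemma tail_nonneg: "0 \<le> tail M X t" and tail_le_1: "tail M X t \<le> 1"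
  by (simp_all add: tail_def)

lemma tail_antimono: "s \<le> t \<Longrightarrow> tail M X t \<le> tail M X s"
  unfolding tail_def by (intro finite_measure_mono) auto

lemma tail_interpolate:
  assumes "s < r" "r < t" "0 < p" "p \<le> tail M X s" "0 \<le> w" "w \<le> tail M X t" "a = (r - s) / (t - s)"
  shows "p powr (1 - a) * w powr a \<le> tail M X r"
proof -
  have a: "0 < a" "a < 1" using assms by auto
  have "p powr (1 - a) * w powr a \<le> tail M X s powr (1 - a) * tail M X t powr a"
    using assms a by (intro mult_mono powr_mono2) auto
  also have "\<dots> \<le> tail M X ((1 - a) * s + a * t)" by (rule tail_log_concave[OF a])
  also have "(1 - a) * s + a * t = s + a * (t - s)" by (simp add: algebra_simps)
  also have "\<dots> = r" using assms by simp
  finally show ?thesis .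
qed

text \<open>
  The logarithm of the tail is concave, so if it decreases by \<open>- ln \<rho>\<close> on the way from \<open>s\<close> to \<open>r\<close>, then it
  continues to decrease at least at this rate.
\<close>

lemma tail_extrapolate:
  assumes "s < r" "r \<le> t" "0 < p" "p \<le> tail M X s" "0 < \<rho>" "tail M X r \<le> p * \<rho>"
  shows "tail M X t \<le> p * \<rho> powr ((t - s) / (r - s))"
proof (cases "r = t \<or> tail M X t = 0")
  case True then show ?thesis using assms by auto
next
  case False
  define a where "a = (r - s) / (t - s)"
  have a: "0 < a" "a < 1" using assms False by (auto simp: a_def)
  have pos: "0 < tail M X t" using False tail_nonneg[of t] by simp
  have "p powr (1 - a) * tail M X t powr a \<le> p * \<rho>"
    using tail_interpolate[OF assms(1) _ assms(3,4) tail_nonneg order_refl a_def, of] assms False by simp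
  then have "p powr a * (p powr (1 - a) * tail M X t powr a) \<le> p powr a * (p * \<rho>)"
    by (rule mult_left_mono) simp
  moreover have "p powr a * (p powr (1 - a) * tail M X t powr a) = p * tail M X t powr a"
    using assms(3) by (simp add: powr_diff)
  ultimately have "tail M X t powr a \<le> p powr a * \<rho>" using assms(3) by simp
  then have "(tail M X t powr a) powr (1 / a) \<le> (p powr a * \<rho>) powr (1 / a)"
    using a by (intro powr_mono2) auto
  then have "tail M X t \<le> p * \<rho> powr (1 / a)"
    using a assms pos by (simp add: powr_powr powr_mult)
  then show ?thesis using assms by (simp add: a_def)
qed

text \<open>
  The rate comes from the halving between \<open>s\<close> and \<open>r\<close>, as \<open>ln 2 \<ge> 2/3\<close>; the factor 2
  makes the bound trivially true before \<open>r\<close>.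
\<close>

lemma tail_le_exp:
  assumes st: "s < r" and tails: "1 / 8 \<le> tail M X s" "tail M X r \<le> 1 / 16" and t: "s \<le> t"
  shows "tail M X t \<le> 2 * exp (- (t - s) / (3 / 2 * (r - s)))"
proof -
  have ln2: "2 / 3 \<le> ln (2::real)" using ln2_ge_two_thirds by simp
  have powr: "(1 / 2 :: real) powr u \<le> exp (- u / (3 / 2))" if "0 \<le> u" for u
  proof -
    have "u * (2 / 3) \<le> u * ln 2" using that ln2 by (intro mult_left_mono) auto
    then show ?thesis by (simp add: powr_def ln_div)
  qed
  have e: "- ((t - s) / (r - s)) / (3 / 2) = - (t - s) / (3 / 2 * (r - s))"
    by (simp add: minus_divide_left mult.commute)
  have u: "0 \<le> (t - s) / (r - s)" using st t by simp
  show ?thesis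
  proof (cases "r \<le> t")
    case True
    have "tail M X t \<le> 1 / 8 * (1 / 2) powr ((t - s) / (r - s))"
      using tail_extrapolate[OF st True _ tails(1), of "1 / 2"] tails by simp
    also have "\<dots> \<le> 1 / 8 * exp (- ((t - s) / (r - s)) / (3 / 2))"
      by (intro mult_left_mono powr u) auto
    also have "\<dots> \<le> 2 * exp (- ((t - s) / (r - s)) / (3 / 2))" by (intro mult_right_mono) auto
    finally show ?thesis unfolding e .
  next
    case False
    have "(1 / 2 :: real) powr 1 \<le> (1 / 2) powr ((t - s) / (r - s))"
      using st False by (intro powr_mono') auto
    also have "\<dots> \<le> exp (- ((t - s) / (r - s)) / (3 / 2))" by (rule powr[OF u])
    finally show ?thesis using tail_le_1[of t] unfolding e by simp
  qed
qed

lemma tail_at_top: "(\<lambda>n. tail M X (real n)) \<longlonglongrightarrow> 0"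
proof -
  have "(\<lambda>n. measure M {x\<in>space M. real n < X x}) \<longlonglongrightarrow> measure M (\<Inter>n. {x\<in>space M. real n < X x})"
    by (rule finite_Lim_measure_decseq) (auto simp: decseq_def)
  moreover have "(\<Inter>n. {x\<in>space M. real n < X x}) = {}"
  proof -
    have "\<exists>n. \<not> real n < X x" for x using reals_Archimedean2[of "X x"] by (meson less_asym)
    then show ?thesis by auto
  qed
  ultimately show ?thesis by (simp add: tail_def)
qed

lemma tail_at_bot: "(\<lambda>n. tail M X (- real n)) \<longlonglongrightarrow> 1"
proof -
  have "(\<lambda>n. measure M {x\<in>space M. - real n < X x}) \<longlonglongrightarrow> measure M (\<Union>n. {x\<in>space M. - real n < X x})"
    by (rule finite_Lim_measure_incseq) (auto simp: incseq_def)
  moreover have "(\<Union>n. {x\<in>space M. - real n < X x}) = space M"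
  proof -
    have "\<exists>n. - real n < X x" for x using reals_Archimedean2[of "- X x"] by (metis minus_less_iff)
    then show ?thesis by auto
  qed
  ultimately show ?thesis by (simp add: tail_def prob_space)
qed

lemma tail_large: obtains s where "c \<le> s" "tail M X s \<le> 1 / 16"
proof -
  obtain n where n: "\<And>k. n \<le> k \<Longrightarrow> tail M X (real k) < 1 / 16"
    using order_tendstoD(2)[OF tail_at_top, of "1 / 16"] by (auto simp: eventually_sequentially)
  obtain k where "c \<le> real k" using real_arch_simple by blast
  then show ?thesis using that[of "real (max n k)"] n[of "max n k"] by auto
qed

lemma tail_small: obtains s where "s \<le> c" "1 / 2 \<le> tail M X s"
proof -
  obtain n where n: "\<And>k. n \<le> k \<Longrightarrow> tail M X (- real k) > 1 / 2"
    using order_tendstoD(1)[OF tail_at_bot, of "1 / 2"] by (auto simp: eventually_sequentially)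
  obtain k where "- c \<le> real k" using real_arch_simple by blast
  then show ?thesis using that[of "- real (max n k)"] n[of "max n k"] by auto
qed

lemma integrable_positive_part_square: "integrable M (\<lambda>x. (max 0 (X x))\<^sup>2)"
proof -
  obtain s where s: "s \<le> 0" "1 / 2 \<le> tail M X s" by (rule tail_small)
  obtain r where r: "s + 1 \<le> r" "tail M X r \<le> 1 / 16" by (rule tail_large)
  have "integrable M (\<lambda>x. (max 0 (X x - s))\<^sup>2)"
  proof (rule exp_tail_moments(1)[of _ "3 / 2 * (r - s)" 2])
    fix t :: real assume t: "0 \<le> t"
    have "prob {x \<in> space M. t < X x - s} = tail M X (s + t)"
      unfolding tail_def by (rule arg_cong[where f = prob]) auto
    also have "\<dots> \<le> 2 * exp (- t / (3 / 2 * (r - s)))"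
      using tail_le_exp[of s r "s + t"] s r t by simp
    finally show "prob {x \<in> space M. t < X x - s} \<le> 2 * exp (- t / (3 / 2 * (r - s)))" .
  qed (use r in auto)
  then show ?thesis
  proof (rule Bochner_Integration.integrable_bound)
    show "AE x in M. norm ((max 0 (X x))\<^sup>2) \<le> norm ((max 0 (X x - s))\<^sup>2)"
      using s by (auto intro!: AE_I2 power_mono)
  qed measurable
qed

end

locale log_concave_tails = log_concave_tail +
  assumes neg: "log_concave_tail M (\<lambda>x. - X x)"
begin

sublocale neg: log_concave_tail M "\<lambda>x. - X x" by (rule neg)

lemma integrable_square: "integrable M (\<lambda>x. (X x)\<^sup>2)"
proof -
  have "(X x)\<^sup>2 = (max 0 (X x))\<^sup>2 + (max 0 (- X x))\<^sup>2" for x by (auto simp: max_def)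
  then show ?thesis
    using integrable_positive_part_square neg.integrable_positive_part_square by simp
qed

lemma integrable: "integrable M X"
  by (rule square_integrable_imp_integrable[OF _ integrable_square]) measurable

lemma integrable_positive_part: "integrable M (\<lambda>x. max 0 (X x))"
  using integrable by (intro integrable_max) auto

lemma integrable_negative_part: "integrable M (\<lambda>x. max 0 (- X x))"
  using integrable by (intro integrable_max) auto

lemma expectation_parts:
  assumes "expectation X = 0"
  shows "expectation (\<lambda>x. max 0 (- X x)) = expectation (\<lambda>x. max 0 (X x))"
proof -
  have "X x = max 0 (X x) - max 0 (- X x)" for x by (simp add: max_def)
  then have "expectation X = expectation (\<lambda>x. max 0 (X x) - max 0 (- X x))" by presburger
  also have "\<dots> = expectation (\<lambda>x. max 0 (X x)) - expectation (\<lambda>x. max 0 (- X x))"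
    by (rule Bochner_Integration.integral_diff[OF integrable_positive_part integrable_negative_part])
  finally show ?thesis using assms by simp
qed

text \<open>
  Suppose that less than \<open>1/8\<close> of the mass lies to the right of the mean \<open>0\<close>, and let \<open>m \<le> 0\<close> be a median.
  The positive part has mean at most \<open>- m / 4\<close>, because the tail falls by a factor of 4
  between \<open>m\<close> and \<open>0\<close> and goes on decreasing at this rate. The negative part has larger mean unless
  \<open>m = 0\<close>, because half of the mass lies to the left of \<open>m\<close>. For \<open>m = 0\<close> both means vanish, so the
  variable is almost surely \<open>0\<close>.
\<close>

lemma centered_depth:
  assumes EX: "expectation X = 0" and nontriv: "\<not> (AE x in M. X x = 0)"
  shows "1 / 8 \<le> tail M X 0"
proof (rule ccontr)
  assume "\<not> 1 / 8 \<le> tail M X 0"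
  then have small: "tail M X 0 < 1 / 8" by simp
  define S where "S = {s. 1 / 2 \<le> tail M X s}"
  define m where "m = Sup S"
  have ne: "S \<noteq> {}" using tail_small unfolding S_def by blast
  have neg: "s \<le> 0" if "s \<in> S" for s
  proof (rule ccontr)
    assume "\<not> s \<le> 0"
    then have "tail M X s \<le> tail M X 0" by (intro tail_antimono) simp
    with small that show False by (simp add: S_def)
  qed
  then have bdd: "bdd_above S" by (auto simp: bdd_above_def)
  have m0: "m \<le> 0" unfolding m_def using ne neg by (rule cSup_least)
  have low: "1 / 2 \<le> tail M X s" if sm: "s < m" for s
  proof -
    obtain s' where "s' \<in> S" "s < s'"
      using less_cSup_iff[OF ne bdd, of s] sm m_def by blast
    then show ?thesis using tail_antimono[of s s'] by (simp add: S_def)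
  qed
  let ?P = "expectation (\<lambda>x. max 0 (X x))"
  have up: "?P \<le> - s / 4" if s: "s < m" for s
  proof -
    have s0: "s < 0" using s m0 by simp
    define b where "b = - s / ln 4"
    have ln4: "1 \<le> ln (4::real)"
    proof -
      have "exp 1 \<le> (4::real)" using exp_le by simp
      then show ?thesis by (subst ln_ge_iff) auto
    qed
    have b: "0 < b" "b \<le> - s" using s0 ln4 by (auto simp: b_def field_simps mult_le_cancel_left2)
    have "?P \<le> 2 * b * (1 / 8)"
    proof (rule exp_tail_moments(4))
      fix t :: real assume t: "0 \<le> t"
      have "tail M X t \<le> 1 / 2 * (1 / 4) powr ((t - s) / (0 - s))"
        using s0 t small low[OF s] by (intro tail_extrapolate) auto
      also have "(t - s) / (0 - s) = 1 + t / (- s)" using s0 by (simp add: field_simps)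
      also have "1 / 2 * (1 / 4) powr (1 + t / (- s)) = 1 / 8 * exp (- t / b)"
      proof -
        have "(1 / 4 :: real) powr (1 + t / (- s)) = (1 / 4) * (1 / 4) powr (t / (- s))"
          unfolding powr_add by simp
        also have "(1 / 4 :: real) powr (t / (- s)) = exp (- t / b)"
          unfolding powr_def b_def using s0 by (simp add: ln_div)
        finally show ?thesis by simp
      qed
      finally show "prob {x \<in> space M. t < X x} \<le> 1 / 8 * exp (- t / b)" unfolding tail_def .
    qed (use b in auto)
    then show ?thesis using b by simp
  qed
  have up': "?P \<le> - m / 4"
  proof (rule field_le_epsilon)
    fix e :: real assume "0 < e"
    then show "?P \<le> - m / 4 + e" using up[of "m - 4 * e"] by simp
  qed
  have "m = 0"
  proof (rule ccontr)
    assume "m \<noteq> 0"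
    then have m: "m < 0" using m0 by simp
    \<comment> \<open>Any point between 1/2 m and m separates the two estimates.\<close>
    define s where "s = 3 / 4 * m"
    have s: "m < s" "s < 0" using m by (auto simp: s_def)
    have "s \<notin> S" using cSup_upper[OF _ bdd] s by (force simp: m_def)
    then have "tail M X s < 1 / 2" by (simp add: S_def)
    moreover have "prob {x\<in>space M. - s \<le> max 0 (- X x)} = 1 - tail M X s"
    proof -
      have "{x\<in>space M. - s \<le> max 0 (- X x)} = space M - {x\<in>space M. s < X x}"
        using s by (auto simp: max_def)
      then show ?thesis unfolding tail_def using prob_compl[of "{x\<in>space M. s < X x}"] by simp
    qed
    moreover have "prob {x\<in>space M. - s \<le> max 0 (- X x)} \<le> expectation (\<lambda>x. max 0 (- X x)) / (- s)"
      using s by (intro integral_Markov_inequality_measure[OF integrable_negative_part, of "{}"]) auto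
    ultimately have "1 / 2 < ?P / (- s)" using expectation_parts[OF EX] by simp
    then have "- s / 2 < ?P" using s by (simp add: field_simps)
    with up' m show False by (simp add: s_def)
  qed
  then have "?P = 0" using up' by (intro antisym) auto
  then have "expectation (\<lambda>x. max 0 (X x) + max 0 (- X x)) = 0"
    using expectation_parts[OF EX] integrable_positive_part integrable_negative_part by simp
  then have "AE x in M. max 0 (X x) + max 0 (- X x) = 0"
    using integrable_positive_part integrable_negative_part
    by (subst (asm) integral_nonneg_eq_0_iff_AE) auto
  then have "AE x in M. X x = 0" by eventually_elim (auto simp: max_def split: if_splits)
  with nontriv show False by simp
qed

text \<open>
  If the \<open>1/16\<close>-tail were reached at a point \<open>r\<close> that is small compared to \<open>\<sigma>\<close>, the positive part
  would have moments of scale \<open>r\<close>. The negative part has the same mean, so by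
  Markov's inequality its tail reaches \<open>1/16\<close> at a multiple of \<open>r\<close>, and its
  second moment has scale \<open>r\<^sup>2\<close> too. Together this contradicts the variance \<open>\<sigma>\<^sup>2\<close>.
\<close>

lemma quantile_ge_deviation:
  assumes EX: "expectation X = 0" and depth: "1 / 8 \<le> tail M X 0" "1 / 8 \<le> tail M (\<lambda>x. - X x) 0"
    and \<sigma>: "0 < \<sigma>" "expectation (\<lambda>x. (X x)\<^sup>2) = \<sigma>\<^sup>2"
  shows "1 / 16 < tail M X (\<sigma> / 600)"
proof (rule ccontr)
  assume "\<not> 1 / 16 < tail M X (\<sigma> / 600)"
  define r where "r = \<sigma> / 600"
  have r: "0 < r" "tail M X r \<le> 1 / 16" using \<sigma> \<open>\<not> _\<close> by (auto simp: r_def)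
  have t1: "prob {x\<in>space M. t < X x} \<le> 2 * exp (- t / (3 / 2 * r))" if "0 \<le> t" for t
    using tail_le_exp[OF r(1) depth(1) r(2) that] by (simp add: tail_def)
  have b1: "0 < 3 / 2 * r" using r by simp
  note m1 = exp_tail_moments[OF X_measurable b1 _ t1, simplified]
  have P: "expectation (\<lambda>x. max 0 (- X x)) \<le> 6 * r"
    using m1(4) expectation_parts[OF EX] by simp
  \<comment> \<open>The mean of the negative part is at most 6 r, so Markov gives 1/16 at 96 r.\<close>
  define w where "w = 96 * r"
  have w: "0 < w" using r by (simp add: w_def)
  have "tail M (\<lambda>x. - X x) w \<le> prob {x\<in>space M. w \<le> max 0 (- X x)}"
    unfolding tail_def by (intro finite_measure_mono) auto
  also have "\<dots> \<le> expectation (\<lambda>x. max 0 (- X x)) / w"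
    using w by (intro integral_Markov_inequality_measure[OF integrable_negative_part, of "{}"]) auto
  also have "\<dots> \<le> 6 * r / w" using P w by (intro divide_right_mono) auto
  also have "\<dots> = 1 / 16" using r by (simp add: w_def)
  finally have tw: "tail M (\<lambda>x. - X x) w \<le> 1 / 16" .
  have t2: "prob {x\<in>space M. t < - X x} \<le> 2 * exp (- t / (3 / 2 * w))" if "0 \<le> t" for t
    using neg.tail_le_exp[OF w depth(2) tw that] by (simp add: tail_def)
  have b2: "0 < 3 / 2 * w" using w by simp
  note m2 = exp_tail_moments[OF neg.X_measurable b2 _ t2, simplified]
  have "\<sigma>\<^sup>2 = expectation (\<lambda>x. (max 0 (X x))\<^sup>2 + (max 0 (- X x))\<^sup>2)"
    unfolding \<sigma>(2)[symmetric] by (intro Bochner_Integration.integral_cong) (auto simp: max_def)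
  also have "\<dots> = expectation (\<lambda>x. (max 0 (X x))\<^sup>2) + expectation (\<lambda>x. (max 0 (- X x))\<^sup>2)"
    by (rule Bochner_Integration.integral_add[OF integrable_positive_part_square neg.integrable_positive_part_square])
  also have "\<dots> \<le> 8 * (3 / 2 * r)\<^sup>2 * 2 + 8 * (3 / 2 * w)\<^sup>2 * 2"
    by (intro add_mono exp_tail_moments(2)[OF _ b1 _ t1] exp_tail_moments(2)[OF _ b2 _ t2]) auto
  also have "\<dots> < 360000 * r\<^sup>2" using r by (simp add: w_def power_mult_distrib power_divide)
  also have "\<dots> = \<sigma>\<^sup>2" by (simp add: r_def power_divide)
  finally show False by simp
qed

text \<open>
  Chebyshev's inequality bounds the tail at \<open>4 * \<sigma>\<close> by \<open>1/16\<close>, half of the lower bound \<open>1/8\<close> for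
  the tail at \<open>0\<close>, so that \<open>tail_le_exp\<close> applies.
\<close>

lemma tail_le_deviation:
  assumes EX: "expectation X = 0" and depth: "1 / 8 \<le> tail M X 0"
    and \<sigma>: "0 < \<sigma>" "expectation (\<lambda>x. (X x)\<^sup>2) \<le> \<sigma>\<^sup>2" and t: "0 \<le> t"
  shows "tail M X t \<le> 2 * exp (- t / (6 * \<sigma>))"
proof -
  have "(4 * \<sigma>)\<^sup>2 \<le> (X x)\<^sup>2" if "4 * \<sigma> < X x" for x
    using that \<sigma>(1) by (intro power_mono) auto
  then have "tail M X (4 * \<sigma>) \<le> prob {x\<in>space M. (4 * \<sigma>)\<^sup>2 \<le> (X x)\<^sup>2}"
    unfolding tail_def by (intro finite_measure_mono) auto
  also have "\<dots> \<le> expectation (\<lambda>x. (X x)\<^sup>2) / (4 * \<sigma>)\<^sup>2"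
    using \<sigma> by (intro integral_Markov_inequality_measure[OF integrable_square, of "{}"]) auto
  also have "\<dots> \<le> \<sigma>\<^sup>2 / (4 * \<sigma>)\<^sup>2" using \<sigma> by (intro divide_right_mono) auto
  also have "\<dots> = 1 / 16" using \<sigma> by (simp add: power_mult_distrib)
  finally have "tail M X (4 * \<sigma>) \<le> 1 / 16" .
  from tail_le_exp[OF _ depth this t] \<sigma> show ?thesis by (simp add: mult.commute)
qed

end

section \<open>The centroid and the covariance form\<close>

lemma bilinear_sum_left:
  fixes B :: "(nat \<Rightarrow> real) \<Rightarrow> (nat \<Rightarrow> real) \<Rightarrow> real"
  assumes lin: "\<And>a b u v w. B (\<lambda>i. a * u i + b * v i) w = a * B u w + b * B v w"
    and "finite J"
  shows "B (\<lambda>i. \<Sum>j\<in>J. c j * v j i) w = (\<Sum>j\<in>J. c j * B (v j) w)"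
  using assms(2)
proof (induction J rule: finite_induct)
  case empty
  show ?case using lin[of 0 "\<lambda>_. 0" 0 "\<lambda>_. 0" w] by simp
next
  case (insert j J)
  have "B (\<lambda>i. c j * v j i + 1 * (\<Sum>j\<in>J. c j * v j i)) w = c j * B (v j) w + 1 * B (\<lambda>i. \<Sum>j\<in>J. c j * v j i) w"
    by (rule lin)
  then show ?case using insert by simp
qed

text \<open>
  Gram-Schmidt, applied to the unit vectors. That the first \<open>k\<close> vectors vanish outside the first \<open>k\<close>
  coordinates is part of the induction, since it guarantees that the next unit vector is
  independent of them.
\<close>

lemma orthonormal_basis_exists:
  fixes B :: "(nat \<Rightarrow> real) \<Rightarrow> (nat \<Rightarrow> real) \<Rightarrow> real"
  assumes lin: "\<And>a b u v w. B (\<lambda>i. a * u i + b * v i) w = a * B u w + b * B v w"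
    and sym: "\<And>u v. B u v = B v u"
    and pos: "\<And>u i. i < d \<Longrightarrow> u i \<noteq> 0 \<Longrightarrow> 0 < B u u"
    and "k \<le> d"
  shows "\<exists>e. (\<forall>j<k. \<forall>l<k. B (e j) (e l) = (if j = l then 1 else 0)) \<and> (\<forall>j<k. \<forall>i\<ge>k. e j i = 0) \<and>
     (\<forall>u. (\<forall>i\<ge>k. u i = 0) \<longrightarrow> (\<exists>c. u = (\<lambda>i. \<Sum>j<k. c j * e j i)))"
  using \<open>k \<le> d\<close>
proof (induction k)
  case 0
  show ?case by auto
next
  case (Suc k)
  from Suc.IH[OF Suc_leD[OF Suc.prems]] obtain e where e: "\<And>j l. j < k \<Longrightarrow> l < k \<Longrightarrow> B (e j) (e l) = (if j = l then 1 else 0)"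
    "\<And>j i. j < k \<Longrightarrow> k \<le> i \<Longrightarrow> e j i = 0"
    "\<And>u. (\<And>i. k \<le> i \<Longrightarrow> u i = 0) \<Longrightarrow> \<exists>c. u = (\<lambda>i. \<Sum>j<k. c j * e j i)"
    by blast
  define v :: "nat \<Rightarrow> real" where "v i = (if i = k then 1 else 0)" for i
  define s where "s i = (\<Sum>j<k. B v (e j) * e j i)" for i
  define w where "w = (\<lambda>i. 1 * v i + (- 1) * s i)"
  have ss: "s = (\<lambda>i. \<Sum>j<k. B v (e j) * e j i)" by (simp add: s_def fun_eq_iff)
  have Bs: "B s (e l) = B v (e l)" if "l < k" for l
  proof -
    have "B s (e l) = (\<Sum>j<k. B v (e j) * B (e j) (e l))" unfolding ss by (rule bilinear_sum_left[OF lin]) simp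
    also have "\<dots> = (\<Sum>j<k. if j = l then B v (e j) else 0)" using e(1) that by (intro sum.cong) auto
    also have "\<dots> = B v (e l)" using that by simp
    finally show ?thesis .
  qed
  have Bw: "B w (e l) = 0" if "l < k" for l unfolding w_def lin using Bs[OF that] by simp
  have wk: "w i = 0" if "k < i" for i
    using e(2) that by (auto simp: w_def v_def s_def)
  have wk1: "w k = 1" using e(2) by (auto simp: w_def v_def s_def)
  define r where "r = sqrt (B w w)"
  have r: "0 < r" "r\<^sup>2 = B w w" using pos[of k w] wk1 Suc.prems by (auto simp: r_def)
  define f where "f = e(k := (\<lambda>i. (1 / r) * w i + 0 * w i))"
  have fk: "f k = (\<lambda>i. (1 / r) * w i + 0 * w i)" and fj: "j \<noteq> k \<Longrightarrow> f j = e j" for j by (auto simp: f_def)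
  have Bf: "B (f k) u = B w u / r" for u unfolding fk lin by simp
  have 1: "B (f j) (f l) = (if j = l then 1 else 0)" if jl: "j < Suc k" "l < Suc k" for j l
  proof -
    consider "j < k" "l < k" | "j = k" "l < k" | "j < k" "l = k" | "j = k" "l = k"
      using jl by (metis less_SucE)
    then show ?thesis
    proof cases
      case 1 then show ?thesis using e(1) by (simp add: fj)
    next
      case 2 then show ?thesis using Bw by (simp add: Bf fj)
    next
      case 3 then show ?thesis using Bw by (subst sym) (simp add: Bf fj)
    next
      case 4
      have "B (f k) (f k) = B w (f k) / r" by (rule Bf)
      also have "B w (f k) = B w w / r" by (subst sym) (rule Bf)
      finally show ?thesis using 4 r by (simp add: power2_eq_square flip: r(2))
    qed
  qed
  have 2: "f j i = 0" if "j < Suc k" "Suc k \<le> i" for j i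
    using that e(2) wk by (cases "j = k") (auto simp: fk fj)
  have 3: "\<exists>c. u = (\<lambda>i. \<Sum>j<Suc k. c j * f j i)" if u: "\<And>i. Suc k \<le> i \<Longrightarrow> u i = 0" for u
  proof -
    have "u i - u k * w i = 0" if "k \<le> i" for i
      using that u wk1 wk[of i] by (cases "i = k") auto
    then obtain c where c: "(\<lambda>i. u i - u k * w i) = (\<lambda>i. \<Sum>j<k. c j * e j i)"
      using e(3)[of "\<lambda>i. u i - u k * w i"] by blast
    have "u i = (\<Sum>j<Suc k. (c(k := u k * r)) j * f j i)" for i
    proof -
      have "u i - u k * w i = (\<Sum>j<k. c j * e j i)" using c by (rule fun_cong)
      moreover have "(\<Sum>j<k. c j * e j i) = (\<Sum>j<k. (c(k := u k * r)) j * f j i)"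
        by (intro sum.cong) (auto simp: fj)
      ultimately show ?thesis using r by (simp add: fk)
    qed
    then show ?thesis by blast
  qed
  show ?case using 1 2 3 by blast
qed

locale log_concave_measure = prob_space \<mu> for \<mu> :: "(nat \<Rightarrow> real) measure" +
  fixes d :: nat
  assumes density: "has_log_concave_density d \<mu>"
begin

lemma sets_eq[simp, measurable_cong]: "sets \<mu> = sets (Rn_lborel d)"
  using density by (auto simp: has_log_concave_density_def)

lemma space_eq[simp]: "space \<mu> = Rn d"
  using sets_eq_imp_space_eq[OF sets_eq] by (simp add: space_Rn_lborel)

lemma prob_Rn[simp]: "prob (Rn d) = 1"
  using prob_space by simp

lemma ip_measurable[measurable]: "ip d u \<in> borel_measurable \<mu>"
  using borel_measurable_ip by measurable

lemma log_concave_tail_ip: "log_concave_tail \<mu> (\<lambda>x. ip d u x - c)"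
proof
  show "(\<lambda>x. ip d u x - c) \<in> borel_measurable \<mu>" by measurable
  fix a s t :: real
  assume a: "0 < a" "a < 1"
  obtain f where f: "f \<in> borel_measurable (Rn_lborel d)" "log_concave d f"
    "\<mu> = Nonnegative_Lebesgue_Integration.density (Rn_lborel d) (\<lambda>x. ennreal (f x))"
    using density unfolding has_log_concave_density_def by blast
  have lc: "log_concave_ennreal (\<lambda>s. emeasure \<mu> {x \<in> Rn d. s < ip d u x})"
    unfolding f(3) by (rule halfspace_emeasure_log_concave[OF f(1,2)])
  have T: "tail \<mu> (\<lambda>x. ip d u x - c) r = measure \<mu> {x \<in> Rn d. r + c < ip d u x}" for r
    unfolding tail_def by (rule arg_cong[where f = prob]) auto
  have step: "ennreal (v powr (1 - a) * w powr a) \<le> emeasure \<mu> {x \<in> Rn d. (1 - a) *\<^sub>R (s + c) + a *\<^sub>R (t + c) < ip d u x}"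
    if "0 < v" "v < prob {x \<in> Rn d. s + c < ip d u x}" "0 < w" "w < prob {x \<in> Rn d. t + c < ip d u x}" for v w
    using that by (intro log_concave_ennrealD[OF lc a]) (auto simp: emeasure_eq_measure ennreal_less_iff)
  have "ennreal (prob {x \<in> Rn d. s + c < ip d u x} powr (1 - a) * prob {x \<in> Rn d. t + c < ip d u x} powr a)
     \<le> emeasure \<mu> {x \<in> Rn d. (1 - a) *\<^sub>R (s + c) + a *\<^sub>R (t + c) < ip d u x}"
    by (rule ennreal_powr_mult_le[OF _ _ a step]) auto
  also have "(1 - a) *\<^sub>R (s + c) + a *\<^sub>R (t + c) = ((1 - a) * s + a * t) + c" by (simp add: algebra_simps)
  finally show "tail \<mu> (\<lambda>x. ip d u x - c) s powr (1 - a) * tail \<mu> (\<lambda>x. ip d u x - c) t powr a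
    \<le> tail \<mu> (\<lambda>x. ip d u x - c) ((1 - a) * s + a * t)"
    unfolding T by (simp add: emeasure_eq_measure)
qed

lemma log_concave_tails_ip: "log_concave_tails \<mu> (\<lambda>x. ip d u x - c)"
proof -
  have "(\<lambda>x. - (ip d u x - c)) = (\<lambda>x. ip d (\<lambda>i. - u i) x - (- c))"
    by (simp add: ip_def sum_negf)
  then have "log_concave_tail \<mu> (\<lambda>x. - (ip d u x - c))" by (metis log_concave_tail_ip)
  then show ?thesis by (intro log_concave_tails.intro log_concave_tails_axioms.intro log_concave_tail_ip)
qed

text \<open>
  Fubini in a coordinate \<open>i\<close> with \<open>u i \<noteq> 0\<close>: on every line in this direction only one point satisfies
  the equation.
\<close>

lemma hyperplane_null:
  assumes i: "i < d" "u i \<noteq> 0"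
  shows "\<not> (AE x in \<mu>. ip d u x - c = 0)"
proof
  assume "AE x in \<mu>. ip d u x - c = 0"
  then have "AE x in \<mu>. ip d u x = c" by simp
  have one: "emeasure \<mu> {x\<in>space \<mu>. ip d u x = c} = 1"
  proof (rule emeasure_eq_1_AE)
    show "{x\<in>space \<mu>. ip d u x = c} \<in> sets \<mu>" by measurable
    show "AE x in \<mu>. x \<in> {x\<in>space \<mu>. ip d u x = c}"
      using \<open>AE x in \<mu>. ip d u x = c\<close> AE_space by eventually_elim simp
  qed
  obtain f where f: "f \<in> borel_measurable (Rn_lborel d)"
    "\<mu> = Nonnegative_Lebesgue_Integration.density (Rn_lborel d) (\<lambda>x. ennreal (f x))"
    using density unfolding has_log_concave_density_def by blast
  interpret product_sigma_finite "\<lambda>_::nat. lborel :: real measure" by standard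
  define I where "I = {..<d} - {i}"
  have I: "finite I" "i \<notin> I" "{..<d} = insert i I" using i by (auto simp: I_def)
  let ?S = "{x\<in>space (Rn_lborel d). ip d u x = c}"
  have S: "?S \<in> sets (Rn_lborel d)" by measurable
  have "emeasure (Rn_lborel d) ?S = (\<integral>\<^sup>+x. indicator ?S x \<partial>Rn_lborel d)" using S by simp
  also have "\<dots> = (\<integral>\<^sup>+x. (\<integral>\<^sup>+y. indicator ?S (x(i := y)) \<partial>lborel) \<partial>PiM I (\<lambda>_. lborel))"
    using S unfolding Rn_lborel_def I(3) by (intro product_nn_integral_insert[OF I(1,2)]) simp
  also have "\<dots> = (\<integral>\<^sup>+(x::nat \<Rightarrow> real). 0 \<partial>PiM I (\<lambda>_. lborel))"
  proof (rule nn_integral_cong)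
    fix x :: "nat \<Rightarrow> real"
    define y0 where "y0 = (c - (\<Sum>j\<in>I. u j * x j)) / u i"
    have sub: "indicator ?S (x(i := y)) \<le> (indicator {y0} y :: ennreal)" for y
    proof (cases "x(i := y) \<in> ?S")
      case True
      then have "(\<Sum>j\<in>insert i I. u j * (x(i := y)) j) = c" by (simp add: ip_def I(3))
      then have "u i * y + (\<Sum>j\<in>I. u j * (x(i := y)) j) = c" using I by simp
      moreover have "(\<Sum>j\<in>I. u j * (x(i := y)) j) = (\<Sum>j\<in>I. u j * x j)" using I by (intro sum.cong) auto
      ultimately have "y = y0" using i by (simp add: y0_def field_simps)
      then show ?thesis by (simp add: indicator_def)
    qed simp
    have "(\<integral>\<^sup>+y. indicator ?S (x(i := y)) \<partial>lborel) \<le> (\<integral>\<^sup>+y. indicator {y0} y \<partial>lborel)"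
      by (intro nn_integral_mono sub)
    then show "(\<integral>\<^sup>+y. indicator ?S (x(i := y)) \<partial>lborel) = 0" by simp
  qed
  finally have null: "emeasure (Rn_lborel d) ?S = 0" by simp
  then have "?S \<in> null_sets (Rn_lborel d)" using S by auto
  moreover have "absolutely_continuous (Rn_lborel d) \<mu>"
    unfolding f(2) using f(1) by (intro absolutely_continuousI_density) simp
  ultimately have "?S \<in> null_sets \<mu>" by (auto simp: absolutely_continuous_def)
  with one show False by (simp add: space_Rn_lborel null_sets_def)
qed

definition centroid :: "nat \<Rightarrow> real" where
  "centroid = (\<lambda>i\<in>{..<d}. expectation (\<lambda>x. x i))"

lemma centroid_mem: "centroid \<in> Rn d"
  by (simp add: centroid_def Rn_def)

definition dev :: "(nat \<Rightarrow> real) \<Rightarrow> (nat \<Rightarrow> real) \<Rightarrow> real" where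
  "dev u x = ip d u x - ip d u centroid"

lemma dev_tails: "log_concave_tails \<mu> (dev u)"
  unfolding dev_def[abs_def] by (rule log_concave_tails_ip)

lemma dev_measurable[measurable]: "dev u \<in> borel_measurable \<mu>"
  unfolding dev_def[abs_def] by measurable

lemma dev_lincomb: "dev (\<lambda>i. a * u i + b * v i) x = a * dev u x + b * dev v x"
  by (simp add: dev_def ip_def algebra_simps sum.distrib sum_distrib_left sum_subtractf)

lemma dev_cong: "(\<And>i. i < d \<Longrightarrow> u i = v i) \<Longrightarrow> dev u x = dev v x"
  by (simp add: dev_def ip_def)

lemma dev_uminus: "dev (\<lambda>i. - u i) x = - dev u x"
  using dev_lincomb[of "-1" u 0 u x] by simp

lemma dev_sum: "finite J \<Longrightarrow> dev (\<lambda>i. \<Sum>j\<in>J. c j * e j i) x = (\<Sum>j\<in>J. c j * dev (e j) x)"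
  using bilinear_sum_left[of "\<lambda>u _. dev u x" J c e undefined] by (simp add: dev_lincomb)

lemma integrable_ip: "integrable \<mu> (ip d u)"
proof -
  interpret log_concave_tails \<mu> "\<lambda>x. ip d u x - 0" by (rule log_concave_tails_ip)
  show ?thesis using integrable by simp
qed

lemma expectation_dev: "expectation (dev u) = 0"
proof -
  have int: "integrable \<mu> (\<lambda>x. x i)" if "i < d" for i
  proof -
    have "ip d (\<lambda>j. if j = i then 1 else 0) = (\<lambda>x. x i)"
      using that by (auto simp: ip_def fun_eq_iff if_distrib[of "\<lambda>y. y * _"] cong: if_cong)
    then show ?thesis using integrable_ip[of "\<lambda>j. if j = i then 1 else 0"] by simp
  qed
  have "expectation (ip d u) = (\<Sum>i<d. u i * expectation (\<lambda>x. x i))"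
    unfolding ip_def[abs_def] using int by (subst Bochner_Integration.integral_sum) auto
  also have "\<dots> = ip d u centroid" by (simp add: ip_def centroid_def)
  finally show ?thesis unfolding dev_def[abs_def] using integrable_ip[of u] by (simp add: prob_space)
qed

definition nontriv :: "(nat \<Rightarrow> real) \<Rightarrow> bool" where
  "nontriv u \<longleftrightarrow> (\<exists>i<d. u i \<noteq> 0)"

lemma dev_not_AE_0: "nontriv u \<Longrightarrow> \<not> (AE x in \<mu>. dev u x = 0)"
  unfolding dev_def nontriv_def by (elim exE conjE, rule hyperplane_null)

lemma depth: "nontriv u \<Longrightarrow> 1 / 8 \<le> tail \<mu> (dev u) 0"
  by (rule log_concave_tails.centered_depth[OF dev_tails expectation_dev dev_not_AE_0])

lemma depth_neg: "nontriv u \<Longrightarrow> 1 / 8 \<le> tail \<mu> (\<lambda>x. - dev u x) 0"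
  using depth[of "\<lambda>i. - u i"] by (simp add: dev_uminus[abs_def] nontriv_def)

lemma dev_halfspace_sets[simp]: "{x \<in> Rn d. a < dev u x} \<in> sets (Rn_lborel d)"
proof -
  have "{x \<in> space \<mu>. a < dev u x} \<in> sets \<mu>" by measurable
  then show ?thesis by simp
qed

definition cov :: "(nat \<Rightarrow> real) \<Rightarrow> (nat \<Rightarrow> real) \<Rightarrow> real" where
  "cov u v = expectation (\<lambda>x. dev u x * dev v x)"

lemma integrable_dev_mult: "integrable \<mu> (\<lambda>x. dev u x * dev v x)"
proof (rule Bochner_Integration.integrable_bound)
  show "integrable \<mu> (\<lambda>x. (dev u x)\<^sup>2 + (dev v x)\<^sup>2)"
    by (intro Bochner_Integration.integrable_add log_concave_tails.integrable_square dev_tails)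
  have "\<bar>a * b\<bar> \<le> a\<^sup>2 + b\<^sup>2" for a b :: real
  proof -
    have "2 * (\<bar>a\<bar> * \<bar>b\<bar>) \<le> \<bar>a\<bar>\<^sup>2 + \<bar>b\<bar>\<^sup>2" using sum_squares_bound[of "\<bar>a\<bar>" "\<bar>b\<bar>"] by (simp add: mult.assoc)
    moreover have "0 \<le> \<bar>a\<bar> * \<bar>b\<bar>" by simp
    ultimately show ?thesis unfolding abs_mult power2_abs by linarith
  qed
  then show "AE x in \<mu>. norm (dev u x * dev v x) \<le> norm ((dev u x)\<^sup>2 + (dev v x)\<^sup>2)" by simp
qed measurable

lemma cov_linear: "cov (\<lambda>i. a * u i + b * v i) w = a * cov u w + b * cov v w"
proof -
  have "cov (\<lambda>i. a * u i + b * v i) w = expectation (\<lambda>x. a * (dev u x * dev w x) + b * (dev v x * dev w x))"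
    unfolding cov_def dev_lincomb by (simp add: algebra_simps)
  also have "\<dots> = a * cov u w + b * cov v w"
    unfolding cov_def using integrable_dev_mult by simp
  finally show ?thesis .
qed

lemma cov_sym: "cov u v = cov v u"
  by (simp add: cov_def mult.commute)

lemma cov_pos:
  assumes "nontriv u"
  shows "0 < cov u u"
proof -
  have "\<not> (AE x in \<mu>. dev u x * dev u x = 0)" using dev_not_AE_0[OF assms] by simp
  then have "cov u u \<noteq> 0" unfolding cov_def
    using integral_nonneg_eq_0_iff_AE[OF integrable_dev_mult[of u u]] by simp
  moreover have "0 \<le> cov u u" unfolding cov_def by simp
  ultimately show "0 < cov u u" by simp
qed

text \<open>
  Coordinates in which the measure has identity covariance. They are taken in the space of
  directions, where the net is constructed below.
\<close>

lemma isotropic_basis: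
  obtains e where "\<And>j l. j < d \<Longrightarrow> l < d \<Longrightarrow> cov (e j) (e l) = (if j = l then 1 else 0)"
    "\<And>u. \<exists>c. \<forall>i<d. u i = (\<Sum>j<d. c j * e j i)"
proof -
  have "\<exists>e. (\<forall>j<d. \<forall>l<d. cov (e j) (e l) = (if j = l then 1 else 0)) \<and> (\<forall>j<d. \<forall>i\<ge>d. e j i = 0) \<and>
     (\<forall>u. (\<forall>i\<ge>d. u i = 0) \<longrightarrow> (\<exists>c. u = (\<lambda>i. \<Sum>j<d. c j * e j i)))"
  proof (rule orthonormal_basis_exists)
    show "cov (\<lambda>i. a * u i + b * v i) w = a * cov u w + b * cov v w" for a b u v w by (rule cov_linear)
    show "cov u v = cov v u" for u v by (rule cov_sym)
    show "0 < cov u u" if "i < d" "u i \<noteq> 0" for u i using that by (intro cov_pos) (auto simp: nontriv_def)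
  qed simp
  then obtain e where e: "\<forall>j<d. \<forall>l<d. cov (e j) (e l) = (if j = l then 1 else 0)"
     "\<forall>u. (\<forall>i\<ge>d. u i = 0) \<longrightarrow> (\<exists>c. u = (\<lambda>i. \<Sum>j<d. c j * e j i))"
    by blast
  have "\<exists>c. \<forall>i<d. u i = (\<Sum>j<d. c j * e j i)" for u
  proof -
    obtain c where "(\<lambda>i. if i < d then u i else 0) = (\<lambda>i. \<Sum>j<d. c j * e j i)"
      using e(2)[rule_format, of "\<lambda>i. if i < d then u i else 0"] by auto
    then have "\<forall>i<d. u i = (\<Sum>j<d. c j * e j i)" by (metis (no_types, lifting))
    then show ?thesis by blast
  qed
  then show ?thesis using that e(1) by blast
qed

end

section \<open>Quantiles of the marginals\<close>

context log_concave_measure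
begin

definition quantile :: "real \<Rightarrow> (nat \<Rightarrow> real) \<Rightarrow> real" where
  "quantile N u = Sup {t. 1 / N \<le> tail \<mu> (dev u) t}"

lemma tail_antimono: "s \<le> t \<Longrightarrow> tail \<mu> (dev u) t \<le> tail \<mu> (dev u) s"
  unfolding tail_def by (intro finite_measure_mono) auto

lemma quantile_set:
  assumes "2 < N"
  shows "{t. 1 / N \<le> tail \<mu> (dev u) t} \<noteq> {}" "bdd_above {t. 1 / N \<le> tail \<mu> (dev u) t}"
proof -
  interpret D: log_concave_tails \<mu> "dev u" by (rule dev_tails)
  have N: "1 / N \<le> 1 / 2" "0 < 1 / N" using assms by auto
  obtain s where "1 / 2 \<le> tail \<mu> (dev u) s" by (rule D.tail_small)
  then have "1 / N \<le> tail \<mu> (dev u) s" using N by linarith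
  then show "{t. 1 / N \<le> tail \<mu> (dev u) t} \<noteq> {}" by blast
  obtain n where n: "\<And>k. n \<le> k \<Longrightarrow> tail \<mu> (dev u) (real k) < 1 / N"
    using order_tendstoD(2)[OF D.tail_at_top N(2)] by (auto simp: eventually_sequentially)
  have "t \<le> real n" if "1 / N \<le> tail \<mu> (dev u) t" for t
    using that n[of n] tail_antimono[of "real n" t u] by (cases "t \<le> real n") auto
  then show "bdd_above {t. 1 / N \<le> tail \<mu> (dev u) t}" by (auto simp: bdd_above_def)
qed

lemma tail_below_quantile:
  assumes "2 < N" "t < quantile N u"
  shows "1 / N \<le> tail \<mu> (dev u) t"
proof -
  have "\<exists>s\<in>{t. 1 / N \<le> tail \<mu> (dev u) t}. t < s"
    using less_cSup_iff[OF quantile_set[OF assms(1), of u], of t] assms(2) unfolding quantile_def by blast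
  then obtain s where "1 / N \<le> tail \<mu> (dev u) s" "t < s" by blast
  then show ?thesis using tail_antimono[of t s u] by simp
qed

lemma tail_above_quantile:
  assumes "2 < N" "quantile N u < t"
  shows "tail \<mu> (dev u) t < 1 / N"
proof (rule ccontr)
  assume "\<not> tail \<mu> (dev u) t < 1 / N"
  then have "t \<le> quantile N u" unfolding quantile_def
    by (intro cSup_upper quantile_set[OF assms(1)]) auto
  with assms show False by simp
qed

lemma quantile_le:
  assumes "2 < N" "tail \<mu> (dev u) t < 1 / N"
  shows "quantile N u \<le> t"
  using tail_below_quantile[OF assms(1), of t u] assms(2) by linarith

lemma quantile_ge:
  assumes "2 < N" "1 / N \<le> tail \<mu> (dev u) t"
  shows "t \<le> quantile N u"
  using tail_above_quantile[OF assms(1), of u t] assms(2) by linarith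

lemma dev_scale: "dev (\<lambda>i. s * u i) x = s * dev u x"
  using dev_lincomb[of s u 0 u x] by simp

lemma quantile_scale:
  assumes N: "2 < N" and s: "0 < s"
  shows "quantile N (\<lambda>i. s * u i) = s * quantile N u"
proof -
  have T: "tail \<mu> (dev (\<lambda>i. s * u i)) t = tail \<mu> (dev u) (t / s)" for t
    unfolding tail_def dev_scale using s by (simp add: field_simps)
  show ?thesis
  proof (rule antisym)
    show "quantile N (\<lambda>i. s * u i) \<le> s * quantile N u"
    proof (rule dense_ge)
      fix y assume "s * quantile N u < y"
      then have "quantile N u < y / s" using s by (simp add: field_simps)
      from tail_above_quantile[OF N this] show "quantile N (\<lambda>i. s * u i) \<le> y"
        by (intro quantile_le[OF N]) (simp add: T)
    qed
    show "s * quantile N u \<le> quantile N (\<lambda>i. s * u i)"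
    proof (rule dense_le)
      fix y assume "y < s * quantile N u"
      then have "y / s < quantile N u" using s by (simp add: field_simps)
      from tail_below_quantile[OF N this] show "y \<le> quantile N (\<lambda>i. s * u i)"
        by (intro quantile_ge[OF N]) (simp add: T)
    qed
  qed
qed

lemma expectation_dev_square: "expectation (\<lambda>x. (dev u x)\<^sup>2) = cov u u"
  by (simp add: cov_def power2_eq_square)

lemma quantile_ge_dev:
  assumes u: "nontriv u" and N: "16 \<le> N" and \<sigma>: "0 < \<sigma>" "\<sigma>\<^sup>2 \<le> cov u u"
  shows "\<sigma> / 600 \<le> quantile N u"
proof -
  interpret D: log_concave_tails \<mu> "dev u" by (rule dev_tails)
  have p: "0 < sqrt (cov u u)" using cov_pos[OF u] by simp
  have "1 / 16 < tail \<mu> (dev u) (sqrt (cov u u) / 600)"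
    using cov_pos[OF u]
    by (intro D.quantile_ge_deviation expectation_dev depth[OF u] depth_neg[OF u] p)
      (simp add: expectation_dev_square)
  moreover have "1 / N \<le> 1 / 16" using N by (simp add: field_simps)
  ultimately have "1 / N \<le> tail \<mu> (dev u) (sqrt (cov u u) / 600)" by linarith
  then have "sqrt (cov u u) / 600 \<le> quantile N u" using N by (intro quantile_ge) auto
  moreover have "\<sigma> \<le> sqrt (cov u u)" using \<sigma> by (simp add: real_le_rsqrt)
  ultimately show ?thesis by simp
qed

text \<open>
  Also the trivial direction is covered, since the lemma is applied to the difference of two
  directions, which may coincide.
\<close>

lemma tail_dev_small:
  assumes N: "16 \<le> N" and \<sigma>: "0 < \<sigma>" "cov u u \<le> \<sigma>\<^sup>2"
  shows "tail \<mu> (dev u) (12 * \<sigma> * ln N) < 1 / (2 * N)"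
proof (cases "nontriv u")
  case True
  then have u: "nontriv u" by (simp add: nontriv_def)
  interpret D: log_concave_tails \<mu> "dev u" by (rule dev_tails)
  have "tail \<mu> (dev u) (12 * \<sigma> * ln N) \<le> 2 * exp (- (12 * \<sigma> * ln N) / (6 * \<sigma>))"
    using N \<sigma> by (intro D.tail_le_deviation expectation_dev depth[OF u]) (auto simp: expectation_dev_square)
  also have "- (12 * \<sigma> * ln N) / (6 * \<sigma>) = - (2 * ln N)" using \<sigma> by simp
  also have "exp (- (2 * ln N)) = 1 / N\<^sup>2"
    using N by (simp add: exp_minus exp_double inverse_eq_divide)
  also have "2 * (1 / N\<^sup>2) < 1 / (2 * N)" using N by (simp add: field_simps power2_eq_square)
  finally show ?thesis .
next
  case False
  then have "dev u x = 0" for x by (simp add: dev_def ip_def nontriv_def)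
  moreover have "0 \<le> 12 * \<sigma> * ln N" using N \<sigma> by simp
  ultimately show ?thesis using N by (simp add: tail_def)
qed

lemma quantile_le_dev:
  assumes N: "16 \<le> N" and \<sigma>: "0 < \<sigma>" "cov u u \<le> \<sigma>\<^sup>2"
  shows "quantile N u \<le> 12 * \<sigma> * ln N"
proof (rule quantile_le)
  have "1 / (2 * N) \<le> 1 / N" using N by (simp add: field_simps)
  then show "tail \<mu> (dev u) (12 * \<sigma> * ln N) < 1 / N" using tail_dev_small[OF assms] by simp
qed (use N in simp)

lemma quantile_pos:
  assumes u: "nontriv u" and N: "16 \<le> N"
  shows "0 < quantile N u"
proof -
  have "0 < sqrt (cov u u) / 600" using cov_pos[OF u] by simp
  also have "\<dots> \<le> quantile N u"
    using quantile_ge_dev[OF u N, of "sqrt (cov u u)"] cov_pos[OF u] by simp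
  finally show ?thesis .
qed

text \<open>
  Between \<open>0\<close> and a point slightly beyond the quantile the tail falls at least by the factor \<open>8 / N\<close>;
  log-concavity continues this decay. The intermediate point is \<open>(1 + \<eta>) * quantile N u\<close>, because the
  defining supremum bounds the tail only strictly beyond the quantile.
\<close>

lemma tail_beyond_quantile:
  assumes u: "nontriv u" and N: "16 \<le> N" and \<eta>: "0 < \<eta>" "\<eta> \<le> 1"
  shows "tail \<mu> (dev u) ((1 + 3 * \<eta>) * quantile N u) \<le> 1 / N * (8 / N) powr \<eta>"
proof -
  interpret D: log_concave_tails \<mu> "dev u" by (rule dev_tails)
  define Q where "Q = quantile N u"
  have Q: "0 < Q" unfolding Q_def by (rule quantile_pos[OF u N])
  have "tail \<mu> (dev u) ((1 + 3 * \<eta>) * Q) \<le> 1 / 8 * (8 / N) powr (((1 + 3 * \<eta>) * Q - 0) / ((1 + \<eta>) * Q - 0))"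
  proof (rule D.tail_extrapolate)
    show "0 < (1 + \<eta>) * Q" "(1 + \<eta>) * Q \<le> (1 + 3 * \<eta>) * Q" using Q \<eta> by auto
    show "1 / 8 \<le> tail \<mu> (dev u) 0" by (rule depth[OF u])
    have "tail \<mu> (dev u) ((1 + \<eta>) * Q) < 1 / N"
      using N Q \<eta> by (intro tail_above_quantile) (auto simp: Q_def[symmetric])
    then show "tail \<mu> (dev u) ((1 + \<eta>) * Q) \<le> 1 / 8 * (8 / N)" by simp
  qed (use N in auto)
  also have "((1 + 3 * \<eta>) * Q - 0) / ((1 + \<eta>) * Q - 0) = (1 + 3 * \<eta>) / (1 + \<eta>)" using Q by simp
  also have "(8 / N) powr ((1 + 3 * \<eta>) / (1 + \<eta>)) \<le> (8 / N) powr (1 + \<eta>)"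
  proof (rule powr_mono')
    have "\<eta> * \<eta> \<le> \<eta> * 1" using \<eta> by (intro mult_left_mono) auto
    then show "1 + \<eta> \<le> (1 + 3 * \<eta>) / (1 + \<eta>)" using \<eta> by (simp add: field_simps)
  qed (use N in auto)
  also have "1 / 8 * (8 / N) powr (1 + \<eta>) = 1 / N * (8 / N) powr \<eta>"
    using N unfolding powr_add by simp
  finally show ?thesis by (simp add: Q_def)
qed

text \<open>
  Log-concavity between \<open>0\<close> and \<open>(1 - \<eta>) * quantile N u\<close>, a point strictly before the quantile, where
  the tail is still at least \<open>1 / N\<close>.
\<close>

lemma tail_before_quantile:
  assumes u: "nontriv u" and N: "16 \<le> N" and \<eta>: "0 < \<eta>" "\<eta> < 1 / 2"
  shows "1 / N * (N / 8) powr \<eta> \<le> tail \<mu> (dev u) ((1 - 2 * \<eta>) * quantile N u)"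
proof -
  interpret D: log_concave_tails \<mu> "dev u" by (rule dev_tails)
  define Q where "Q = quantile N u"
  have Q: "0 < Q" unfolding Q_def by (rule quantile_pos[OF u N])
  define a where "a = (1 - 2 * \<eta>) / (1 - \<eta>)"
  have a: "\<eta> \<le> 1 - a" using \<eta> by (simp add: a_def field_simps)
  have "1 / N * (N / 8) powr \<eta> \<le> 1 / N * (N / 8) powr (1 - a)"
    using N a by (intro mult_left_mono powr_mono) auto
  also have "\<dots> = (1 / 8) powr (1 - a) * (1 / N) powr a"
    using N by (simp add: powr_divide powr_diff)
  also have "\<dots> \<le> tail \<mu> (dev u) ((1 - 2 * \<eta>) * Q)"
  proof (rule D.tail_interpolate)
    show "0 < (1 - 2 * \<eta>) * Q" "(1 - 2 * \<eta>) * Q < (1 - \<eta>) * Q" using Q \<eta> by auto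
    show "1 / 8 \<le> tail \<mu> (dev u) 0" by (rule depth[OF u])
    show "1 / N \<le> tail \<mu> (dev u) ((1 - \<eta>) * Q)"
      using N Q \<eta> by (intro tail_below_quantile) (auto simp: Q_def[symmetric])
    show "a = ((1 - 2 * \<eta>) * Q - 0) / ((1 - \<eta>) * Q - 0)" using Q by (simp add: a_def)
  qed (use N in auto)
  finally show ?thesis by (simp add: Q_def)
qed

lemma tail_subadditive:
  assumes "\<And>x. dev t x = dev u x + dev w x"
  shows "tail \<mu> (dev t) (a + b) \<le> tail \<mu> (dev u) a + tail \<mu> (dev w) b"
proof -
  have "tail \<mu> (dev t) (a + b) \<le> prob ({x \<in> space \<mu>. a < dev u x} \<union> {x \<in> space \<mu>. b < dev w x})"
    unfolding tail_def assms by (intro finite_measure_mono) auto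
  also have "\<dots> \<le> tail \<mu> (dev u) a + tail \<mu> (dev w) b"
    unfolding tail_def by (rule measure_Un_le) auto
  finally show ?thesis .
qed

text \<open>
  The quantile is not a norm, so the triangle inequality is replaced by a union bound for
  half-spaces. It loses a factor 2 in the tail, which the decay beyond the
  quantile compensates.
\<close>

lemma quantile_perturb:
  assumes u: "nontriv u" and N: "16 \<le> N" and \<eta>: "0 < \<eta>" "\<eta> \<le> 1"
    and half: "(8 / N) powr \<eta> \<le> 1 / 2"
    and \<sigma>: "0 < \<sigma>" "cov w w \<le> \<sigma>\<^sup>2" and w: "\<And>x. dev t x = dev u x + dev w x"
  shows "quantile N t \<le> (1 + 3 * \<eta>) * quantile N u + 12 * \<sigma> * ln N"
proof (rule quantile_le)
  have "tail \<mu> (dev t) ((1 + 3 * \<eta>) * quantile N u + 12 * \<sigma> * ln N)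
      \<le> tail \<mu> (dev u) ((1 + 3 * \<eta>) * quantile N u) + tail \<mu> (dev w) (12 * \<sigma> * ln N)"
    by (rule tail_subadditive[OF w])
  also have "\<dots> < 1 / N * (8 / N) powr \<eta> + 1 / (2 * N)"
    by (intro add_le_less_mono tail_beyond_quantile[OF u N \<eta>] tail_dev_small[OF N \<sigma>])
  also have "\<dots> \<le> 1 / N * (1 / 2) + 1 / (2 * N)"
    using N half by (intro add_right_mono mult_left_mono) auto
  also have "\<dots> = 1 / N" by simp
  finally show "tail \<mu> (dev t) ((1 + 3 * \<eta>) * quantile N u + 12 * \<sigma> * ln N) < 1 / N" .
qed (use N in simp)

text \<open>
  The infimum defining the floating body runs over open half-spaces \<open>{x. b < ip d u x}\<close> with \<open>b < ip d u y\<close>,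
  that is, over all points strictly before \<open>dev u y\<close>; their tails are at least \<open>1 / N\<close> exactly when
  \<open>dev u y\<close> does not exceed the quantile.
\<close>

lemma floating_body_iff:
  assumes d: "1 \<le> d" and N: "2 < N"
  shows "y \<in> floating_body d \<mu> (1 / N) \<longleftrightarrow>
    y \<in> Rn d \<and> (\<forall>u. nontriv u \<longrightarrow> dev u y \<le> quantile N u)"
proof (cases "y \<in> Rn d")
  case True
  let ?A = "{H \<in> open_halfspaces d. y \<in> H}"
  define H where "H u b = {y \<in> Rn d. (\<Sum>i<d. u i * y i) > b}" for u :: "nat \<Rightarrow> real" and b :: real
  have A: "?A = {H u b |u b. nontriv u \<and> b < ip d u y}"
    using True unfolding open_halfspaces_def H_def ip_def nontriv_def by auto
  have ne: "?A \<noteq> {}"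
  proof -
    have "nontriv (\<lambda>_. 1)" unfolding nontriv_def using d by (intro exI[of _ 0]) auto
    moreover have "ip d (\<lambda>_. 1) y - 1 < ip d (\<lambda>_. 1) y" by simp
    ultimately have "H (\<lambda>_. 1) (ip d (\<lambda>_. 1) y - 1) \<in> ?A" unfolding A by blast
    then show ?thesis by blast
  qed
  have bdd: "bdd_below (measure \<mu> ` ?A)" by (auto simp: bdd_below_def intro: exI[of _ 0])
  have meas: "measure \<mu> (H u b) = tail \<mu> (dev u) (b - ip d u centroid)" for u b
    unfolding tail_def H_def dev_def ip_def[symmetric] by (rule arg_cong[where f = prob]) auto
  have "1 / N \<le> floating_fun d \<mu> y \<longleftrightarrow> (\<forall>H\<in>?A. 1 / N \<le> measure \<mu> H)"
    unfolding floating_fun_def by (rule le_cINF_iff[OF ne bdd])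
  also have "\<dots> \<longleftrightarrow> (\<forall>u b. nontriv u \<and> b < ip d u y \<longrightarrow> 1 / N \<le> tail \<mu> (dev u) (b - ip d u centroid))"
    unfolding A meas[symmetric] by blast
  also have "\<dots> \<longleftrightarrow> (\<forall>u. nontriv u \<longrightarrow> dev u y \<le> quantile N u)"
  proof (intro iffI allI impI)
    fix u :: "nat \<Rightarrow> real" assume *: "\<forall>u b. nontriv u \<and> b < ip d u y \<longrightarrow> 1 / N \<le> tail \<mu> (dev u) (b - ip d u centroid)"
      and u: "nontriv u"
    show "dev u y \<le> quantile N u"
    proof (rule dense_le)
      fix t assume "t < dev u y"
      then have "t + ip d u centroid < ip d u y" by (simp add: dev_def)
      then have "1 / N \<le> tail \<mu> (dev u) (t + ip d u centroid - ip d u centroid)" using * u by blast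
      then show "t \<le> quantile N u" by (intro quantile_ge[OF N]) simp
    qed
  next
    fix u :: "nat \<Rightarrow> real" and b :: real
    assume *: "\<forall>u. nontriv u \<longrightarrow> dev u y \<le> quantile N u" and u: "nontriv u \<and> b < ip d u y"
    then have "b - ip d u centroid < quantile N u" by (auto simp: dev_def intro: less_le_trans)
    then show "1 / N \<le> tail \<mu> (dev u) (b - ip d u centroid)" by (rule tail_below_quantile[OF N])
  qed
  finally show ?thesis using True by (simp add: floating_body_def)
next
  case False then show ?thesis by (simp add: floating_body_def)
qed

end

section \<open>A finite net of directions\<close>

context log_concave_measure
begin

definition comb :: "(nat \<Rightarrow> nat \<Rightarrow> real) \<Rightarrow> (nat \<Rightarrow> real) \<Rightarrow> nat \<Rightarrow> real" where
  "comb e c = (\<lambda>i. \<Sum>j<d. c j * e j i)"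

definition isotropic :: "(nat \<Rightarrow> nat \<Rightarrow> real) \<Rightarrow> bool" where
  "isotropic e \<longleftrightarrow> (\<forall>j<d. \<forall>l<d. cov (e j) (e l) = (if j = l then 1 else 0))"

lemma dev_comb: "dev (comb e c) x = (\<Sum>j<d. c j * dev (e j) x)"
  unfolding comb_def by (rule dev_sum) simp

lemma cov_comb:
  assumes "isotropic e"
  shows "cov (comb e c) (comb e c) = (\<Sum>j<d. (c j)\<^sup>2)"
proof -
  have left: "cov (comb e c) w = (\<Sum>j<d. c j * cov (e j) w)" for w
    unfolding comb_def by (rule bilinear_sum_left[OF cov_linear]) simp
  have "cov (e j) (comb e c) = c j" if "j < d" for j
  proof -
    have "cov (e j) (comb e c) = cov (comb e c) (e j)" by (rule cov_sym)
    also have "\<dots> = (\<Sum>l<d. if l = j then c l else 0)"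
      unfolding left using assms that by (intro sum.cong) (auto simp: isotropic_def)
    also have "\<dots> = c j" using that by simp
    finally show ?thesis .
  qed
  then show ?thesis by (subst left) (simp add: power2_eq_square)
qed

lemma nontriv_comb:
  assumes "isotropic e" "j < d" "c j \<noteq> 0"
  shows "nontriv (comb e c)"
proof (rule ccontr)
  assume "\<not> nontriv (comb e c)"
  then have "dev (comb e c) x = 0" for x by (simp add: nontriv_def dev_def ip_def)
  then have "cov (comb e c) (comb e c) = 0" by (simp add: cov_def)
  moreover have "0 < (\<Sum>j<d. (c j)\<^sup>2)" using assms by (intro sum_pos2[of _ j]) auto
  ultimately show False using cov_comb[OF assms(1)] by simp
qed

definition net :: "(nat \<Rightarrow> nat \<Rightarrow> real) \<Rightarrow> nat \<Rightarrow> (nat \<Rightarrow> real) set" where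
  "net e m = (\<lambda>k. comb e (\<lambda>j. real_of_int (k j) / real m)) `
     {k \<in> {..<d} \<rightarrow>\<^sub>E {- int m..int m}. \<exists>j<d. k j \<noteq> 0}"

lemma finite_net: "finite (net e m)"
  unfolding net_def by (intro finite_imageI finite_subset[OF _ finite_PiE[of "{..<d}" "\<lambda>_. {- int m..int m}"]]) auto

lemma card_net_le: "card (net e m) \<le> (2 * m + 1) ^ d"
proof -
  let ?P = "{..<d} \<rightarrow>\<^sub>E {- int m..int m}"
  have fin: "finite ?P" by (intro finite_PiE) auto
  have "card (net e m) \<le> card {k \<in> ?P. \<exists>j<d. k j \<noteq> 0}"
    unfolding net_def by (rule card_image_le) (use fin in auto)
  also have "\<dots> \<le> card ?P" by (rule card_mono[OF fin]) auto
  also have "\<dots> = (2 * m + 1) ^ d" by (simp add: card_PiE nat_add_distrib nat_mult_distrib)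
  finally show ?thesis .
qed

lemma nontriv_net:
  assumes "isotropic e" "0 < m" "t \<in> net e m"
  shows "nontriv t"
proof -
  obtain k j where k: "t = comb e (\<lambda>j. real_of_int (k j) / real m)" "j < d" "k j \<noteq> 0"
    using assms(3) unfolding net_def by blast
  show ?thesis unfolding k(1) by (rule nontriv_comb[OF assms(1) k(2)]) (use k assms(2) in simp)
qed

lemma quantile_cong:
  assumes "\<And>x. dev u x = dev v x"
  shows "quantile N u = quantile N v"
proof -
  have "tail \<mu> (dev u) t = tail \<mu> (dev v) t" for t
    unfolding tail_def assms by (rule refl)
  then show ?thesis unfolding quantile_def by presburger
qed

text \<open>
  Let \<open>t\<close> be the grid direction next to \<open>u\<close>. Their difference has standard deviation at most \<open>d / m\<close>, so
  passing from \<open>u\<close> to \<open>t\<close> changes the quantile by \<open>\<delta> = 12 * (d / m) * ln N\<close> at most, besides the factor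
  \<open>1 + 3 * \<eta>\<close>. The basis directions and their negatives belong to the net, hence bound the coordinates
  of all sample points, and \<open>dev u\<close> and \<open>dev t\<close> differ by at most \<open>2 * \<delta>\<close> on the sample. As
  \<open>quantile N u \<ge> 1/600\<close>, the choice of \<open>m\<close> makes \<open>\<delta>\<close> negligible against \<open>\<eta> * quantile N u\<close>.
\<close>

lemma net_controls_unit_directions:
  fixes x :: "nat \<Rightarrow> nat \<Rightarrow> real"
  assumes e: "isotropic e" and N: "16 \<le> N" and \<eta>: "0 < \<eta>" "\<eta> \<le> 1 / 12"
    and half: "(8 / N) powr \<eta> \<le> 1 / 2" and d: "1 \<le> d"
    and m: "0 < m" "36000 * real d * ln N / \<eta> \<le> real m"
    and low: "\<And>t. t \<in> net e m \<Longrightarrow> \<exists>i<n. (1 - 2 * \<eta>) * quantile N t < dev t (x i)"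
    and up: "\<And>t i. t \<in> net e m \<Longrightarrow> i < n \<Longrightarrow> dev t (x i) \<le> (1 + 3 * \<eta>) * quantile N t"
    and c: "\<And>j. j < d \<Longrightarrow> \<bar>c j\<bar> \<le> 1" "j0 < d" "\<bar>c j0\<bar> = 1"
  defines "u \<equiv> comb e c"
  shows "\<exists>i<n. quantile N u \<le> (1 + 12 * \<eta>) * dev u (x i)"
    and "\<And>i. i < n \<Longrightarrow> dev u (x i) \<le> (1 + 12 * \<eta>) * quantile N u"
proof -
  define k where "k = (\<lambda>j\<in>{..<d}. \<lfloor>real m * c j\<rfloor>)"
  define t where "t = comb e (\<lambda>j. real_of_int (k j) / real m)"
  define b where "b = (\<lambda>j. real_of_int (k j) / real m - c j)"
  define L where "L = ln N"
  define \<delta> where "\<delta> = 12 * (real d / real m) * L"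
  have L: "0 < L" using N by (simp add: L_def)
  have b: "\<bar>b j\<bar> \<le> 1 / real m" if "j < d" for j
  proof -
    have "\<bar>real_of_int \<lfloor>real m * c j\<rfloor> - real m * c j\<bar> \<le> 1" by linarith
    moreover have "b j = (real_of_int \<lfloor>real m * c j\<rfloor> - real m * c j) / real m"
      using that m by (simp add: b_def k_def field_simps)
    ultimately show ?thesis using m by (simp add: divide_right_mono)
  qed
  have kmem: "k \<in> {..<d} \<rightarrow>\<^sub>E {- int m..int m}"
  proof (rule PiE_I)
    fix j assume "j \<in> {..<d}"
    then have cj: "-1 \<le> c j" "c j \<le> 1" and j: "j < d" using c(1)[of j] by auto
    have "real m * (-1) \<le> real m * c j" "real m * c j \<le> real m * 1"
      using mult_left_mono[OF cj(1), of "real m"] mult_left_mono[OF cj(2), of "real m"] by simp_all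
    then have "- int m \<le> \<lfloor>real m * c j\<rfloor>" "\<lfloor>real m * c j\<rfloor> \<le> int m"
      by (simp_all add: le_floor_iff floor_le_iff)
    then show "k j \<in> {- int m..int m}" using j by (simp add: k_def)
  qed (simp add: k_def)
  have "k j0 \<noteq> 0"
  proof -
    have "c j0 = 1 \<or> c j0 = -1" using c(3) by linarith
    moreover have "\<lfloor>- real m\<rfloor> = - int m" by (metis floor_of_int of_int_minus of_int_of_nat_eq)
    ultimately show ?thesis using c(2) m by (auto simp: k_def)
  qed
  then have t: "t \<in> net e m" unfolding net_def t_def using kmem c(2) by blast
  have e_net: "(\<lambda>i. s * e j i) \<in> net e m" if j: "j < d" and s: "s = 1 \<or> s = -1" for j s
  proof -
    \<comment> \<open>The grid point with coordinate m or - m in position j is the basis direction itself or its negative.\<close>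
    define h where "h = (\<lambda>l\<in>{..<d}. if l = j then (if s = 1 then int m else - int m) else 0)"
    have "comb e (\<lambda>l. real_of_int (h l) / real m) = (\<lambda>i. s * e j i)"
    proof (rule ext)
      fix i
      have "comb e (\<lambda>l. real_of_int (h l) / real m) i = (\<Sum>l<d. if l = j then s * e j i else 0)"
        unfolding comb_def using m s by (intro sum.cong) (auto simp: h_def)
      then show "comb e (\<lambda>l. real_of_int (h l) / real m) i = s * e j i" using j by simp
    qed
    moreover have "h \<in> {..<d} \<rightarrow>\<^sub>E {- int m..int m}" by (auto simp: h_def)
    moreover have "h j \<noteq> 0" using j m by (simp add: h_def)
    ultimately show ?thesis unfolding net_def using j by (intro image_eqI[of _ _ h]) auto
  qed
  have ej: "\<bar>dev (e j) (x i)\<bar> \<le> 24 * L" if j: "j < d" and i: "i < n" for i j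
  proof -
    have bound: "s * dev (e j) (x i) \<le> 24 * L" if s: "s = 1 \<or> s = -1" for s
    proof -
      have "cov (\<lambda>i. s * e j i) (\<lambda>i. s * e j i) = s * (s * cov (e j) (e j))"
        using cov_linear[of s "e j" 0 "e j"] cov_sym by simp
      also have "\<dots> = 1\<^sup>2" using e j s by (auto simp: isotropic_def)
      finally have q: "quantile N (\<lambda>i. s * e j i) \<le> 12 * 1 * ln N"
        by (intro quantile_le_dev N) auto
      have "s * dev (e j) (x i) = dev (\<lambda>i. s * e j i) (x i)" by (simp add: dev_scale)
      also have "\<dots> \<le> (1 + 3 * \<eta>) * quantile N (\<lambda>i. s * e j i)" by (rule up[OF e_net[OF j s] i])
      also have "\<dots> \<le> (1 + 3 * \<eta>) * (12 * L)" using \<eta> q by (intro mult_left_mono) (auto simp: L_def)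
      also have "\<dots> \<le> 2 * (12 * L)" using \<eta> L by (intro mult_right_mono) auto
      finally show ?thesis by simp
    qed
    from bound[of 1] bound[of "-1"] show ?thesis by simp
  qed
  have w: "dev (comb e b) (x i) = dev t (x i) - dev u (x i)" and w': "dev t y = dev u y + dev (comb e b) y"
    and w'': "dev u y = dev t y + dev (comb e (\<lambda>j. - b j)) y" for i y
    by (simp_all add: dev_comb t_def u_def b_def left_diff_distrib sum_subtractf)
  have dm: "real d / real m \<ge> 0" by simp
  have covb: "(\<Sum>j<d. (b j)\<^sup>2) \<le> (real d / real m)\<^sup>2"
  proof -
    have "(\<Sum>j<d. (b j)\<^sup>2) \<le> (\<Sum>j<d. (1 / real m)\<^sup>2)"
      using b by (intro sum_mono) (metis abs_ge_zero lessThan_iff power2_abs power_mono)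
    also have "\<dots> = real d * (1 / real m)\<^sup>2" by simp
    also have "\<dots> \<le> real d * real d * (1 / real m)\<^sup>2" using d by (intro mult_right_mono) auto
    also have "\<dots> = (real d / real m)\<^sup>2" by (simp add: power2_eq_square)
    finally show ?thesis .
  qed
  have sm: "0 < real d / real m" using d m by simp
  have nu: "nontriv u" unfolding u_def using c by (intro nontriv_comb[OF e, of j0]) auto
  have nt: "nontriv t" by (rule nontriv_net[OF e m(1) t])
  have \<eta>1: "\<eta> \<le> 1" using \<eta> by simp
  have Qt: "quantile N t \<le> (1 + 3 * \<eta>) * quantile N u + \<delta>"
    unfolding \<delta>_def L_def
    by (rule quantile_perturb[OF nu N \<eta>(1) \<eta>1 half sm _ w']) (simp add: cov_comb[OF e] covb)
  have Qu: "quantile N u \<le> (1 + 3 * \<eta>) * quantile N t + \<delta>"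
    unfolding \<delta>_def L_def
    by (rule quantile_perturb[OF nt N \<eta>(1) \<eta>1 half sm _ w'']) (simp add: cov_comb[OF e] covb)
  have Q600: "1 / 600 \<le> quantile N u"
  proof (rule quantile_ge_dev[OF nu N])
    have "1\<^sup>2 = (c j0)\<^sup>2" using c(3) by (metis power2_abs)
    also have "\<dots> \<le> (\<Sum>j<d. (c j)\<^sup>2)" using c(2) by (intro member_le_sum) auto
    finally show "1\<^sup>2 \<le> cov u u" unfolding u_def cov_comb[OF e] .
  qed simp
  have \<delta>: "0 \<le> \<delta>" "5 * \<delta> \<le> \<eta> * quantile N u"
  proof -
    show "0 \<le> \<delta>" using L by (simp add: \<delta>_def)
    \<comment> \<open>36000 is the product of 5, of 12 in the definition of \<delta>, and of 600 in the lower bound for the quantile.\<close>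
    have "36000 * real d * L \<le> real m * \<eta>" using m(2) \<eta> by (simp add: L_def field_simps)
    then have "5 * \<delta> \<le> \<eta> * (1 / 600)" using m(1) by (simp add: \<delta>_def field_simps)
    also have "\<dots> \<le> \<eta> * quantile N u" using Q600 \<eta> by (intro mult_left_mono) auto
    finally show "5 * \<delta> \<le> \<eta> * quantile N u" .
  qed
  have wb: "\<bar>dev t (x i) - dev u (x i)\<bar> \<le> 2 * \<delta>" if i: "i < n" for i
  proof -
    have "\<bar>dev (comb e b) (x i)\<bar> \<le> (\<Sum>j<d. \<bar>b j * dev (e j) (x i)\<bar>)" unfolding dev_comb by (rule sum_abs)
    also have "\<dots> \<le> (\<Sum>j<d. (1 / real m) * (24 * L))"
    proof (rule sum_mono)
      fix j assume "j \<in> {..<d}"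
      then have j: "j < d" by simp
      show "\<bar>b j * dev (e j) (x i)\<bar> \<le> (1 / real m) * (24 * L)"
        unfolding abs_mult by (intro mult_mono b ej j i) auto
    qed
    also have "\<dots> = 2 * \<delta>" by (simp add: \<delta>_def)
    finally show ?thesis unfolding w .
  qed
  define Q where "Q = quantile N u"
  have Q: "0 < Q" unfolding Q_def using Q600 by simp
  show "dev u (x i) \<le> (1 + 12 * \<eta>) * quantile N u" if i: "i < n" for i
  proof -
    have "dev u (x i) \<le> dev t (x i) + 2 * \<delta>" using wb[OF i] by linarith
    also have "\<dots> \<le> (1 + 3 * \<eta>) * quantile N t + 2 * \<delta>" using up[OF t i] by simp
    also have "\<dots> \<le> (1 + 3 * \<eta>) * ((1 + 3 * \<eta>) * Q + \<delta>) + 2 * \<delta>"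
      using Qt \<eta> unfolding Q_def by (intro add_right_mono mult_left_mono) auto
    also have "\<dots> = (1 + 6 * \<eta> + 9 * (\<eta> * \<eta>)) * Q + (3 + 3 * \<eta>) * \<delta>" by (simp add: algebra_simps)
    also have "\<dots> \<le> (1 + 6 * \<eta> + 9 * (\<eta> * (1 / 12))) * Q + 5 * \<delta>"
      using \<eta> Q \<delta> by (intro add_mono mult_right_mono mult_left_mono) auto
    also have "\<dots> \<le> (1 + 6 * \<eta> + 9 * (\<eta> * (1 / 12))) * Q + \<eta> * Q" using \<delta> by (simp add: Q_def)
    also have "\<dots> = (1 + 7.75 * \<eta>) * Q" by (simp add: algebra_simps)
    also have "\<dots> \<le> (1 + 12 * \<eta>) * Q" using \<eta> Q by (intro mult_right_mono) auto
    finally show ?thesis by (simp add: Q_def)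
  qed
  obtain i where i: "i < n" "(1 - 2 * \<eta>) * quantile N t < dev t (x i)" using low[OF t] by blast
  have "(1 - 5 * \<eta>) * (Q - \<delta>) \<le> (1 - 2 * \<eta>) * quantile N t"
  proof -
    have "(1 - 5 * \<eta>) * (Q - \<delta>) \<le> (1 - 5 * \<eta>) * ((1 + 3 * \<eta>) * quantile N t)"
      using Qu \<eta> by (intro mult_left_mono) (auto simp: Q_def)
    also have "\<dots> = (1 - 2 * \<eta> - 15 * (\<eta> * \<eta>)) * quantile N t" by (simp add: algebra_simps)
    also have "\<dots> \<le> (1 - 2 * \<eta>) * quantile N t"
      using quantile_pos[OF nt N] \<eta> by (intro mult_right_mono) auto
    finally show ?thesis .
  qed
  moreover have "dev t (x i) \<le> dev u (x i) + 2 * \<delta>" using wb[OF i(1)] by linarith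
  moreover have "(1 - 6 * \<eta>) * Q \<le> (1 - 5 * \<eta>) * (Q - \<delta>) - 2 * \<delta>"
  proof -
    have "(1 - 5 * \<eta>) * \<delta> \<le> 1 * \<delta>" using \<eta> \<delta> by (intro mult_right_mono) auto
    moreover have "(1 - 5 * \<eta>) * (Q - \<delta>) - 2 * \<delta> = (1 - 6 * \<eta>) * Q + \<eta> * Q - (1 - 5 * \<eta>) * \<delta> - 2 * \<delta>"
      by (simp add: algebra_simps)
    ultimately show ?thesis using \<delta> by (simp add: Q_def)
  qed
  ultimately have l: "(1 - 6 * \<eta>) * Q \<le> dev u (x i)" using i(2) by linarith
  have "Q \<le> (1 + 12 * \<eta>) * ((1 - 6 * \<eta>) * Q)"
  proof -
    have "12 * \<eta> * \<eta> \<le> 1 * \<eta>" using \<eta> by (intro mult_right_mono) auto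
    then have "1 \<le> (1 + 12 * \<eta>) * (1 - 6 * \<eta>)" by (simp add: algebra_simps)
    then have "1 * Q \<le> (1 + 12 * \<eta>) * (1 - 6 * \<eta>) * Q" using Q by (intro mult_right_mono) auto
    then show ?thesis by (simp add: mult.assoc)
  qed
  also have "\<dots> \<le> (1 + 12 * \<eta>) * dev u (x i)" using l \<eta> by (intro mult_left_mono) auto
  finally show "\<exists>i<n. quantile N u \<le> (1 + 12 * \<eta>) * dev u (x i)" using i(1) unfolding Q_def by blast
qed

text \<open>
  Quantiles and deviations are positively homogeneous in the direction, so it may be scaled until its
  largest coordinate is \<open>1\<close>.
\<close>

lemma net_controls_directions:
  fixes x :: "nat \<Rightarrow> nat \<Rightarrow> real"
  assumes e: "isotropic e" "\<And>u. \<exists>c. \<forall>i<d. u i = (\<Sum>j<d. c j * e j i)"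
    and N: "16 \<le> N" and \<eta>: "0 < \<eta>" "\<eta> \<le> 1 / 12"
    and half: "(8 / N) powr \<eta> \<le> 1 / 2" and d: "1 \<le> d"
    and m: "0 < m" "36000 * real d * ln N / \<eta> \<le> real m"
    and low: "\<And>t. t \<in> net e m \<Longrightarrow> \<exists>i<n. (1 - 2 * \<eta>) * quantile N t < dev t (x i)"
    and up: "\<And>t i. t \<in> net e m \<Longrightarrow> i < n \<Longrightarrow> dev t (x i) \<le> (1 + 3 * \<eta>) * quantile N t"
    and u: "nontriv u"
  shows "\<exists>i<n. quantile N u \<le> (1 + 12 * \<eta>) * dev u (x i)"
    and "\<And>i. i < n \<Longrightarrow> dev u (x i) \<le> (1 + 12 * \<eta>) * quantile N u"
proof -
  obtain c where c: "\<And>i. i < d \<Longrightarrow> u i = (\<Sum>j<d. c j * e j i)" using e(2)[of u] by blast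
  define s where "s = Max ((\<lambda>j. \<bar>c j\<bar>) ` {..<d})"
  have ne: "(\<lambda>j. \<bar>c j\<bar>) ` {..<d} \<noteq> {}" using d by (auto simp: lessThan_empty_iff)
  have s_ge: "\<bar>c j\<bar> \<le> s" if "j < d" for j unfolding s_def using that by (intro Max_ge) auto
  obtain j0 where j0: "j0 < d" "\<bar>c j0\<bar> = s" using Max_in[OF _ ne] unfolding s_def by auto
  have s: "0 < s"
  proof (rule ccontr)
    assume "\<not> 0 < s"
    then have "c j = 0" if "j < d" for j using s_ge[OF that] by simp
    then have "\<forall>i<d. u i = 0" using c by simp
    then show False using u by (auto simp: nontriv_def)
  qed
  define c' where "c' = (\<lambda>j. c j / s)"
  have c': "\<bar>c' j\<bar> \<le> 1" if "j < d" for j using s_ge[OF that] s by (simp add: c'_def)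
  have c'0: "\<bar>c' j0\<bar> = 1" using j0 s by (simp add: c'_def)
  have "dev u y = dev (comb e c) y" for y by (rule dev_cong) (simp add: comb_def c)
  moreover have "dev (comb e c) y = s * dev (comb e c') y" for y
    using s by (simp add: dev_comb c'_def sum_distrib_left)
  ultimately have du: "dev u y = s * dev (comb e c') y" for y by simp
  then have "dev u y = dev (\<lambda>i. s * comb e c' i) y" for y unfolding dev_scale .
  then have Qu: "quantile N u = s * quantile N (comb e c')"
    using quantile_cong[of u "\<lambda>i. s * comb e c' i" N] quantile_scale[OF _ s, of N "comb e c'"] N by simp
  have main1: "\<exists>i<n. quantile N (comb e c') \<le> (1 + 12 * \<eta>) * dev (comb e c') (x i)"
    using e(1) N \<eta> half d m low up c' j0(1) c'0 by (rule net_controls_unit_directions(1))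
  have main2: "dev (comb e c') (x i) \<le> (1 + 12 * \<eta>) * quantile N (comb e c')" if "i < n" for i
    using e(1) N \<eta> half d m low up c' j0(1) c'0 that
    by (rule net_controls_unit_directions(2)[where x = x and c = c' and n = n and m = m and e = e and N = N and \<eta> = \<eta> and ?j0.0 = j0])
  obtain i where "i < n" "quantile N (comb e c') \<le> (1 + 12 * \<eta>) * dev (comb e c') (x i)" using main1 by blast
  then have "s * quantile N (comb e c') \<le> s * ((1 + 12 * \<eta>) * dev (comb e c') (x i))" using s by (intro mult_left_mono) auto
  then show "\<exists>i<n. quantile N u \<le> (1 + 12 * \<eta>) * dev u (x i)"
    using \<open>i < n\<close> by (intro exI[of _ i]) (simp add: du Qu mult.left_commute)
  fix i assume i: "i < n"
  have "s * dev (comb e c') (x i) \<le> s * ((1 + 12 * \<eta>) * quantile N (comb e c'))"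
    using s main2[OF i] by (intro mult_left_mono) auto
  then show "dev u (x i) \<le> (1 + 12 * \<eta>) * quantile N u"
    by (simp add: du Qu mult.left_commute)
qed

end

section \<open>From directions to the logarithmic Hausdorff distance\<close>

lemma sum_fun_apply: "(\<Sum>i\<in>A. f i) j = (\<Sum>i\<in>A. f i j)" for f :: "'i \<Rightarrow> 'a \<Rightarrow> real"
  by (induction A rule: infinite_finite_induct) auto

lemma convex_Rn: "convex (Rn d)"
  by (rule affine_imp_convex[OF affine_Rn])

lemma convex_hull_subset_Rn: "X \<subseteq> Rn d \<Longrightarrow> convex hull X \<subseteq> Rn d"
  by (rule hull_minimal) (simp_all add: convex_Rn)

lemma Rn_eqI: "x \<in> Rn d \<Longrightarrow> y \<in> Rn d \<Longrightarrow> (\<And>i. i < d \<Longrightarrow> x i = y i) \<Longrightarrow> x = y"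
  unfolding Rn_def by (rule PiE_ext) auto

text \<open>
  Functions vanish outside \<open>{..<n}\<close> here rather than being \<open>undefined\<close>, so that Tychonoff's theorem for
  the product over all naturals applies.
\<close>

lemma compact_simplex: "compact {\<theta> :: nat \<Rightarrow> real. (\<forall>i. \<theta> i \<in> (if i < n then {0..1} else {0})) \<and> (\<Sum>i<n. \<theta> i) = 1}"
proof -
  have "compactin (product_topology (\<lambda>_. euclideanreal) (UNIV :: nat set))
      (PiE UNIV (\<lambda>i. if i < n then {0..1} else {0}))"
    unfolding compactin_PiE by auto
  then have "compact (PiE UNIV (\<lambda>i. if i < n then {0..1} else {0 :: real}))"
    by (simp add: euclidean_product_topology)
  moreover have "closed {\<theta> :: nat \<Rightarrow> real. (\<Sum>i<n. \<theta> i) = 1}"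
    by (intro closed_Collect_eq continuous_intros continuous_on_product_coordinates)
  ultimately have "compact (PiE UNIV (\<lambda>i. if i < n then {0..1} else {0 :: real}) \<inter> {\<theta>. (\<Sum>i<n. \<theta> i) = 1})"
    by (rule compact_Int_closed)
  moreover have "PiE UNIV (\<lambda>i. if i < n then {0..1} else {0 :: real}) \<inter> {\<theta>. (\<Sum>i<n. \<theta> i) = 1} =
     {\<theta>. (\<forall>i. \<theta> i \<in> (if i < n then {0..1} else {0})) \<and> (\<Sum>i<n. \<theta> i) = 1}"
    by (rule set_eqI) (simp only: Int_iff mem_Collect_eq PiE_UNIV_domain Pi_iff ball_UNIV)
  ultimately show ?thesis by simp
qed

text \<open>
  The point \<open>p\<close> of the hull nearest to \<open>y\<close> exists because the simplex of weights is compact. Moving \<open>p\<close>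
  towards a vertex does not decrease the distance, so in the direction \<open>u = y - p\<close> all vertices stay
  behind \<open>p\<close>; a vertex that is not behind \<open>y\<close> in this direction forces \<open>y = p\<close>.
\<close>

lemma mem_convex_hull_if_no_separation:
  fixes x :: "nat \<Rightarrow> nat \<Rightarrow> real"
  assumes n: "0 < n" and x: "\<And>i. i < n \<Longrightarrow> x i \<in> Rn d" and y: "y \<in> Rn d"
    and sep: "\<And>u. \<exists>i<n. ip d u y \<le> ip d u (x i)"
  shows "y \<in> convex hull (x ` {..<n})"
proof -
  define S where "S = {\<theta> :: nat \<Rightarrow> real. (\<forall>i. \<theta> i \<in> (if i < n then {0..1} else {0})) \<and> (\<Sum>i<n. \<theta> i) = 1}"
  define p where "p \<theta> j = (\<Sum>i<n. \<theta> i * x i j)" for \<theta> :: "nat \<Rightarrow> real" and j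
  define Q where "Q \<theta> = (\<Sum>j<d. (y j - p \<theta> j)\<^sup>2)" for \<theta>
  have "(\<lambda>i. if i = 0 then 1 else 0) \<in> S" using n by (auto simp: S_def)
  then have "S \<noteq> {}" by blast
  moreover have "continuous_on S Q"
    unfolding Q_def p_def
    by (intro continuous_intros continuous_on_subset[OF continuous_on_product_coordinates subset_UNIV])
  ultimately obtain \<theta> where \<theta>: "\<theta> \<in> S" "\<And>\<theta>'. \<theta>' \<in> S \<Longrightarrow> Q \<theta> \<le> Q \<theta>'"
    using continuous_attains_inf[OF compact_simplex[of n, folded S_def]] by blast
  have mem: "(\<Sum>i<n. \<theta> i *\<^sub>R x i) \<in> convex hull (x ` {..<n})"
  proof (rule convex_sum)
    show "0 \<le> \<theta> i" if "i \<in> {..<n}" for i using \<theta>(1) that by (auto simp: S_def split: if_splits)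
    show "x i \<in> convex hull (x ` {..<n})" if "i \<in> {..<n}" for i using that by (intro hull_inc) auto
  qed (use \<theta>(1) in \<open>auto simp: S_def convex_convex_hull\<close>)
  define u where "u j = y j - p \<theta> j" for j
  obtain k where k: "k < n" "ip d u y \<le> ip d u (x k)" using sep by blast
  define K where "K = (\<Sum>j<d. (x k j - p \<theta> j)\<^sup>2)"
  define D where "D = (\<Sum>j<d. u j * (x k j - p \<theta> j))"
  \<comment> \<open>First-order condition at the minimum, for moving a fraction s of the way to the vertex x k.\<close>
  have step: "2 * D \<le> s * K" if s: "0 < s" "s \<le> 1" for s
  proof -
    define \<theta>' where "\<theta>' i = (1 - s) * \<theta> i + (if i = k then s else 0)" for i
    have "\<theta>' i \<in> (if i < n then {0..1} else {0})" for i
    proof -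
      have ti: "\<theta> i \<in> (if i < n then {0..1} else {0})" using \<theta>(1) by (simp add: S_def)
      show ?thesis
      proof (cases "i < n")
        case True
        then have t01: "0 \<le> \<theta> i" "\<theta> i \<le> 1" using ti by auto
        have "(1 - s) * \<theta> i \<le> (1 - s) * 1" using t01 s by (intro mult_left_mono) auto
        moreover have "0 \<le> (1 - s) * \<theta> i" using t01 s by simp
        ultimately show ?thesis using True s by (auto simp: \<theta>'_def)
      next
        case False then show ?thesis using ti k by (auto simp: \<theta>'_def)
      qed
    qed
    moreover have "(\<Sum>i<n. \<theta>' i) = (1 - s) * (\<Sum>i<n. \<theta> i) + s"
      using k by (simp add: \<theta>'_def sum.distrib sum_distrib_left)
    ultimately have "\<theta>' \<in> S" using \<theta>(1) by (simp add: S_def)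
    from \<theta>(2)[OF this] have "Q \<theta> \<le> Q \<theta>'" .
    have p': "y j - p \<theta>' j = u j - s * (x k j - p \<theta> j)" for j
    proof -
      have "p \<theta>' j = (\<Sum>i<n. (1 - s) * (\<theta> i * x i j) + (if i = k then s * x i j else 0))"
        unfolding p_def \<theta>'_def by (intro sum.cong) (auto simp: algebra_simps)
      also have "\<dots> = (1 - s) * p \<theta> j + s * x k j"
        using k by (simp add: sum.distrib p_def sum_distrib_left)
      finally show ?thesis by (simp add: u_def algebra_simps)
    qed
    have "Q \<theta>' = (\<Sum>j<d. (u j)\<^sup>2 + s\<^sup>2 * (x k j - p \<theta> j)\<^sup>2 - 2 * s * (u j * (x k j - p \<theta> j)))"
    proof -
      have "(u j - s * w)\<^sup>2 = (u j)\<^sup>2 + s\<^sup>2 * w\<^sup>2 - 2 * s * (u j * w)" for j w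
        by (simp add: power2_eq_square algebra_simps)
      then show ?thesis unfolding Q_def p' by presburger
    qed
    also have "\<dots> = Q \<theta> + s\<^sup>2 * K - 2 * s * D"
      by (simp add: Q_def u_def K_def D_def sum.distrib sum_subtractf sum_distrib_left)
    finally have "2 * s * D \<le> s\<^sup>2 * K" using \<open>Q \<theta> \<le> Q \<theta>'\<close> by simp
    then have "s * (2 * D) \<le> s * (s * K)" by (simp add: power2_eq_square algebra_simps)
    then show ?thesis using s by simp
  qed
  have K0: "0 \<le> K" unfolding K_def by (intro sum_nonneg) auto
  have "D \<le> 0"
  proof (rule ccontr)
    assume "\<not> D \<le> 0"
    define s where "s = min 1 (D / (K + 1))"
    have s: "0 < s" "s \<le> 1" using \<open>\<not> D \<le> 0\<close> K0 by (auto simp: s_def)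
    have "s * K \<le> D / (K + 1) * K" unfolding s_def using K0 by (intro mult_right_mono) auto
    also have "\<dots> \<le> D" using K0 \<open>\<not> D \<le> 0\<close> by (simp add: field_simps)
    finally show False using step[OF s] \<open>\<not> D \<le> 0\<close> by simp
  qed
  have "(\<Sum>j<d. (u j)\<^sup>2) = ip d u y - ip d u (p \<theta>)"
    unfolding ip_def sum_subtractf[symmetric]
    by (intro sum.cong) (auto simp: u_def power2_eq_square algebra_simps)
  also have "\<dots> \<le> ip d u (x k) - ip d u (p \<theta>)" using k by simp
  also have "\<dots> = D" by (simp add: ip_def D_def sum_subtractf algebra_simps)
  finally have "(\<Sum>j<d. (u j)\<^sup>2) \<le> 0" using \<open>D \<le> 0\<close> by simp
  then have "(\<Sum>j<d. (u j)\<^sup>2) = 0" by (intro antisym sum_nonneg) auto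
  then have u0: "u j = 0" if "j < d" for j using that by (simp add: sum_nonneg_eq_0_iff)
  have "y = (\<Sum>i<n. \<theta> i *\<^sub>R x i)"
  proof (rule Rn_eqI[OF y])
    show "(\<Sum>i<n. \<theta> i *\<^sub>R x i) \<in> Rn d" using mem convex_hull_subset_Rn[of "x ` {..<n}" d] x by auto
    show "y i = (\<Sum>i<n. \<theta> i *\<^sub>R x i) i" if "i < d" for i
      using u0[OF that] by (simp add: u_def p_def sum_fun_apply scaleR_fun_def)
  qed
  then show ?thesis using mem by simp
qed

lemma ip_convex_hull_le:
  assumes "y \<in> convex hull X" "\<And>x. x \<in> X \<Longrightarrow> ip d u x \<le> c"
  shows "ip d u y \<le> c"
proof -
  have "convex {y. ip d u y \<le> c}"
    by (rule convexI) (auto simp: ip_affine intro: convex_bound_le)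
  then have "convex hull X \<subseteq> {y. ip d u y \<le> c}" using assms(2) by (intro hull_minimal) auto
  then show ?thesis using assms(1) by blast
qed

definition cube :: "nat \<Rightarrow> (nat \<Rightarrow> real) \<Rightarrow> real \<Rightarrow> (nat \<Rightarrow> real) set" where
  "cube d z r = {y \<in> Rn d. \<forall>i<d. \<bar>y i - z i\<bar> < r}"

lemma cube_eq_PiE: "cube d z r = PiE {..<d} (\<lambda>i. {z i - r<..<z i + r})"
  by (rule set_eqI)
    (auto simp only: cube_def Rn_def PiE_iff abs_diff_less_iff mem_Collect_eq UNIV_I greaterThanLessThan_iff lessThan_iff)

lemma openin_cube: "openin (Rn_topology d) (cube d z r)"
  unfolding cube_eq_PiE Rn_topology_def by (simp add: openin_PiE)

lemma cube_subset_cube: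
  assumes "\<And>i. i < d \<Longrightarrow> \<bar>q i - z i\<bar> + s \<le> r"
  shows "cube d q s \<subseteq> cube d z r"
  unfolding cube_def
proof (intro subsetI CollectI conjI allI impI; elim CollectE conjE)
  fix y i assume "\<forall>i<d. \<bar>y i - q i\<bar> < s" and i: "i < d"
  then have "\<bar>y i - q i\<bar> < s" by blast
  then show "\<bar>y i - z i\<bar> < r" using assms[OF i] by linarith
qed

lemma interior_cube_iff:
  "z \<in> Rn_topology d interior_of S \<longleftrightarrow> z \<in> Rn d \<and> (\<exists>r>0. cube d z r \<subseteq> S)"
proof
  assume "z \<in> Rn_topology d interior_of S"
  then obtain T where T: "openin (Rn_topology d) T" "z \<in> T" "T \<subseteq> S" by (auto simp: interior_of_def)
  then have z: "z \<in> Rn d" using openin_subset topspace_Rn_topology by blast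
  have "\<exists>U. (\<forall>i\<in>{..<d}. open (U i)) \<and> z \<in> PiE {..<d} U \<and> PiE {..<d} U \<subseteq> T"
    using T(1,2) unfolding Rn_topology_def openin_product_topology_alt by auto
  then obtain U where U: "\<And>i. i < d \<Longrightarrow> open (U i)" "z \<in> PiE {..<d} U" "PiE {..<d} U \<subseteq> T"
    by auto
  have "\<exists>r>0. \<forall>v. \<bar>v - z i\<bar> < r \<longrightarrow> v \<in> U i" if "i < d" for i
  proof -
    have "z i \<in> U i" using U(2) that by auto
    then show ?thesis using U(1)[OF that] unfolding open_dist dist_real_def by blast
  qed
  then obtain r where r: "\<And>i. i < d \<Longrightarrow> 0 < r i" "\<And>i v. i < d \<Longrightarrow> \<bar>v - z i\<bar> < r i \<Longrightarrow> v \<in> U i"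
    by metis
  define R where "R = Min (insert 1 (r ` {..<d}))"
  have R0: "0 < R" unfolding R_def using r(1) by (subst Min_gr_iff) auto
  have R_le: "R \<le> r i" if "i < d" for i unfolding R_def using that by (intro Min_le) auto
  have "cube d z R \<subseteq> PiE {..<d} U"
  proof
    fix y assume y: "y \<in> cube d z R"
    show "y \<in> PiE {..<d} U"
    proof (rule PiE_I)
      fix i assume "i \<in> {..<d}"
      then have i: "i < d" by simp
      then have "\<bar>y i - z i\<bar> < r i" using y R_le[OF i] unfolding cube_def by fastforce
      then show "y i \<in> U i" by (rule r(2)[OF i])
    next
      fix i assume "i \<notin> {..<d}"
      then show "y i = undefined" using y unfolding cube_def Rn_def by (blast intro: PiE_arb)
    qed
  qed
  then show "z \<in> Rn d \<and> (\<exists>r>0. cube d z r \<subseteq> S)" using z R0 U(3) T(3) by blast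
next
  assume "z \<in> Rn d \<and> (\<exists>r>0. cube d z r \<subseteq> S)"
  then obtain r where r: "z \<in> Rn d" "0 < r" "cube d z r \<subseteq> S" by blast
  then have "z \<in> cube d z r" by (simp add: cube_def)
  moreover have "cube d z r \<subseteq> Rn_topology d interior_of S" by (rule interior_of_maximal[OF r(3) openin_cube])
  ultimately show "z \<in> Rn_topology d interior_of S" by blast
qed

lemma homothety_apply: "(s *\<^sub>R (y - z) + z) i = s * (y i - z i) + z i" for y z :: "nat \<Rightarrow> real"
  by (simp add: scaleR_fun_def)

lemma homothety_mem_Rn:
  assumes "y \<in> Rn d" "z \<in> Rn d"
  shows "s *\<^sub>R (y - z) + z \<in> Rn d"
proof -
  have "s *\<^sub>R (y - z) + z = s *\<^sub>R y + (1 - s) *\<^sub>R z"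
    by (simp add: fun_eq_iff scaleR_fun_def algebra_simps)
  then show ?thesis using affine_Rn[of d] assms unfolding affine_def by simp
qed

context log_concave_measure
begin

lemma dev_homothety: "dev u (s *\<^sub>R (y - centroid) + centroid) = s * dev u y"
proof -
  have "dev u (s *\<^sub>R (y - centroid) + centroid) = (\<Sum>i<d. u i * (s * (y i - centroid i) + centroid i) - u i * centroid i)"
    unfolding dev_def ip_def homothety_apply sum_subtractf[symmetric] ..
  also have "\<dots> = s * dev u y"
    unfolding dev_def ip_def sum_subtractf[symmetric] sum_distrib_left
    by (intro sum.cong) (auto simp: algebra_simps)
  finally show ?thesis .
qed

text \<open>
  In isotropic coordinates the quantile is at least a multiple of the length of \<open>u\<close>, which dominates
  \<open>dev u y\<close> near the centroid.
\<close>

lemma cube_in_floating_body: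
  assumes d: "1 \<le> d" and N: "16 \<le> N" and e: "isotropic e" "\<And>u. \<exists>c. \<forall>i<d. u i = (\<Sum>j<d. c j * e j i)"
  obtains r where "0 < r" "cube d centroid r \<subseteq> floating_body d \<mu> (1 / N)"
proof -
  define K where "K = (\<Sum>i<d. \<Sum>j<d. \<bar>e j i\<bar>)"
  have K: "0 \<le> K" unfolding K_def by (intro sum_nonneg) auto
  define r where "r = 1 / (600 * (K + 1))"
  have r: "0 < r" "r * K \<le> 1 / 600" using K by (auto simp: r_def field_simps)
  have "dev u y \<le> quantile N u" if y: "y \<in> cube d centroid r" and u: "nontriv u" for y u
  proof -
    obtain c where c: "\<And>i. i < d \<Longrightarrow> u i = (\<Sum>j<d. c j * e j i)" using e(2)[of u] by blast
    have "dev u x = dev (comb e c) x" for x by (rule dev_cong) (simp add: comb_def c)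
    then have "cov u u = cov (comb e c) (comb e c)" by (simp add: cov_def)
    then have cu: "cov u u = (\<Sum>j<d. (c j)\<^sup>2)" using cov_comb[OF e(1)] by simp
    define \<sigma> where "\<sigma> = sqrt (cov u u)"
    have \<sigma>: "0 < \<sigma>" "\<sigma>\<^sup>2 = cov u u" using cov_pos[OF u] by (auto simp: \<sigma>_def)
    have cj: "\<bar>c j\<bar> \<le> \<sigma>" if "j < d" for j
    proof -
      have "(c j)\<^sup>2 \<le> (\<Sum>j<d. (c j)\<^sup>2)" using that by (intro member_le_sum) auto
      then show ?thesis unfolding \<sigma>_def cu by (rule real_le_rsqrt[of "\<bar>c j\<bar>", unfolded power2_abs])
    qed
    have ui: "\<bar>u i\<bar> \<le> \<sigma> * (\<Sum>j<d. \<bar>e j i\<bar>)" if "i < d" for i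
    proof -
      have "\<bar>u i\<bar> \<le> (\<Sum>j<d. \<bar>c j * e j i\<bar>)" unfolding c[OF that] by (rule sum_abs)
      also have "\<dots> \<le> (\<Sum>j<d. \<sigma> * \<bar>e j i\<bar>)" 
        unfolding abs_mult using cj by (intro sum_mono mult_right_mono) auto
      finally show ?thesis by (simp add: sum_distrib_left)
    qed
    have "dev u y = (\<Sum>i<d. u i * (y i - centroid i))"
      by (simp add: dev_def ip_def sum_subtractf algebra_simps)
    also have "\<dots> \<le> (\<Sum>i<d. \<bar>u i * (y i - centroid i)\<bar>)" by (intro sum_mono) auto
    also have "\<dots> \<le> (\<Sum>i<d. (\<sigma> * (\<Sum>j<d. \<bar>e j i\<bar>)) * r)"
    proof (rule sum_mono)
      fix i assume "i \<in> {..<d}"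
      then have i: "i < d" by simp
      have "\<bar>y i - centroid i\<bar> \<le> r" using y i by (auto simp: cube_def intro: less_imp_le)
      moreover have "0 \<le> \<sigma> * (\<Sum>j<d. \<bar>e j i\<bar>)" using ui[OF i] by linarith
      ultimately show "\<bar>u i * (y i - centroid i)\<bar> \<le> (\<sigma> * (\<Sum>j<d. \<bar>e j i\<bar>)) * r"
        unfolding abs_mult using ui[OF i] by (intro mult_mono) auto
    qed
    also have "\<dots> = \<sigma> * (r * K)" by (simp add: K_def sum_distrib_left sum_distrib_right algebra_simps)
    also have "\<dots> \<le> \<sigma> * (1 / 600)" using r \<sigma> by (intro mult_left_mono) auto
    also have "\<dots> \<le> quantile N u" using quantile_ge_dev[OF u N \<sigma>(1)] \<sigma>(2) by simp
    finally show ?thesis .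
  qed
  then have "cube d centroid r \<subseteq> floating_body d \<mu> (1 / N)"
    using N by (auto simp: floating_body_iff[OF d] cube_def)
  then show ?thesis using that r(1) by blast
qed

text \<open>
  The lower bound on the sample places the floating body, contracted towards the centroid, inside the
  polytope; the upper bound does the converse. A cube around the centroid inside the floating body is
  contracted into the polytope, so the centroid is admissible as an interior centre.
\<close>

lemma log_Hausdorff_dist_le_if_directions:
  fixes x :: "nat \<Rightarrow> nat \<Rightarrow> real"
  assumes d: "1 \<le> d" and n: "0 < n" and N: "16 \<le> N"
    and e: "isotropic e" "\<And>u. \<exists>c. \<forall>i<d. u i = (\<Sum>j<d. c j * e j i)"
    and x: "\<And>i. i < n \<Longrightarrow> x i \<in> Rn d" and l: "1 \<le> l"
    and low: "\<And>u. nontriv u \<Longrightarrow> \<exists>i<n. quantile N u \<le> l * dev u (x i)"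
    and up: "\<And>u i. nontriv u \<Longrightarrow> i < n \<Longrightarrow> dev u (x i) \<le> l * quantile N u"
  shows "log_Hausdorff_dist d (convex hull (x ` {..<n})) (floating_body d \<mu> (1 / N)) \<le> ereal l"
proof -
  let ?P = "convex hull (x ` {..<n})" and ?F = "floating_body d \<mu> (1 / N)"
  have N2: "2 < N" using N by simp
  note F_iff = floating_body_iff[OF d N2]
  have P_Rn: "?P \<subseteq> Rn d" using x by (intro convex_hull_subset_Rn) auto
  have F_in_P: "(1 / l) *\<^sub>R (y - centroid) + centroid \<in> ?P" if y: "y \<in> ?F" for y
  proof (rule mem_convex_hull_if_no_separation[OF n])
    show "x i \<in> Rn d" if "i < n" for i using that by (rule x)
    show "(1 / l) *\<^sub>R (y - centroid) + centroid \<in> Rn d"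
      using y by (intro homothety_mem_Rn centroid_mem) (simp add: floating_body_def)
    fix u
    show "\<exists>i<n. ip d u ((1 / l) *\<^sub>R (y - centroid) + centroid) \<le> ip d u (x i)"
    proof (cases "nontriv u")
      case True
      then obtain i where i: "i < n" "quantile N u \<le> l * dev u (x i)" using low by blast
      have "dev u y \<le> quantile N u" using y True unfolding F_iff by blast
      then have "(1 / l) * dev u y \<le> (1 / l) * (l * dev u (x i))" using i l by (intro mult_left_mono) auto
      then have "(1 / l) * dev u y \<le> dev u (x i)" using l by simp
      then have "dev u ((1 / l) *\<^sub>R (y - centroid) + centroid) \<le> dev u (x i)" unfolding dev_homothety .
      then show ?thesis using i by (auto simp: dev_def)
    next
      case False
      then show ?thesis using n by (auto simp: nontriv_def ip_def)
    qed
  qed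
  have P_in_F: "(1 / l) *\<^sub>R (y - centroid) + centroid \<in> ?F" if y: "y \<in> ?P" for y
    unfolding F_iff
  proof (intro conjI allI impI)
    show "(1 / l) *\<^sub>R (y - centroid) + centroid \<in> Rn d"
      using y P_Rn by (intro homothety_mem_Rn centroid_mem) auto
    fix u assume u: "nontriv u"
    have "ip d u y \<le> l * quantile N u + ip d u centroid"
      using y by (rule ip_convex_hull_le) (use up[OF u] in \<open>auto simp: dev_def algebra_simps\<close>)
    then have "dev u y \<le> l * quantile N u" by (simp add: dev_def)
    then have "(1 / l) * dev u y \<le> (1 / l) * (l * quantile N u)" using l by (intro mult_left_mono) auto
    then show "dev u ((1 / l) *\<^sub>R (y - centroid) + centroid) \<le> quantile N u"
      unfolding dev_homothety using l by simp
  qed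
  obtain r where r: "0 < r" "cube d centroid r \<subseteq> ?F" using cube_in_floating_body[OF d N e] by blast
  have hom_inv: "y = (1 / l) *\<^sub>R ((l *\<^sub>R (y - centroid) + centroid) - centroid) + centroid"
    "y = l *\<^sub>R (((1 / l) *\<^sub>R (y - centroid) + centroid) - centroid) + centroid" for y
    using l by (simp_all add: fun_eq_iff scaleR_fun_def)
  have "cube d centroid (r / l) \<subseteq> ?P \<inter> ?F"
  proof
    fix y assume y: "y \<in> cube d centroid (r / l)"
    have "l *\<^sub>R (y - centroid) + centroid \<in> cube d centroid r"
      unfolding cube_def mem_Collect_eq
    proof (intro conjI allI impI)
      show "l *\<^sub>R (y - centroid) + centroid \<in> Rn d"
        using y by (intro homothety_mem_Rn centroid_mem) (simp add: cube_def)
      fix i assume "i < d"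
      then have "l * \<bar>y i - centroid i\<bar> < r" using y l by (auto simp: cube_def field_simps)
      then show "\<bar>(l *\<^sub>R (y - centroid) + centroid) i - centroid i\<bar> < r"
        unfolding homothety_apply using l by (simp add: abs_mult)
    qed
    then have "y \<in> ?P" using F_in_P[of "l *\<^sub>R (y - centroid) + centroid"] r(2) hom_inv(1)[of y] by auto
    moreover have "r / l \<le> r" using r(1) l by (simp add: field_simps)
    then have "y \<in> cube d centroid r" using y unfolding cube_def by (auto intro: less_le_trans)
    ultimately show "y \<in> ?P \<inter> ?F" using r(2) by blast
  qed
  then have int: "centroid \<in> Rn_topology d interior_of (?P \<inter> ?F)"
    unfolding interior_cube_iff using centroid_mem r(1) l by (intro conjI exI[of _ "r / l"]) auto
  have "(\<lambda>y. (1 / l) *\<^sub>R (y - centroid) + centroid) ` ?F \<subseteq> ?P" using F_in_P by blast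
  moreover have "?P \<subseteq> (\<lambda>y. l *\<^sub>R (y - centroid) + centroid) ` ?F"
  proof
    fix y assume "y \<in> ?P"
    then show "y \<in> (\<lambda>y. l *\<^sub>R (y - centroid) + centroid) ` ?F"
      using hom_inv(2)[of y] P_in_F by (intro image_eqI[where x = "(1 / l) *\<^sub>R (y - centroid) + centroid"])
  qed
  ultimately show ?thesis
    unfolding log_Hausdorff_dist_def using l int by (intro Inf_lower) blast
qed

end

section \<open>Probability that all net directions behave\<close>

context log_concave_measure
begin

abbreviation sample :: "nat \<Rightarrow> (nat \<Rightarrow> nat \<Rightarrow> real) measure" where
  "sample n \<equiv> PiM {..<n} (\<lambda>_. \<mu>)"

lemma prob_space_sample: "prob_space (sample n)"
  by (rule prob_space_PiM) (rule prob_space_axioms)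

lemma product_prob_space_const: "product_prob_space (\<lambda>_::nat. \<mu>)"
  by (intro product_prob_spaceI prob_space_axioms)

lemma dev_component_measurable[measurable]: "i < n \<Longrightarrow> (\<lambda>x. dev t (x i)) \<in> borel_measurable (sample n)"
  by (rule measurable_compose[OF _ dev_measurable]) (rule measurable_component_singleton, simp)

lemma prob_exceeds_quantile:
  assumes t: "nontriv t" and n: "16 \<le> n" and \<eta>: "0 < \<eta>" "\<eta> \<le> 1"
  shows "measure (sample n) {x \<in> space (sample n). \<exists>i<n. (1 + 3 * \<eta>) * quantile (real n) t < dev t (x i)}
    \<le> (8 / real n) powr \<eta>"
proof -
  interpret P: product_prob_space "\<lambda>_::nat. \<mu>" "{..<n}" by (rule product_prob_space_const)
  define T where "T = (1 + 3 * \<eta>) * quantile (real n) t"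
  let ?B = "\<lambda>i. {x \<in> space (sample n). T < dev t (x i)}"
  have "{x \<in> space (sample n). \<exists>i<n. T < dev t (x i)} = (\<Union>i\<in>{..<n}. ?B i)" by auto
  also have "measure (sample n) \<dots> \<le> (\<Sum>i<n. measure (sample n) (?B i))"
    by (rule measure_UNION_le) auto
  also have "\<dots> \<le> (\<Sum>i<n. 1 / real n * (8 / real n) powr \<eta>)"
  proof (rule sum_mono)
    fix i assume i: "i \<in> {..<n}"
    have "?B i = {x \<in> space (sample n). x i \<in> {y \<in> Rn d. T < dev t y}}"
      using i by (auto simp: space_PiM PiE_iff)
    then have "emeasure (sample n) (?B i) = emeasure \<mu> {y \<in> Rn d. T < dev t y}"
      using P.emeasure_PiM_Collect_single[OF i, of "{y \<in> Rn d. T < dev t y}"] by simp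
    then have "measure (sample n) (?B i) = tail \<mu> (dev t) T"
      by (simp add: measure_def tail_def)
    also have "\<dots> \<le> 1 / real n * (8 / real n) powr \<eta>"
      unfolding T_def using n by (intro tail_beyond_quantile[OF t _ \<eta>]) simp
    finally show "measure (sample n) (?B i) \<le> 1 / real n * (8 / real n) powr \<eta>" .
  qed
  also have "\<dots> = (8 / real n) powr \<eta>" using n by simp
  finally show ?thesis by (simp add: T_def)
qed

text \<open>
  By independence the probability is \<open>(1 - p) ^ n \<le> exp (- n * p)\<close> with \<open>n * p \<ge> (n / 8)\<close> to the power \<open>\<eta>\<close>.
  Only the reciprocal of this power is kept, since the other inequality loses as much.
\<close>

lemma prob_falls_short_of_quantile:
  assumes t: "nontriv t" and n: "16 \<le> n" and \<eta>: "0 < \<eta>" "\<eta> < 1 / 2"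
  shows "measure (sample n) {x \<in> space (sample n). \<forall>i<n. dev t (x i) \<le> (1 - 2 * \<eta>) * quantile (real n) t}
    \<le> (8 / real n) powr \<eta>"
proof -
  interpret P: product_prob_space "\<lambda>_::nat. \<mu>" "{..<n}" by (rule product_prob_space_const)
  define T where "T = (1 - 2 * \<eta>) * quantile (real n) t"
  define p where "p = tail \<mu> (dev t) T"
  let ?C = "Rn d - {y \<in> Rn d. T < dev t y}"
  have C: "?C \<in> sets \<mu>" using sets.compl_sets[of "{y \<in> Rn d. T < dev t y}" \<mu>] by simp
  have "{x \<in> space (sample n). \<forall>i<n. dev t (x i) \<le> T} = PiE {..<n} (\<lambda>_. ?C)"
    by (rule set_eqI) (auto simp: space_PiM PiE_iff not_less)
  moreover have "emeasure (sample n) (PiE {..<n} (\<lambda>_. ?C)) = (\<Prod>i<n. emeasure \<mu> ?C)"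
    using C by (intro P.emeasure_PiM) auto
  moreover have "measure \<mu> ?C = 1 - p"
    using prob_compl[of "{y \<in> Rn d. T < dev t y}"] by (simp add: p_def tail_def)
  moreover have p1: "0 \<le> 1 - p" by (simp add: p_def tail_def)
  ultimately have "emeasure (sample n) {x \<in> space (sample n). \<forall>i<n. dev t (x i) \<le> T} = ennreal ((1 - p) ^ n)"
    by (simp add: emeasure_eq_measure ennreal_power)
  then have "measure (sample n) {x \<in> space (sample n). \<forall>i<n. dev t (x i) \<le> T} = (1 - p) ^ n"
    using p1 by (intro measure_eq_emeasure_eq_ennreal) auto
  also have "\<dots> \<le> exp (- p) ^ n"
  proof (rule power_mono)
    show "1 - p \<le> exp (- p)" using exp_ge_add_one_self[of "- p"] by simp
    show "0 \<le> 1 - p" by (rule p1)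
  qed
  also have "\<dots> = exp (- (real n * p))" by (simp flip: exp_of_nat_mult)
  also have "\<dots> \<le> exp (- ((real n / 8) powr \<eta>))"
  proof -
    have "1 / real n * (real n / 8) powr \<eta> \<le> p"
      unfolding p_def T_def using n by (intro tail_before_quantile[OF t _ \<eta>]) simp
    then have "real n * (1 / real n * (real n / 8) powr \<eta>) \<le> real n * p" by (intro mult_left_mono) auto
    then show ?thesis using n by simp
  qed
  also have "\<dots> \<le> 1 / (real n / 8) powr \<eta>"
  proof -
    define y where "y = (real n / 8) powr \<eta>"
    have y: "0 < y" using n by (simp add: y_def)
    have "y \<le> exp y" using exp_ge_add_one_self[of y] by linarith
    then have "1 / exp y \<le> 1 / y" using y by (intro divide_left_mono) auto
    then show ?thesis by (simp add: y_def exp_minus inverse_eq_divide)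
  qed
  also have "\<dots> = (8 / real n) powr \<eta>" using n by (simp add: powr_divide)
  finally show ?thesis by (simp add: T_def)
qed

lemma prob_log_Hausdorff_dist:
  assumes d: "1 \<le> d" and n: "16 \<le> n" and \<eta>: "0 < \<eta>" "\<eta> \<le> 1 / 12"
    and half: "(8 / real n) powr \<eta> \<le> 1 / 2"
    and m: "0 < m" "36000 * real d * ln (real n) / \<eta> \<le> real m"
    and E: "{x \<in> space (sample n). log_Hausdorff_dist d (convex hull (x ` {..<n})) (floating_body d \<mu> (1 / real n))
       \<le> ereal (1 + 12 * \<eta>)} \<in> sets (sample n)" (is "?E \<in> _")
  shows "1 - 2 * (2 * real m + 1) ^ d * (8 / real n) powr \<eta> \<le> measure (sample n) ?E"
proof -
  interpret S: prob_space "sample n" by (rule prob_space_sample)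
  obtain e where e: "isotropic e" "\<And>u. \<exists>c. \<forall>i<d. u i = (\<Sum>j<d. c j * e j i)"
    using isotropic_basis unfolding isotropic_def by metis
  let ?U = "\<lambda>t. {x \<in> space (sample n). \<exists>i<n. (1 + 3 * \<eta>) * quantile (real n) t < dev t (x i)}"
  let ?L = "\<lambda>t. {x \<in> space (sample n). \<forall>i<n. dev t (x i) \<le> (1 - 2 * \<eta>) * quantile (real n) t}"
  define B where "B = (\<Union>t\<in>net e m. ?U t \<union> ?L t)"
  have UL: "?U t \<in> sets (sample n)" "?L t \<in> sets (sample n)" for t
    by measurable
  have B: "B \<in> sets (sample n)" unfolding B_def using UL finite_net[of e m] by (intro sets.finite_UN) auto
  have "measure (sample n) B \<le> (\<Sum>t\<in>net e m. measure (sample n) (?U t \<union> ?L t))"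
    unfolding B_def using UL finite_net[of e m] by (intro measure_UNION_le) auto
  also have "\<dots> \<le> (\<Sum>t\<in>net e m. 2 * (8 / real n) powr \<eta>)"
  proof (rule sum_mono)
    fix t assume "t \<in> net e m"
    then have t: "nontriv t" using e(1) m(1) by (intro nontriv_net)
    have "measure (sample n) (?U t \<union> ?L t) \<le> measure (sample n) (?U t) + measure (sample n) (?L t)"
      by (rule measure_Un_le[OF UL])
    also have "\<dots> \<le> (8 / real n) powr \<eta> + (8 / real n) powr \<eta>"
      using \<eta> by (intro add_mono prob_exceeds_quantile[OF t n] prob_falls_short_of_quantile[OF t n]) auto
    finally show "measure (sample n) (?U t \<union> ?L t) \<le> 2 * (8 / real n) powr \<eta>" by simp
  qed
  also have "\<dots> = real (card (net e m)) * (2 * (8 / real n) powr \<eta>)" by simp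
  also have "\<dots> \<le> (2 * real m + 1) ^ d * (2 * (8 / real n) powr \<eta>)"
  proof (rule mult_right_mono)
    have "real (card (net e m)) \<le> real ((2 * m + 1) ^ d)" using card_net_le by (simp only: of_nat_le_iff)
    then show "real (card (net e m)) \<le> (2 * real m + 1) ^ d" by (simp add: add.commute)
  qed simp
  finally have bad: "measure (sample n) B \<le> 2 * (2 * real m + 1) ^ d * (8 / real n) powr \<eta>" by simp
  have "space (sample n) - B \<subseteq> ?E"
  proof
    fix x assume x: "x \<in> space (sample n) - B"
    then have xs: "x i \<in> Rn d" if "i < n" for i using that by (auto simp: space_PiM PiE_iff)
    have low: "\<exists>i<n. (1 - 2 * \<eta>) * quantile (real n) t < dev t (x i)" if "t \<in> net e m" for t
      using x that unfolding B_def by (auto simp: not_le)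
    have up: "dev t (x i) \<le> (1 + 3 * \<eta>) * quantile (real n) t" if "t \<in> net e m" "i < n" for t i
    proof -
      have "x \<notin> ?U t" using x that(1) unfolding B_def by blast
      then have "\<not> (\<exists>i<n. (1 + 3 * \<eta>) * quantile (real n) t < dev t (x i))" using x by simp
      then show ?thesis using that(2) by (meson not_le)
    qed
    have N: "16 \<le> real n" using n by simp
    have "log_Hausdorff_dist d (convex hull (x ` {..<n})) (floating_body d \<mu> (1 / real n)) \<le> ereal (1 + 12 * \<eta>)"
    proof (rule log_Hausdorff_dist_le_if_directions[OF d _ N e])
      show "0 < n" using n by simp
      show "x i \<in> Rn d" if "i < n" for i using that by (rule xs)
      show "1 \<le> 1 + 12 * \<eta>" using \<eta> by simp
      fix u assume u: "nontriv u"
      show "\<exists>i<n. quantile (real n) u \<le> (1 + 12 * \<eta>) * dev u (x i)"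
        using e N \<eta> half d m low up u by (rule net_controls_directions(1))
      show "dev u (x i) \<le> (1 + 12 * \<eta>) * quantile (real n) u" if "i < n" for i
        using e N \<eta> half d m low up u that by (rule net_controls_directions(2))
    qed
    then show "x \<in> ?E" using x by simp
  qed
  then have "measure (sample n) (space (sample n) - B) \<le> measure (sample n) ?E"
    by (rule S.finite_measure_mono[OF _ E])
  moreover have "measure (sample n) (space (sample n) - B) = 1 - measure (sample n) B"
    by (rule S.prob_compl[OF B])
  ultimately show ?thesis using bad by linarith
qed

end

section \<open>Measurability of the event\<close>

definition rational_points :: "nat \<Rightarrow> (nat \<Rightarrow> real) set" where
  "rational_points d = ({..<d} \<rightarrow>\<^sub>E \<rat>)"

lemma countable_rational_points: "countable (rational_points d)"
  unfolding rational_points_def by (intro countable_PiE countable_rat) auto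

lemma rational_points_subset: "rational_points d \<subseteq> Rn d"
  unfolding rational_points_def Rn_def by (intro PiE_mono) auto

lemma rational_points_dense:
  assumes "0 < r"
  obtains q where "q \<in> rational_points d" "\<And>i. i < d \<Longrightarrow> \<bar>q i - z i\<bar> < r"
proof -
  have "\<exists>q\<in>\<rat>. \<bar>q - z i\<bar> < r" for i
  proof -
    obtain q where "q \<in> \<rat>" "z i - r < q" "q < z i + r"
      using Rats_dense_in_real[of "z i - r" "z i + r"] assms by auto
    then show ?thesis by (intro bexI[of _ q]) (auto simp: abs_diff_less_iff)
  qed
  then obtain q where q: "\<And>i. q i \<in> \<rat>" "\<And>i. \<bar>q i - z i\<bar> < r" by metis
  have "restrict q {..<d} \<in> rational_points d" unfolding rational_points_def using q by auto
  then show ?thesis using that[of "restrict q {..<d}"] q by simp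
qed

lemma cube_sets: "cube d z r \<in> sets (Rn_lborel d)"
  unfolding cube_eq_PiE Rn_lborel_def by (intro sets_PiM_I_finite) auto

text \<open>
  Open sets are countable unions of rational cubes.
\<close>

lemma measurable_if_cube_neighbourhoods:
  assumes T: "T \<subseteq> Rn d" and nb: "\<And>y. y \<in> T \<Longrightarrow> \<exists>r>0. cube d y r \<subseteq> T"
  shows "T \<in> sets (Rn_lborel d)"
proof -
  define C where "C = {(q, k). q \<in> rational_points d \<and> cube d q (1 / real (Suc k)) \<subseteq> T}"
  have "C \<subseteq> rational_points d \<times> UNIV" by (auto simp: C_def)
  then have "countable C"
    by (rule countable_subset) (intro countable_SIGMA countable_rational_points, simp)
  then have U: "(\<Union>(q, k)\<in>C. cube d q (1 / real (Suc k))) \<in> sets (Rn_lborel d)"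
    by (intro sets.countable_UN') (auto intro: cube_sets)
  have "T \<subseteq> (\<Union>(q, k)\<in>C. cube d q (1 / real (Suc k)))"
  proof
    fix y assume y: "y \<in> T"
    then obtain r where r: "0 < r" "cube d y r \<subseteq> T" using nb by blast
    obtain k where k: "1 / real (Suc k) < r / 2" using nat_approx_posE[of "r / 2"] r by (auto simp: of_nat_Suc)
    obtain q where q: "q \<in> rational_points d" "\<And>i. i < d \<Longrightarrow> \<bar>q i - y i\<bar> < 1 / real (Suc k)"
      using rational_points_dense[of "1 / real (Suc k)" d y] by auto
    have "\<bar>q i - y i\<bar> + 1 / real (Suc k) \<le> r" if "i < d" for i using q(2)[OF that] k by linarith
    then have "cube d q (1 / real (Suc k)) \<subseteq> cube d y r" by (rule cube_subset_cube)
    moreover have "y \<in> cube d q (1 / real (Suc k))"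
      using q y T by (auto simp: cube_def abs_minus_commute)
    ultimately show "y \<in> (\<Union>(q, k)\<in>C. cube d q (1 / real (Suc k)))"
      using q(1) r(2) unfolding C_def by blast
  qed
  then have "T = (\<Union>(q, k)\<in>C. cube d q (1 / real (Suc k)))" by (auto simp: C_def)
  with U show ?thesis by simp
qed

text \<open>
  Strict separation of a point from finitely many points survives a small change of direction. Hence
  membership in a polytope can be tested with countably many directions.
\<close>

lemma rational_separation:
  fixes x :: "nat \<Rightarrow> nat \<Rightarrow> real"
  assumes "\<And>i. i < n \<Longrightarrow> ip d u (x i) < ip d u b"
  obtains q where "q \<in> rational_points d" "\<And>i. i < n \<Longrightarrow> ip d q (x i) < ip d q b"
proof -
  define \<epsilon> where "\<epsilon> = Min (insert 1 ((\<lambda>i. ip d u b - ip d u (x i)) ` {..<n}))"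
  have \<epsilon>: "0 < \<epsilon>" unfolding \<epsilon>_def using assms by (subst Min_gr_iff) auto
  have \<epsilon>_le: "\<epsilon> \<le> ip d u b - ip d u (x i)" if "i < n" for i
    unfolding \<epsilon>_def using that by (intro Min_le) auto
  define K where "K = (\<Sum>i<n. \<Sum>j<d. \<bar>b j - x i j\<bar>)"
  have K0: "0 \<le> K" unfolding K_def by (intro sum_nonneg) auto
  have K: "(\<Sum>j<d. \<bar>b j - x i j\<bar>) \<le> K" if "i < n" for i
    unfolding K_def using that by (intro member_le_sum[of i "{..<n}" "\<lambda>i. \<Sum>j<d. \<bar>b j - x i j\<bar>"]) (auto intro: sum_nonneg)
  define r where "r = \<epsilon> / (K + 1)"
  have r: "0 < r" "r * K < \<epsilon>" using \<epsilon> K0 by (auto simp: r_def field_simps)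
  obtain q where q: "q \<in> rational_points d" "\<And>i. i < d \<Longrightarrow> \<bar>q i - u i\<bar> < r"
    using rational_points_dense[OF r(1), of d u] by blast
  have "ip d q (x i) < ip d q b" if i: "i < n" for i
  proof -
    have "\<bar>\<Sum>j<d. (q j - u j) * (b j - x i j)\<bar> \<le> (\<Sum>j<d. \<bar>(q j - u j) * (b j - x i j)\<bar>)" by (rule sum_abs)
    also have "\<dots> \<le> (\<Sum>j<d. r * \<bar>b j - x i j\<bar>)"
      unfolding abs_mult using q(2) by (intro sum_mono mult_right_mono) (auto intro: less_imp_le)
    also have "\<dots> \<le> r * K" unfolding sum_distrib_left[symmetric] using K[OF i] r(1) by (intro mult_left_mono) auto
    finally have "\<bar>\<Sum>j<d. (q j - u j) * (b j - x i j)\<bar> < \<epsilon>" using r(2) by linarith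
    moreover have "(\<Sum>j<d. (q j - u j) * (b j - x i j)) = (ip d q b - ip d q (x i)) - (ip d u b - ip d u (x i))"
      unfolding ip_def sum_subtractf[symmetric] by (intro sum.cong) (auto simp: algebra_simps)
    ultimately show ?thesis using \<epsilon>_le[OF i] by linarith
  qed
  then show ?thesis using that q(1) by blast
qed

text \<open>
  For a fixed direction, the largest value on the polytope is a maximum of finitely many random
  variables, and the values that bound all of \<open>B\<close> form a closed set.
\<close>

lemma measurable_subset_convex_hull:
  fixes n :: nat
  assumes M: "sets M = sets (Rn_lborel d)" and n: "0 < n" and B: "B \<subseteq> Rn d"
  shows "{x \<in> space (PiM {..<n} (\<lambda>_. M)). B \<subseteq> convex hull (x ` {..<n})} \<in> sets (PiM {..<n} (\<lambda>_. M))"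
proof -
  let ?S = "PiM {..<n} (\<lambda>_. M)"
  have spM: "space M = Rn d" using sets_eq_imp_space_eq[OF M] by (simp add: space_Rn_lborel)
  have comp[measurable]: "(\<lambda>x. ip d u (x i)) \<in> borel_measurable ?S" if "i < n" for u i
  proof (rule measurable_compose[OF measurable_component_singleton])
    show "ip d u \<in> borel_measurable M" using borel_measurable_ip by (simp add: measurable_cong_sets[OF M refl])
  qed (use that in simp)
  define E where "E u = {x \<in> space ?S. \<forall>b\<in>B. ip d u b \<le> Max ((\<lambda>i. ip d u (x i)) ` {..<n})}" for u
  have E: "E u \<in> sets ?S" for u
  proof -
    have "closed {m::real. \<forall>b\<in>B. ip d u b \<le> m}"
    proof -
      have "{m::real. \<forall>b\<in>B. ip d u b \<le> m} = (\<Inter>b\<in>B. {ip d u b..})" by auto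
      then show ?thesis by auto
    qed
    then have [measurable]: "{m::real. \<forall>b\<in>B. ip d u b \<le> m} \<in> sets borel" by (rule borel_closed)
    have "(\<lambda>x. Max ((\<lambda>i. ip d u (x i)) ` {..<n})) \<in> borel_measurable ?S"
      by (rule borel_measurable_Max[where I = "{..<n}" and f = "\<lambda>i x. ip d u (x i)"]) (auto intro: comp)
    then have "(\<lambda>x. Max ((\<lambda>i. ip d u (x i)) ` {..<n})) -` {m. \<forall>b\<in>B. ip d u b \<le> m} \<inter> space ?S \<in> sets ?S"
      by (rule measurable_sets) measurable
    also have "(\<lambda>x. Max ((\<lambda>i. ip d u (x i)) ` {..<n})) -` {m. \<forall>b\<in>B. ip d u b \<le> m} \<inter> space ?S = E u"
      unfolding E_def by auto
    finally show ?thesis .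
  qed
  have Max_iff: "c \<le> Max ((\<lambda>i. ip d u (x i)) ` {..<n}) \<longleftrightarrow> (\<exists>i<n. c \<le> ip d u (x i))"
    for c u and x :: "nat \<Rightarrow> nat \<Rightarrow> real"
    using n by (subst Max_ge_iff) (auto simp: lessThan_empty_iff)
  have "{x \<in> space ?S. B \<subseteq> convex hull (x ` {..<n})} = space ?S \<inter> (\<Inter>u\<in>rational_points d. E u)"
  proof (intro set_eqI iffI)
    fix x assume x: "x \<in> {x \<in> space ?S. B \<subseteq> convex hull (x ` {..<n})}"
    have "\<exists>i<n. ip d u b \<le> ip d u (x i)" if "b \<in> B" for b u
    proof -
      have b: "b \<in> convex hull (x ` {..<n})" using x that by blast
      have "ip d u b \<le> Max ((\<lambda>i. ip d u (x i)) ` {..<n})"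
        by (rule ip_convex_hull_le[OF b]) auto
      then show ?thesis unfolding Max_iff .
    qed
    then show "x \<in> space ?S \<inter> (\<Inter>u\<in>rational_points d. E u)" using x unfolding E_def Max_iff by blast
  next
    fix x assume x: "x \<in> space ?S \<inter> (\<Inter>u\<in>rational_points d. E u)"
    have "b \<in> convex hull (x ` {..<n})" if b: "b \<in> B" for b
    proof (rule mem_convex_hull_if_no_separation[OF n])
      show "x i \<in> Rn d" if "i < n" for i using x that by (auto simp: space_PiM PiE_iff spM)
      show "b \<in> Rn d" using b B by blast
      fix u
      show "\<exists>i<n. ip d u b \<le> ip d u (x i)"
      proof (rule ccontr)
        assume "\<not> (\<exists>i<n. ip d u b \<le> ip d u (x i))"
        then have "\<And>i. i < n \<Longrightarrow> ip d u (x i) < ip d u b" by (meson not_le)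
        then show False
        proof (rule rational_separation)
          fix q assume q: "q \<in> rational_points d" "\<And>i. i < n \<Longrightarrow> ip d q (x i) < ip d q b"
          have "x \<in> E q" using x q(1) by blast
          then have "\<exists>i<n. ip d q b \<le> ip d q (x i)" using b unfolding E_def Max_iff by blast
          then show False using q(2) by (meson not_le)
        qed
      qed
    qed
    then show "x \<in> {x \<in> space ?S. B \<subseteq> convex hull (x ` {..<n})}" using x by blast
  qed
  moreover have "(\<Inter>u\<in>rational_points d. E u) \<in> sets ?S"
  proof (rule sets.countable_INT')
    show "countable (rational_points d)" by (rule countable_rational_points)
    show "rational_points d \<noteq> {}" using rational_points_dense[of 1 d] by auto
  qed (use E in \<open>auto\<close>)
  ultimately show ?thesis by simp
qed

text \<open>
  A stronger contraction about another centre is the given contraction followed by a contraction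
  towards the point \<open>w\<close>, which tends to \<open>z\<close> as \<open>z'\<close> does.
\<close>

lemma homothety_convex_combination:
  fixes y z z' :: "nat \<Rightarrow> real"
  assumes "0 < l" "l < l'"
  defines "w \<equiv> z + ((1 - 1 / l') / (1 - l / l')) *\<^sub>R (z' - z)"
  shows "(1 / l') *\<^sub>R (y - z') + z' = (l / l') *\<^sub>R ((1 / l) *\<^sub>R (y - z) + z) + (1 - l / l') *\<^sub>R w"
proof (rule ext)
  fix i
  have nz: "1 - l / l' \<noteq> 0" using assms by simp
  have "(1 - l / l') * w i = (1 - l / l') * z i + (1 - 1 / l') * (z' i - z i)"
  proof -
    have "(1 - l / l') * w i = (1 - l / l') * z i + ((1 - l / l') * ((1 - 1 / l') / (1 - l / l'))) * (z' i - z i)"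
      unfolding w_def by (simp only: plus_fun_apply minus_apply scaleR_fun_def real_scaleR_def ring_distribs mult.assoc)
    also have "(1 - l / l') * ((1 - 1 / l') / (1 - l / l')) = 1 - 1 / l'"
      using nz by (subst times_divide_eq_right) (rule nonzero_mult_div_cancel_left)
    finally show ?thesis .
  qed
  moreover have "(l / l') * ((1 / l) * (y i - z i) + z i) = (1 / l') * (y i - z i) + (l / l') * z i"
    using assms(1) by (simp add: distrib_left)
  moreover have "p * (y i - z' i) + z' i = p * (y i - z i) + q * z i + ((1 - q) * z i + (1 - p) * (z' i - z i))" for p q :: real
    by (simp add: algebra_simps)
  ultimately show "((1 / l') *\<^sub>R (y - z') + z') i = ((l / l') *\<^sub>R ((1 / l) *\<^sub>R (y - z) + z) + (1 - l / l') *\<^sub>R w) i"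
    by (simp only: plus_fun_apply minus_apply scaleR_fun_def real_scaleR_def)
qed

text \<open>
  A factor and a centre that witness a bound on the logarithmic Hausdorff distance, with an explicit
  cube as witness for interiority. Both inclusions are written as contractions, for symmetry.
\<close>

definition admissible :: "nat \<Rightarrow> real \<Rightarrow> (nat \<Rightarrow> real) \<Rightarrow> nat \<Rightarrow> (nat \<Rightarrow> real) set \<Rightarrow> (nat \<Rightarrow> real) set \<Rightarrow> bool" where
  "admissible d l z k K L \<longleftrightarrow> cube d z (1 / real (Suc k)) \<subseteq> K \<and> cube d z (1 / real (Suc k)) \<subseteq> L \<and>
     (\<lambda>y. (1 / l) *\<^sub>R (y - z) + z) ` L \<subseteq> K \<and> (\<lambda>y. (1 / l) *\<^sub>R (y - z) + z) ` K \<subseteq> L"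

lemma image_subset_homothety_iff:
  fixes K L :: "(nat \<Rightarrow> real) set"
  assumes "0 < l"
  shows "K \<subseteq> (\<lambda>y. l *\<^sub>R (y - z) + z) ` L \<longleftrightarrow> (\<lambda>y. (1 / l) *\<^sub>R (y - z) + z) ` K \<subseteq> L"
proof -
  have 1: "(1 / l) *\<^sub>R ((l *\<^sub>R (y - z) + z) - z) + z = y" and 2: "l *\<^sub>R (((1 / l) *\<^sub>R (y - z) + z) - z) + z = y" for y
    using assms by (simp_all add: fun_eq_iff scaleR_fun_def)
  show ?thesis
  proof
    assume "K \<subseteq> (\<lambda>y. l *\<^sub>R (y - z) + z) ` L"
    then show "(\<lambda>y. (1 / l) *\<^sub>R (y - z) + z) ` K \<subseteq> L" using 1 by fastforce
  next
    assume "(\<lambda>y. (1 / l) *\<^sub>R (y - z) + z) ` K \<subseteq> L"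
    then show "K \<subseteq> (\<lambda>y. l *\<^sub>R (y - z) + z) ` L" using 2
      by (metis (no_types, lifting) image_eqI image_subset_iff subsetI)
  qed
qed

text \<open>
  A slightly larger rational factor leaves room to move the centre to a nearby rational point, because
  the original centre is interior.
\<close>

lemma rational_admissible:
  assumes K: "convex K" "K \<subseteq> Rn d" and L: "convex L" "L \<subseteq> Rn d"
    and l: "1 \<le> l" "l < s" and z: "z \<in> Rn_topology d interior_of (K \<inter> L)"
    and sub: "(\<lambda>y. (1 / l) *\<^sub>R (y - z) + z) ` L \<subseteq> K" "(\<lambda>y. (1 / l) *\<^sub>R (y - z) + z) ` K \<subseteq> L"
  obtains l' z' k where "l' \<in> \<rat>" "1 \<le> l'" "l' < s" "z' \<in> rational_points d" "admissible d l' z' k K L"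
proof -
  obtain l' where l': "l' \<in> \<rat>" "l < l'" "l' < s" using Rats_dense_in_real[OF l(2)] by blast
  obtain r where zR: "z \<in> Rn d" and r: "0 < r" "cube d z r \<subseteq> K \<inter> L" using z unfolding interior_cube_iff by blast
  define C where "C = (1 - 1 / l') / (1 - l / l')"
  have C: "0 \<le> C" unfolding C_def using l l' by (intro divide_nonneg_nonneg) auto
  define \<delta> where "\<delta> = min (r / 2) (r / (C + 1))"
  have \<delta>: "0 < \<delta>" using r C by (simp add: \<delta>_def)
  obtain z' where z': "z' \<in> rational_points d" "\<And>i. i < d \<Longrightarrow> \<bar>z' i - z i\<bar> < \<delta>"
    using rational_points_dense[OF \<delta>, of d z] by blast
  have z'R: "z' \<in> Rn d" using z'(1) rational_points_subset by blast
  define w where "w = z + C *\<^sub>R (z' - z)"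
  have "w \<in> cube d z r"
    unfolding cube_def mem_Collect_eq
  proof (intro conjI allI impI)
    have "w = (1 - C) *\<^sub>R z + C *\<^sub>R z'" by (simp add: w_def fun_eq_iff scaleR_fun_def algebra_simps)
    then show "w \<in> Rn d" using affine_Rn[of d] zR z'R unfolding affine_def by simp
    fix i assume i: "i < d"
    have "\<bar>w i - z i\<bar> = C * \<bar>z' i - z i\<bar>" using C by (simp add: w_def scaleR_fun_def abs_mult)
    also have "\<dots> \<le> C * (r / (C + 1))" using z'(2)[OF i] C by (intro mult_left_mono) (auto simp: \<delta>_def)
    also have "\<dots> < r" using C r by (simp add: field_simps)
    finally show "\<bar>w i - z i\<bar> < r" .
  qed
  then have w: "w \<in> K" "w \<in> L" using r(2) by auto
  have shrink: "(\<lambda>y. (1 / l') *\<^sub>R (y - z') + z') ` B \<subseteq> A"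
    if A: "convex A" "w \<in> A" and B: "(\<lambda>y. (1 / l) *\<^sub>R (y - z) + z) ` B \<subseteq> A" for A B
  proof (rule image_subsetI)
    fix y assume "y \<in> B"
    then have m: "(1 / l) *\<^sub>R (y - z) + z \<in> A" using B by blast
    have "(1 / l') *\<^sub>R (y - z') + z' = (l / l') *\<^sub>R ((1 / l) *\<^sub>R (y - z) + z) + (1 - l / l') *\<^sub>R w"
      unfolding w_def C_def using l l' by (intro homothety_convex_combination) auto
    also have "\<dots> \<in> A" using l l' by (intro convexD[OF A(1) m A(2)]) auto
    finally show "(1 / l') *\<^sub>R (y - z') + z' \<in> A" .
  qed
  obtain k where k: "1 / real (Suc k) < r / 2" using nat_approx_posE[of "r / 2"] r by (auto simp: of_nat_Suc)
  have "\<bar>z' i - z i\<bar> + 1 / real (Suc k) \<le> r" if "i < d" for i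
    using z'(2)[OF that] k by (simp add: \<delta>_def)
  then have "cube d z' (1 / real (Suc k)) \<subseteq> cube d z r" by (rule cube_subset_cube)
  then have "admissible d l' z' k K L"
    unfolding admissible_def using r(2) shrink[OF K(1) w(1) sub(1)] shrink[OF L(1) w(2) sub(2)] by blast
  then show ?thesis using that[of l' z' k] l l' z' by simp
qed

lemma log_Hausdorff_dist_less_iff:
  assumes K: "convex K" "K \<subseteq> Rn d" and L: "convex L" "L \<subseteq> Rn d"
  shows "log_Hausdorff_dist d K L < ereal s \<longleftrightarrow>
    (\<exists>l\<in>{l \<in> \<rat>. 1 \<le> l \<and> l < s}. \<exists>z\<in>rational_points d. \<exists>k. admissible d l z k K L)"
proof -
  have "log_Hausdorff_dist d K L < ereal s \<longleftrightarrow>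
    (\<exists>l. 1 \<le> l \<and> l < s \<and> (\<exists>z\<in>Rn_topology d interior_of (K \<inter> L).
       (\<lambda>y. (1 / l) *\<^sub>R (y - z) + z) ` L \<subseteq> K \<and> K \<subseteq> (\<lambda>y. l *\<^sub>R (y - z) + z) ` L))"
    unfolding log_Hausdorff_dist_def Inf_less_iff by auto
  also have "\<dots> \<longleftrightarrow> (\<exists>l\<in>{l \<in> \<rat>. 1 \<le> l \<and> l < s}. \<exists>z\<in>rational_points d. \<exists>k. admissible d l z k K L)"
  proof
    assume "\<exists>l. 1 \<le> l \<and> l < s \<and> (\<exists>z\<in>Rn_topology d interior_of (K \<inter> L).
       (\<lambda>y. (1 / l) *\<^sub>R (y - z) + z) ` L \<subseteq> K \<and> K \<subseteq> (\<lambda>y. l *\<^sub>R (y - z) + z) ` L)"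
    then obtain l z where *: "1 \<le> l" "l < s" "z \<in> Rn_topology d interior_of (K \<inter> L)"
      "(\<lambda>y. (1 / l) *\<^sub>R (y - z) + z) ` L \<subseteq> K" "K \<subseteq> (\<lambda>y. l *\<^sub>R (y - z) + z) ` L" by blast
    then have "(\<lambda>y. (1 / l) *\<^sub>R (y - z) + z) ` K \<subseteq> L" using image_subset_homothety_iff[of l K z L] by simp
    from rational_admissible[OF K L *(1-4) this]
    show "\<exists>l\<in>{l \<in> \<rat>. 1 \<le> l \<and> l < s}. \<exists>z\<in>rational_points d. \<exists>k. admissible d l z k K L" by blast
  next
    assume "\<exists>l\<in>{l \<in> \<rat>. 1 \<le> l \<and> l < s}. \<exists>z\<in>rational_points d. \<exists>k. admissible d l z k K L"
    then obtain l z k where *: "1 \<le> l" "l < s" "z \<in> rational_points d" "admissible d l z k K L" by blast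
    have "z \<in> Rn d" using *(3) rational_points_subset by blast
    then have "z \<in> Rn_topology d interior_of (K \<inter> L)"
      unfolding interior_cube_iff using *(4) unfolding admissible_def
      by (intro conjI exI[of _ "1 / real (Suc k)"]) auto
    moreover have "K \<subseteq> (\<lambda>y. l *\<^sub>R (y - z) + z) ` L"
      using image_subset_homothety_iff[of l K z L] *(1,4) by (simp add: admissible_def)
    ultimately show "\<exists>l. 1 \<le> l \<and> l < s \<and> (\<exists>z\<in>Rn_topology d interior_of (K \<inter> L).
       (\<lambda>y. (1 / l) *\<^sub>R (y - z) + z) ` L \<subseteq> K \<and> K \<subseteq> (\<lambda>y. l *\<^sub>R (y - z) + z) ` L)"
      using * unfolding admissible_def by blast
  qed
  finally show ?thesis .
qed

lemma measurable_homothety: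
  assumes "z \<in> Rn d"
  shows "(\<lambda>y. a *\<^sub>R (y - z) + z) \<in> measurable (Rn_lborel d) (Rn_lborel d)"
  unfolding Rn_lborel_def
proof (rule measurable_PiM_single')
  show "(\<lambda>y. (a *\<^sub>R (y - z) + z) i) \<in> measurable (PiM {..<d} (\<lambda>_. lborel)) lborel" if "i \<in> {..<d}" for i
    unfolding homothety_apply using that by measurable
  show "(\<lambda>y i. (a *\<^sub>R (y - z) + z) i) \<in> space (PiM {..<d} (\<lambda>_. lborel)) \<rightarrow> {..<d} \<rightarrow>\<^sub>E space lborel"
  proof (rule funcsetI)
    fix y assume "y \<in> space (PiM {..<d} (\<lambda>_. lborel :: real measure))"
    then have "y \<in> Rn d" by (simp add: space_PiM Rn_def)
    from homothety_mem_Rn[OF this assms, of a]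
    show "(\<lambda>i. (a *\<^sub>R (y - z) + z) i) \<in> {..<d} \<rightarrow>\<^sub>E space lborel"
      unfolding Rn_def space_lborel space_borel .
  qed
qed

text \<open>
  For a fixed factor, centre and cube the conditions are measurable. Rational factors and centres suffice
  when the distance is required to be strictly less than a bound, and the weak inequality is a
  countable intersection of strict ones.
\<close>

lemma measurable_log_Hausdorff_dist_le:
  fixes n :: nat
  assumes M: "sets M = sets (Rn_lborel d)" and n: "0 < n"
    and L: "convex L" "L \<in> sets (Rn_lborel d)"
  shows "{x \<in> space (PiM {..<n} (\<lambda>_. M)). log_Hausdorff_dist d (convex hull (x ` {..<n})) L \<le> ereal r}
    \<in> sets (PiM {..<n} (\<lambda>_. M))"
proof -
  let ?S = "PiM {..<n} (\<lambda>_. M)"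
  let ?P = "\<lambda>x. convex hull (x ` {..<n})"
  let ?h = "\<lambda>l z y. (1 / l) *\<^sub>R (y - z) + z :: nat \<Rightarrow> real"
  have spM: "space M = Rn d" using sets_eq_imp_space_eq[OF M] by (simp add: space_Rn_lborel)
  have LR: "L \<subseteq> Rn d" using sets.sets_into_space[OF L(2)] by (simp add: space_Rn_lborel)
  have xR: "x ` {..<n} \<subseteq> Rn d" if "x \<in> space ?S" for x using that by (auto simp: space_PiM PiE_iff spM)
  have adm: "{x \<in> space ?S. admissible d l z k (?P x) L} \<in> sets ?S"
    if z: "z \<in> rational_points d" for l z k
  proof -
    have zR: "z \<in> Rn d" using z rational_points_subset by blast
    have "(?h l z ` (?P x) \<subseteq> L) \<longleftrightarrow> (\<forall>i<n. ?h l z (x i) \<in> L)" for x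
    proof
      assume "?h l z ` (?P x) \<subseteq> L"
      then show "\<forall>i<n. ?h l z (x i) \<in> L" by (auto intro: hull_inc)
    next
      assume *: "\<forall>i<n. ?h l z (x i) \<in> L"
      have "convex {y. ?h l z y \<in> L}"
      proof (rule convexI)
        fix y1 y2 and u v :: real
        assume "y1 \<in> {y. ?h l z y \<in> L}" "y2 \<in> {y. ?h l z y \<in> L}" and uv: "0 \<le> u" "0 \<le> v" "u + v = 1"
        then have "u *\<^sub>R ?h l z y1 + v *\<^sub>R ?h l z y2 \<in> L" by (intro convexD[OF L(1)]) auto
        moreover have "u *\<^sub>R ?h l z y1 + v *\<^sub>R ?h l z y2 = ?h l z (u *\<^sub>R y1 + v *\<^sub>R y2)"
        proof -
          have v: "v = 1 - u" using uv by simp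
          show ?thesis unfolding v by (simp add: fun_eq_iff scaleR_fun_def algebra_simps diff_divide_distrib add_divide_distrib)
        qed
        ultimately show "u *\<^sub>R y1 + v *\<^sub>R y2 \<in> {y. ?h l z y \<in> L}" by simp
      qed
      then have "?P x \<subseteq> {y. ?h l z y \<in> L}" using * by (intro hull_minimal) auto
      then show "?h l z ` (?P x) \<subseteq> L" by blast
    qed
    then have eq: "{x \<in> space ?S. admissible d l z k (?P x) L} =
      {x \<in> space ?S. cube d z (1 / real (Suc k)) \<subseteq> ?P x} \<inter>
      {x \<in> space ?S. ?h l z ` L \<subseteq> ?P x} \<inter>
      {x \<in> space ?S. \<forall>i<n. ?h l z (x i) \<in> L} \<inter>
      (if cube d z (1 / real (Suc k)) \<subseteq> L then space ?S else {})"
      unfolding admissible_def by auto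
    have m1: "{x \<in> space ?S. cube d z (1 / real (Suc k)) \<subseteq> ?P x} \<in> sets ?S"
      by (rule measurable_subset_convex_hull[OF M n]) (auto simp: cube_def)
    have m2: "{x \<in> space ?S. ?h l z ` L \<subseteq> ?P x} \<in> sets ?S"
      by (rule measurable_subset_convex_hull[OF M n]) (use LR homothety_mem_Rn[OF _ zR] in blast)
    have m3: "{x \<in> space ?S. \<forall>i<n. ?h l z (x i) \<in> L} \<in> sets ?S"
    proof -
      define D where "D = {y \<in> Rn d. ?h l z y \<in> L}"
      have "D = ?h l z -` L \<inter> space (Rn_lborel d)" unfolding D_def space_Rn_lborel by auto
      also have "\<dots> \<in> sets (Rn_lborel d)" by (rule measurable_sets[OF measurable_homothety[OF zR] L(2)])
      finally have "D \<in> sets M" using M by simp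
      then have "PiE {..<n} (\<lambda>_. D) \<in> sets ?S" by (intro sets_PiM_I_finite) auto
      moreover have "{x \<in> space ?S. \<forall>i<n. ?h l z (x i) \<in> L} = PiE {..<n} (\<lambda>_. D)"
        by (rule set_eqI) (auto simp: space_PiM PiE_iff spM D_def)
      ultimately show ?thesis by simp
    qed
    show ?thesis unfolding eq by (intro sets.Int m1 m2 m3) simp
  qed
  have less: "{x \<in> space ?S. log_Hausdorff_dist d (?P x) L < ereal s} \<in> sets ?S" for s
  proof -
    have "{x \<in> space ?S. log_Hausdorff_dist d (?P x) L < ereal s} =
      (\<Union>l\<in>{l \<in> \<rat>. 1 \<le> l \<and> l < s}. \<Union>z\<in>rational_points d. \<Union>k.
         {x \<in> space ?S. admissible d l z k (?P x) L})"
    proof -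
      have less_iff: "log_Hausdorff_dist d (?P x) L < ereal s \<longleftrightarrow>
        (\<exists>l\<in>{l \<in> \<rat>. 1 \<le> l \<and> l < s}. \<exists>z\<in>rational_points d. \<exists>k. admissible d l z k (?P x) L)"
        if "x \<in> space ?S" for x
        by (rule log_Hausdorff_dist_less_iff[OF convex_convex_hull convex_hull_subset_Rn[OF xR[OF that]] L(1) LR])
      show ?thesis
      proof (rule set_eqI)
        fix x
        show "x \<in> {x \<in> space ?S. log_Hausdorff_dist d (?P x) L < ereal s} \<longleftrightarrow>
          x \<in> (\<Union>l\<in>{l \<in> \<rat>. 1 \<le> l \<and> l < s}. \<Union>z\<in>rational_points d. \<Union>k.
         {x \<in> space ?S. admissible d l z k (?P x) L})"
        proof (cases "x \<in> space ?S")
          case True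
          then show ?thesis by (simp only: mem_Collect_eq UN_iff less_iff simp_thms bex_UNIV)
        next
          case False
          then show ?thesis by simp
        qed
      qed
    qed
    also have "\<dots> \<in> sets ?S"
    proof (rule sets.countable_UN'')
      show "countable {l \<in> \<rat>. 1 \<le> l \<and> l < s}" by (rule countable_subset[OF _ countable_rat]) auto
      fix l
      show "(\<Union>z\<in>rational_points d. \<Union>k. {x \<in> space ?S. admissible d l z k (?P x) L}) \<in> sets ?S"
      proof (rule sets.countable_UN''[OF countable_rational_points])
        fix z assume "z \<in> rational_points d"
        then have "range (\<lambda>k. {x \<in> space ?S. admissible d l z k (?P x) L}) \<subseteq> sets ?S"
          using adm by blast
        then show "(\<Union>k. {x \<in> space ?S. admissible d l z k (?P x) L}) \<in> sets ?S"
          by (rule sets.countable_UN)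
      qed
    qed
    finally show ?thesis .
  qed
  have "v \<le> ereal r \<longleftrightarrow> (\<forall>k. v < ereal (r + 1 / real (Suc k)))" for v :: ereal
  proof
    assume "v \<le> ereal r"
    then show "\<forall>k. v < ereal (r + 1 / real (Suc k))" by (auto intro: le_less_trans)
  next
    assume *: "\<forall>k. v < ereal (r + 1 / real (Suc k))"
    show "v \<le> ereal r"
    proof (rule ereal_le_epsilon2)
      fix e :: real assume "0 < e"
      then obtain k where "1 / real (Suc k) < e" using nat_approx_posE[of e] by (auto simp: of_nat_Suc)
      then have "ereal (r + 1 / real (Suc k)) \<le> ereal r + ereal e" by simp
      then show "v \<le> ereal r + ereal e" using * by (metis less_imp_le order.trans)
    qed
  qed
  then have "{x \<in> space ?S. log_Hausdorff_dist d (?P x) L \<le> ereal r} =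
     (\<Inter>k. {x \<in> space ?S. log_Hausdorff_dist d (?P x) L < ereal (r + 1 / real (Suc k))})"
    by auto
  also have "\<dots> \<in> sets ?S" using less by (intro sets.countable_INT) auto
  finally show ?thesis .
qed

context log_concave_measure
begin

lemma dev_affine: "u + v = 1 \<Longrightarrow> dev t (u *\<^sub>R x + v *\<^sub>R y) = u * dev t x + v * dev t y"
proof -
  assume "u + v = 1"
  then have "ip d t centroid = (u + v) * ip d t centroid" by simp
  then show ?thesis unfolding dev_def ip_affine by (simp add: algebra_simps)
qed

lemma convex_floating_body:
  assumes "1 \<le> d" "2 < N"
  shows "convex (floating_body d \<mu> (1 / N))"
proof (rule convexI)
  fix x y and u v :: real
  assume xy: "x \<in> floating_body d \<mu> (1 / N)" "y \<in> floating_body d \<mu> (1 / N)" and uv: "0 \<le> u" "0 \<le> v" "u + v = 1"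
  then show "u *\<^sub>R x + v *\<^sub>R y \<in> floating_body d \<mu> (1 / N)"
    using convexD[OF convex_Rn, of x d y u v]
    unfolding floating_body_iff[OF assms] by (auto simp: dev_affine intro!: convex_bound_le)
qed

text \<open>
  A point outside violates one strict half-space inequality, which persists in a neighbourhood.
\<close>

lemma floating_body_sets:
  assumes "1 \<le> d" "2 < N"
  shows "floating_body d \<mu> (1 / N) \<in> sets (Rn_lborel d)"
proof -
  let ?F = "floating_body d \<mu> (1 / N)"
  have "Rn d - ?F \<in> sets (Rn_lborel d)"
  proof (rule measurable_if_cube_neighbourhoods)
    fix y assume y: "y \<in> Rn d - ?F"
    then have "\<not> (\<forall>u. nontriv u \<longrightarrow> dev u y \<le> quantile N u)"
      using floating_body_iff[OF assms, of y] by blast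
    then obtain u where u: "nontriv u" "quantile N u < dev u y" by (meson not_le)
    define K where "K = (\<Sum>i<d. \<bar>u i\<bar>)"
    have K: "0 \<le> K" unfolding K_def by (intro sum_nonneg) auto
    define r where "r = (dev u y - quantile N u) / (K + 1)"
    have r: "0 < r" "r * K < dev u y - quantile N u" using u K by (auto simp: r_def field_simps)
    have "cube d y r \<subseteq> Rn d - ?F"
    proof
      fix w assume w: "w \<in> cube d y r"
      have "dev u y - dev u w = (\<Sum>i<d. u i * (y i - w i))"
        by (simp add: dev_def ip_def sum_subtractf algebra_simps)
      also have "\<dots> \<le> (\<Sum>i<d. \<bar>u i\<bar> * r)"
      proof (rule sum_mono)
        fix i assume "i \<in> {..<d}"
        then have "\<bar>y i - w i\<bar> \<le> r" using w by (auto simp: cube_def abs_minus_commute intro: less_imp_le)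
        then have "\<bar>u i\<bar> * \<bar>y i - w i\<bar> \<le> \<bar>u i\<bar> * r" by (intro mult_left_mono) auto
        then show "u i * (y i - w i) \<le> \<bar>u i\<bar> * r" unfolding abs_mult[symmetric] by linarith
      qed
      also have "\<dots> = r * K" by (simp add: K_def sum_distrib_left mult.commute)
      finally have "quantile N u < dev u w" using r(2) by linarith
      then show "w \<in> Rn d - ?F" using u(1) w floating_body_iff[OF assms, of w] by (auto simp: cube_def not_le[symmetric])
    qed
    then show "\<exists>r>0. cube d y r \<subseteq> Rn d - ?F" using r(1) by blast
  qed auto
  then have "space (Rn_lborel d) - (Rn d - ?F) \<in> sets (Rn_lborel d)" by auto
  moreover have "space (Rn_lborel d) - (Rn d - ?F) = ?F" by (auto simp: space_Rn_lborel floating_body_def)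
  ultimately show ?thesis by simp
qed

end

section \<open>Choice of the constants\<close>

text \<open>
  With \<open>L = ln n\<close>, the first condition will give \<open>\<eta> \<le> 1/12\<close> when \<open>d \<le> ln L / 5\<close> and \<open>q \<le> L\<close> to the power \<open>1/3\<close>,
  and the last one bounds the number of grid values per coordinate by \<open>L ^ 5\<close>.
\<close>

lemma large_parameter_exists:
  "\<exists>L0>0. \<forall>L\<ge>(L0::real). 144 * ((ln L) ^ 3 / 25 + (ln L)\<^sup>2 * L powr (1 / 3) / 5) \<le> L \<and>
     1 \<le> ln L \<and> ln 64 \<le> L \<and> 2 * (36000 * L ^ 3 + 1) + 1 \<le> L ^ 5"
proof -
  have "eventually (\<lambda>L::real. 144 * ((ln L) ^ 3 / 25 + (ln L)\<^sup>2 * L powr (1 / 3) / 5) \<le> L) at_top"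
    "eventually (\<lambda>L::real. 1 \<le> ln L) at_top" "eventually (\<lambda>L::real. ln 64 \<le> L) at_top"
    "eventually (\<lambda>L::real. 2 * (36000 * L ^ 3 + 1) + 1 \<le> L ^ 5) at_top"
    by real_asymp+
  then have "eventually (\<lambda>L::real. 144 * ((ln L) ^ 3 / 25 + (ln L)\<^sup>2 * L powr (1 / 3) / 5) \<le> L \<and>
     1 \<le> ln L \<and> ln 64 \<le> L \<and> 2 * (36000 * L ^ 3 + 1) + 1 \<le> L ^ 5) at_top"
    by eventually_elim simp
  then obtain L0 :: real where "\<forall>L\<ge>L0. 144 * ((ln L) ^ 3 / 25 + (ln L)\<^sup>2 * L powr (1 / 3) / 5) \<le> L \<and>
     1 \<le> ln L \<and> ln 64 \<le> L \<and> 2 * (36000 * L ^ 3 + 1) + 1 \<le> L ^ 5"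
    unfolding eventually_at_top_linorder by blast
  then show ?thesis by (intro exI[of _ "max 1 L0"]) simp
qed

text \<open>
  The constant \<open>exp L0\<close> in front makes \<open>n\<close> large. The double exponential and the exponential in the bound on \<open>n\<close>
  limit the dimension and \<open>q\<close> in terms of \<open>n\<close>.
\<close>

lemma le_ln_of_sample_size:
  fixes n :: nat
  assumes n: "real n \<ge> exp L0 * exp (exp (5 * real d)) + exp (q ^ 3)"
    and L0: "0 < L0"
  shows "L0 \<le> ln (real n)" "5 * real d \<le> ln (ln (real n))" "q ^ 3 \<le> ln (real n)"
proof -
  have ge: "y \<le> ln (real n)" if "exp y \<le> real n" for y
  proof -
    have "0 < real n" using that exp_gt_zero[of y] by linarith
    then show ?thesis using that by (simp add: ln_ge_iff)
  qed
  have e1: "exp L0 * 1 \<le> exp L0 * exp (exp (5 * real d))" by (intro mult_left_mono) auto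
  have e2: "1 * exp (exp (5 * real d)) \<le> exp L0 * exp (exp (5 * real d))" using L0 by (intro mult_right_mono) auto
  show 1: "L0 \<le> ln (real n)" using n e1 exp_gt_zero[of "q ^ 3"] by (intro ge) linarith
  have 2: "exp (5 * real d) \<le> ln (real n)" using n e2 exp_gt_zero[of "q ^ 3"] by (intro ge) linarith
  then show "5 * real d \<le> ln (ln (real n))" using 1 L0 by (simp add: ln_ge_iff)
  have "0 < exp L0 * exp (exp (5 * real d))" by simp
  then show "q ^ 3 \<le> ln (real n)" using n by (intro ge) linarith
qed

text \<open>
  As \<open>\<eta> \<ge> 1 / L\<close> and \<open>d \<le> L\<close>, the required fineness of the grid is at most \<open>36000 * L ^ 3\<close>.
\<close>

lemma parameters:
  fixes L q :: real and d :: nat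
  assumes L0: "144 * ((ln L) ^ 3 / 25 + (ln L)\<^sup>2 * L powr (1 / 3) / 5) \<le> L" "1 \<le> ln L"
      "2 * (36000 * L ^ 3 + 1) + 1 \<le> L ^ 5" "0 < L"
    and d: "1 \<le> d" "5 * real d \<le> ln L" and q: "1 \<le> q" "q ^ 3 \<le> L"
  defines "\<eta> \<equiv> 12 * real d * (real d + q) * (ln L / L)"
  shows "0 < \<eta>" "\<eta> \<le> 1 / 12" "\<exists>m. 0 < m \<and> 36000 * real d * L / \<eta> \<le> real m \<and> 2 * real m + 1 \<le> L ^ 5"
proof -
  have L1: "1 < L" using L0(2,4) by (metis ln_gt_zero_iff less_le_trans zero_less_one)
  have dq: "1 \<le> real d" "0 < q" using d q by auto
  show \<eta>0: "0 < \<eta>" unfolding \<eta>_def using dq L1 L0(2,4) by (intro mult_pos_pos divide_pos_pos) auto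
  have qL: "q \<le> L powr (1 / 3)"
  proof -
    have "q = (q ^ 3) powr (1 / 3)" using dq(2) by (simp add: powr_powr flip: powr_numeral)
    also have "\<dots> \<le> L powr (1 / 3)" using q dq by (intro powr_mono2) auto
    finally show ?thesis .
  qed
  have d5: "real d \<le> ln L / 5" using d by simp
  have "real d * (real d + q) * ln L \<le> (ln L / 5) * (ln L / 5 + L powr (1 / 3)) * ln L"
    using d5 qL dq L0(2) by (intro mult_right_mono mult_mono add_mono) auto
  also have "\<dots> = (ln L) ^ 3 / 25 + (ln L)\<^sup>2 * L powr (1 / 3) / 5"
    by (simp add: power2_eq_square power3_eq_cube algebra_simps)
  finally have "144 * (real d * (real d + q) * ln L) \<le> 144 * ((ln L) ^ 3 / 25 + (ln L)\<^sup>2 * L powr (1 / 3) / 5)"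
    by (rule mult_left_mono) simp
  also have "\<dots> \<le> L" by (rule L0(1))
  finally have "144 * (real d * (real d + q) * ln L) \<le> L" .
  then show "\<eta> \<le> 1 / 12" unfolding \<eta>_def using L0(4) by (simp add: field_simps)
  define m where "m = nat \<lceil>36000 * L ^ 3\<rceil>"
  have L3: "1 \<le> L ^ 3" using L1 by simp
  have m: "36000 * L ^ 3 \<le> real m" "real m \<le> 36000 * L ^ 3 + 1"
    using L3 unfolding m_def by linarith+
  have "1 / L \<le> \<eta>"
  proof -
    have "1 * 1 \<le> 12 * real d * (real d + q) * ln L"
      using dq L0(2) q by (intro mult_mono) (auto intro!: mult_ge1_I)
    then show ?thesis unfolding \<eta>_def using L0(4) by (simp add: field_simps)
  qed
  then have "36000 * real d * L / \<eta> \<le> 36000 * real d * L / (1 / L)"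
    using L0(4) \<eta>0 by (intro divide_left_mono) auto
  also have "\<dots> = 36000 * real d * (L * L)" by simp
  also have "\<dots> \<le> 36000 * L * (L * L)"
  proof -
    have "ln L \<le> L" using ln_le_minus_one[OF L0(4)] by simp
    then have "real d \<le> L" using d by linarith
    then show ?thesis using L0(4) by (intro mult_right_mono) auto
  qed
  also have "\<dots> = 36000 * L ^ 3" by (simp add: power3_eq_cube)
  also have "\<dots> \<le> real m" by (rule m)
  finally have "36000 * real d * L / \<eta> \<le> real m" .
  moreover have "2 * real m + 1 \<le> L ^ 5"
    by (rule order.trans[OF _ L0(3)]) (use m(2) in simp)
  moreover have "0 < m" by (rule gr0I) (use m(1) L1 in simp)
  ultimately show "\<exists>m. 0 < m \<and> 36000 * real d * L / \<eta> \<le> real m \<and> 2 * real m + 1 \<le> L ^ 5" by blast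
qed

text \<open>
  The net has at most \<open>L\<close> to the power \<open>5 * d\<close> elements and each of them fails with probability at most
  \<open>2 * L\<close> to the power \<open>- 6 * d * (d + q)\<close>. The product is at most \<open>2 * L\<close> to the power \<open>- q\<close>, as
  \<open>5 * d + q \<le> 6 * d * (d + q)\<close>.
\<close>

lemma failure_probability_bound:
  fixes L q m :: real and d n :: nat
  assumes n: "0 < n" "L = ln (real n)" and L: "1 \<le> ln L" "ln 64 \<le> L" "0 < L" and d: "1 \<le> d" and q: "1 \<le> q"
    and m: "0 \<le> m" "2 * m + 1 \<le> L ^ 5"
  defines "\<eta> \<equiv> 12 * real d * (real d + q) * (ln L / L)"
  shows "(8 / real n) powr \<eta> \<le> 1 / 2"
    and "2 * (2 * m + 1) ^ d * (8 / real n) powr \<eta> \<le> 3 ^ (d + 3) * L powr (- q)"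
proof -
  define D where "D = 6 * real d * (real d + q)"
  have dq: "1 \<le> real d" using d by simp
  have L2: "2 \<le> L"
  proof -
    have "exp 1 \<le> L" using L by (simp add: ln_ge_iff)
    moreover have "2 \<le> exp (1::real)" using exp_ge_add_one_self[of 1] by simp
    ultimately show ?thesis by linarith
  qed
  have "(8 / real n) powr \<eta> = exp (\<eta> * (ln 8 - L))"
    using n by (simp add: powr_def ln_div)
  also have "\<dots> \<le> exp (\<eta> * (- (L / 2)))"
  proof -
    have "ln (64::real) = 2 * ln 8"
      using ln_mult[of "8::real" 8] by simp
    then have "ln 8 - L \<le> - (L / 2)" using L(2) by linarith
    moreover have "0 \<le> \<eta>" unfolding \<eta>_def using L L2 q by (intro mult_nonneg_nonneg divide_nonneg_nonneg) auto
    ultimately show ?thesis by (simp only: exp_le_cancel_iff) (rule mult_left_mono)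
  qed
  also have "\<eta> * (- (L / 2)) = - D * ln L" using L(3) by (simp add: \<eta>_def D_def)
  also have "exp (- D * ln L) = L powr (- D)" using L(3) by (simp add: powr_def)
  finally have p: "(8 / real n) powr \<eta> \<le> L powr (- D)" .
  have D1: "5 * real d + q \<le> D"
  proof -
    have "1 * real d \<le> real d * real d" "1 * q \<le> real d * q" using dq q by (intro mult_right_mono; simp)+
    moreover have "D = 6 * (real d * real d) + 6 * (real d * q)" by (simp add: D_def algebra_simps)
    moreover have "0 \<le> real d * real d" "0 \<le> real d * q" using q by auto
    ultimately show ?thesis by linarith
  qed
  have "L powr (- D) \<le> L powr (- 1)" using D1 dq q L2 by (intro powr_mono) auto
  also have "\<dots> \<le> 1 / 2" using L2 by (simp add: powr_minus_divide)
  finally show "(8 / real n) powr \<eta> \<le> 1 / 2" using p by linarith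
  have "(2 * m + 1) ^ d \<le> (L ^ 5) ^ d" using m by (intro power_mono) auto
  also have "\<dots> = L powr (5 * real d)" using L(3) by (simp add: powr_realpow flip: power_mult of_nat_mult)
      (metis of_nat_mult of_nat_numeral powr_realpow)
  finally have "2 * (2 * m + 1) ^ d * (8 / real n) powr \<eta> \<le> 2 * L powr (5 * real d) * L powr (- D)"
    using p m by (intro mult_mono) auto
  also have "\<dots> = 2 * L powr (5 * real d - D)" by (simp flip: powr_add)
  also have "\<dots> \<le> 2 * L powr (- q)" using D1 L2 by (intro mult_left_mono powr_mono) auto
  also have "\<dots> \<le> 3 ^ (d + 3) * L powr (- q)"
  proof (rule mult_right_mono)
    have "(2::real) \<le> 3 ^ 1" by simp
    also have "\<dots> \<le> 3 ^ (d + 3)" by (intro power_increasing) auto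
    finally show "(2::real) \<le> 3 ^ (d + 3)" .
  qed simp
  finally show "2 * (2 * m + 1) ^ d * (8 / real n) powr \<eta> \<le> 3 ^ (d + 3) * L powr (- q)" .
qed

theorem theorem1:
  shows "\<exists>c c' c'' :: real. c > 0 \<and> c' > 0 \<and> c'' > 0 \<and>
    (\<forall>(q::real) (d::nat) (n::nat) (\<mu> :: (nat \<Rightarrow> real) measure).
       q \<ge> 1 \<longrightarrow> d \<ge> 1 \<longrightarrow>
       real n \<ge> c * exp (exp (5 * real d)) + c' * exp (q ^ 3) \<longrightarrow>
       prob_space \<mu> \<longrightarrow> has_log_concave_density d \<mu> \<longrightarrow>
       measure (PiM {..<n} (\<lambda>_. \<mu>))
         {x \<in> space (PiM {..<n} (\<lambda>_. \<mu>)).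
            log_Hausdorff_dist d (convex hull (x ` {..<n})) (floating_body d \<mu> (1 / real n))
              \<le> ereal (1 + c'' * real d * (real d + q) * (ln (ln (real n)) / ln (real n)))}
         \<ge> 1 - 3 ^ (d + 3) * ln (real n) powr (- q))"
proof -
  obtain L0 :: real where L0: "0 < L0" "\<forall>L\<ge>L0. 144 * ((ln L) ^ 3 / 25 + (ln L)\<^sup>2 * L powr (1 / 3) / 5) \<le> L \<and>
     1 \<le> ln L \<and> ln 64 \<le> L \<and> 2 * (36000 * L ^ 3 + 1) + 1 \<le> L ^ 5"
    using large_parameter_exists by blast
  have main: "1 - 3 ^ (d + 3) * ln (real n) powr (- q) \<le> measure (PiM {..<n} (\<lambda>_. \<mu>))
         {x \<in> space (PiM {..<n} (\<lambda>_. \<mu>)).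
            log_Hausdorff_dist d (convex hull (x ` {..<n})) (floating_body d \<mu> (1 / real n))
              \<le> ereal (1 + 144 * real d * (real d + q) * (ln (ln (real n)) / ln (real n)))}"
    if q: "1 \<le> q" and d: "1 \<le> d" and n: "real n \<ge> exp L0 * exp (exp (5 * real d)) + 1 * exp (q ^ 3)"
      and "prob_space \<mu>" "has_log_concave_density d \<mu>" for q :: real and d n :: nat and \<mu>
  proof -
    interpret prob_space \<mu> by fact
    interpret log_concave_measure \<mu> d by unfold_locales fact
    define L where "L = ln (real n)"
    define \<eta> where "\<eta> = 12 * real d * (real d + q) * (ln L / L)"
    note size = le_ln_of_sample_size[OF n[unfolded mult_1] L0(1), folded L_def]
    have L: "144 * ((ln L) ^ 3 / 25 + (ln L)\<^sup>2 * L powr (1 / 3) / 5) \<le> L" "1 \<le> ln L" "ln 64 \<le> L"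
      "2 * (36000 * L ^ 3 + 1) + 1 \<le> L ^ 5"
      using L0(2) size(1) by blast+
    have Lpos: "0 < L" using size(1) L0(1) by simp
    note par = parameters[OF L(1,2,4) Lpos d size(2) q size(3), folded \<eta>_def]
    obtain m where m: "0 < m" "36000 * real d * L / \<eta> \<le> real m" "2 * real m + 1 \<le> L ^ 5" using par(3) by blast
    have n64: "64 \<le> real n"
    proof -
      have "0 < n" by (rule gr0I) (use Lpos in \<open>simp add: L_def\<close>)
      then show ?thesis using L(3) by (simp add: L_def)
    qed
    then have n16: "16 \<le> n" "0 < n" "2 < real n" by auto
    note fail = failure_probability_bound[OF n16(2) L_def L(2,3) Lpos d q _ m(3), folded \<eta>_def]
    have eq: "1 + 144 * real d * (real d + q) * (ln L / L) = 1 + 12 * \<eta>" by (simp add: \<eta>_def)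
    have "1 - 3 ^ (d + 3) * L powr (- q) \<le> 1 - 2 * (2 * real m + 1) ^ d * (8 / real n) powr \<eta>"
      using fail(2) by simp
    also have "\<dots> \<le> measure (sample n) {x \<in> space (sample n).
        log_Hausdorff_dist d (convex hull (x ` {..<n})) (floating_body d \<mu> (1 / real n)) \<le> ereal (1 + 12 * \<eta>)}"
      by (intro prob_log_Hausdorff_dist d n16(1) par(1,2) fail(1) m(1) m(2)[unfolded L_def]
          measurable_log_Hausdorff_dist_le sets_eq n16(2) convex_floating_body floating_body_sets n16(3)) simp
    finally show ?thesis unfolding L_def[symmetric] eq .
  qed
  show ?thesis
    \<comment> \<open>144 is the product of the factor 12 in the bound 1 + 12 \<eta> and of the factor 12 in the definition of \<eta>.\<close>
    by (rule exI[of _ "exp L0"], rule exI[of _ 1], rule exI[of _ 144]) (use main in simp)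
qed

end
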